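(* Let $r=\bigl(2\sqrt3+1-2\sqrt{1+\sqrt3}\bigr)/3$. The compact packings of the plane using discs of radius $1$ and $r$ are exactly the packings obtained as follows: start with a triangular lattice packing by discs of radius $1$, choose a nonempty subset $S$ of its discs such that no two discs in $S$ are tangent, and replace each disc in $S$ by a hexagonal block of $7$ discs of radius $r$.
   Context: A packing of the plane is a collection of closed discs in $\mathbb{R}^2$ with pairwise disjoint interiors. A packing is compact if for every disc $D$ of the packing, the discs of the packing tangent to $D$, listed in cyclic order around $D$ as $D_1,\dots,D_n$ (with $D_{n+1}=D_1$), are such that $D_i$ is tangent to $D_{i+1}$ for $i=1,\dots,n$, and this chain surrounds $D$: the angles, in $(0,\pi)$, at the centre of $D$ in the triangles with vertices the centres of $D,D_i,D_{i+1}$ sum to $2\pi$. A compact packing using discs of radius $1$ and $r$ is a compact packing in which every disc has radius $1$ or $r$ and discs of both radii occur. The triangular lattice packing is the packing by discs of radius $1$ in which each disc is tangent to six others. Replacing a disc $D$ of it by a hexagonal block means: remove $D$, put a disc of radius $r$ concentric with $D$, and put six further discs of radius $r$ tangent to this one, each consecutive pair of them tangent, oriented so that each of the six is tangent to two (mutually tangent) of the six radius-$1$ discs that surrounded $D$. *)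

theory Defs
  imports "HOL-Analysis.Analysis"
begin

text \<open>
  The Euclidean plane is modelled by the complex numbers. A closed disc is encoded by the pair of
  its centre and its radius; positivity of the radii is part of the definition of a packing.
\<close>

type_synonym disc = "complex \<times> real"

abbreviation centre :: "disc \<Rightarrow> complex" where
  "centre D \<equiv> fst D"

abbreviation radius :: "disc \<Rightarrow> real" where
  "radius D \<equiv> snd D"

definition region :: "disc \<Rightarrow> complex set" where
  "region D = cball (centre D) (radius D)"

definition packing :: "disc set \<Rightarrow> bool" where
  "packing P \<longleftrightarrow> (\<forall>D\<in>P. 0 < radius D) \<and>
     pairwise (\<lambda>D E. interior (region D) \<inter> interior (region E) = {}) P"

text \<open>
  This is external tangency, the only one possible between discs with disjoint interiors. It is
  irreflexive on discs of positive radius.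
\<close>

definition tangent :: "disc \<Rightarrow> disc \<Rightarrow> bool" where
  "tangent D E \<longleftrightarrow> dist (centre D) (centre E) = radius D + radius E"

definition neighbours :: "disc set \<Rightarrow> disc \<Rightarrow> disc set" where
  "neighbours P D = {E \<in> P. tangent D E}"

text \<open>
  The angle at \<open>c\<close> of the triangle \<open>c p q\<close>. It lies in the open interval from \<open>0\<close> to \<open>pi\<close> whenever
  the triangle is nondegenerate, in particular for the centres of three mutually tangent discs.
\<close>

definition angle_at :: "complex \<Rightarrow> complex \<Rightarrow> complex \<Rightarrow> real" where
  "angle_at c p q = arccos (((p - c) \<bullet> (q - c)) / (norm (p - c) * norm (q - c)))"

text \<open>
  The points of \<open>zs\<close> are listed counterclockwise as seen from \<open>c\<close>, in a single turn: directions are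
  measured from that of the first point, as angles in \<open>[0, 2 pi)\<close>.
\<close>

definition cyclic_order :: "complex \<Rightarrow> complex list \<Rightarrow> bool" where
  "cyclic_order c zs \<longleftrightarrow> sorted_wrt (<) (map (\<lambda>z. Arg2pi ((z - c) / (hd zs - c))) zs)"

definition corona :: "disc set \<Rightarrow> disc \<Rightarrow> disc list \<Rightarrow> bool" where
  "corona P D Ds \<longleftrightarrow> set Ds = neighbours P D \<and> cyclic_order (centre D) (map centre Ds)"

text \<open>
  The choice of the corona is immaterial: two of them differ by a rotation of the list. An empty
  corona is excluded since its angle sum is \<open>0\<close>.
\<close>

definition compact_packing :: "disc set \<Rightarrow> bool" where
  "compact_packing P \<longleftrightarrow> packing P \<and>
     (\<forall>D\<in>P. \<exists>Ds. corona P D Ds \<and>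
        (\<forall>i<length Ds. tangent (Ds ! i) (Ds ! (Suc i mod length Ds))) \<and>
        (\<Sum>i<length Ds.
           angle_at (centre D) (centre (Ds ! i)) (centre (Ds ! (Suc i mod length Ds)))) = 2 * pi)"

definition compact_packing_using :: "real \<Rightarrow> disc set \<Rightarrow> bool" where
  "compact_packing_using r P \<longleftrightarrow> compact_packing P \<and> (\<forall>D\<in>P. radius D = 1 \<or> radius D = r) \<and>
     (\<exists>D\<in>P. radius D = 1) \<and> (\<exists>D\<in>P. radius D = r)"

text \<open>
  The centres of six unit discs tangent to a given one and not overlapping form a regular
  hexagon, so that the condition below determines the packing up to isometry.
\<close>

definition triangular_lattice_packing :: "disc set \<Rightarrow> bool" where
  "triangular_lattice_packing T \<longleftrightarrow> T \<noteq> {} \<and> packing T \<and>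
     (\<forall>D\<in>T. radius D = 1) \<and> (\<forall>D\<in>T. card (neighbours T D) = 6)"

definition hexagonal_block :: "real \<Rightarrow> disc set \<Rightarrow> disc \<Rightarrow> disc set \<Rightarrow> bool" where
  "hexagonal_block r T D B \<longleftrightarrow>
     (\<exists>bs. length bs = 6 \<and> distinct bs \<and> B = insert (centre D, r) (set bs) \<and>
        (\<forall>i<6. radius (bs ! i) = r \<and>
           tangent (bs ! i) (centre D, r) \<and>
           tangent (bs ! i) (bs ! (Suc i mod 6)) \<and>
           (\<exists>E\<in>neighbours T D. \<exists>F\<in>neighbours T D.
              tangent E F \<and> tangent (bs ! i) E \<and> tangent (bs ! i) F)))"

text \<open>\<open>P\<close> arises from \<open>T\<close> by replacing every disc in \<open>S\<close> by a hexagonal block.\<close>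

definition block_replacement :: "real \<Rightarrow> disc set \<Rightarrow> disc set \<Rightarrow> disc set \<Rightarrow> bool" where
  "block_replacement r T S P \<longleftrightarrow>
     (\<exists>B. (\<forall>D\<in>S. hexagonal_block r T D (B D)) \<and> P = (T - S) \<union> (\<Union>D\<in>S. B D))"

end

theory Submission
  imports Defs
begin

text \<open>
  Write \<open>s\<close> for the height \<open>sqrt 3 - 2 * r\<close> of the triangle of two unit discs and a small disc, all
  tangent, and \<open>alpha\<close> for the angle at a small disc between a unit disc and a small disc. The choice
  of \<open>r\<close> makes the angle between two unit discs \<open>4 * pi / 3 - 2 * alpha\<close>, and \<open>pi / 3 < alpha < 5 * pi / 12\<close>
  already forces the corona of a small disc to be six small discs or, cyclically, two unit discs
  followed by three small ones. In the second case the middle one of the three small discs has six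
  small neighbours. Two tangent discs with six small neighbours would spread over the whole
  plane, leaving no room for a unit disc; hence every disc with six small neighbours is the centre
  of a block, the block is ringed by six unit discs in a regular hexagon, and it can be
  exchanged for a unit disc. The resulting centres are at distance at least 2, and whenever
  \<open>c\<close> and \<open>d\<close> are centres at distance 2, so is the rotation of \<open>d\<close> about \<open>c\<close> by \<open>pi / 3\<close>.

  Conversely, six unit discs around a unit disc are at angles multiple of \<open>pi / 3\<close>, a block is
  determined up to the numbering of its discs, and consecutive neighbours of a disc that subtend the
  angle of three mutually tangent discs are tangent, so that the angle sum telescopes.
\<close>

section \<open>Sixth roots of unity\<close>

text \<open>The radius comes from the block itself. From the centre of a block to the midpoint
  between two tangent unit discs of its ring the distance is \<open>sqrt 3\<close>: first
  \<open>2 * r\<close> to an outer small disc, then the height \<open>s\<close>. Pythagoras,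
  \<open>s^2 + 1 = (1 + r)^2\<close>, is a quadratic equation in \<open>r\<close> whose roots have
  product 1, and the smaller root is the radius. The metric facts rest on this equation and on crude
  decimal bounds. The obstacle is that a compact packing is given by local data only: no lattice is
  at hand, and the directions found at one disc do not give those at the next. Hence lattices appear
  as \<open>hexagonal\<close> sets, separated by 2 and containing around each point a hexagon whose
  orientation is chosen afresh. Global coordinates are never computed; a turn by
  \<open>pi / 3\<close> about each point is enough. Likewise the spreading of discs with six small
  neighbours is used only through a descent toward one unit disc.\<close>

definition omega :: complex where
  "omega = Complex (1/2) (sqrt 3 / 2)"

text \<open>The sixth roots of unity in the basis \<open>1\<close>, \<open>omega\<close>. With
  \<open>omega * omega = omega - 1\<close> products reduce to the same basis, so finite case
  distinctions are settled by rewriting.\<close>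

definition hexagon :: "complex set" where
  "hexagon = {1, omega, omega - 1, -1, -omega, 1 - omega}"

lemma Re_omega [simp]: "Re omega = 1/2" and Im_omega [simp]: "Im omega = sqrt 3 / 2"
  by (simp_all add: omega_def)

lemma omega_square: "omega * omega = omega - 1"
  by (simp add: complex_eq_iff)

lemma cis_pi_div_3: "cis (pi/3) = omega"
  by (simp add: complex_eq_iff cos_60 sin_60)

lemma norm_omega [simp]: "cmod omega = 1"
  by (metis cis_pi_div_3 norm_cis)

lemma norm_hexagon: "h \<in> hexagon \<Longrightarrow> cmod h = 1"
  by (auto simp: hexagon_def cmod_def power_divide)

lemma card_hexagon: "card hexagon = 6"
  by (simp add: hexagon_def complex_eq_iff)

lemma finite_hexagon [simp]: "finite hexagon"
  by (simp add: hexagon_def)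

lemma one_in_hexagon [simp]: "1 \<in> hexagon" and omega_in_hexagon [simp]: "omega \<in> hexagon"
  and minus_one_in_hexagon [simp]: "-1 \<in> hexagon"
  and one_minus_omega_in_hexagon [simp]: "1 - omega \<in> hexagon"
  by (simp_all add: hexagon_def)

lemma hexagon_minus: "h \<in> hexagon \<Longrightarrow> -h \<in> hexagon"
  by (auto simp: hexagon_def)

lemma hexagon_omega_mult: "h \<in> hexagon \<Longrightarrow> omega * h \<in> hexagon"
  unfolding hexagon_def
  by (elim insertE emptyE; simp add: right_diff_distrib omega_square)

lemma hexagon_mult:
  assumes "g \<in> hexagon" "h \<in> hexagon" shows "g * h \<in> hexagon"
proof -
  have 1: "(omega - 1) * h = omega * (omega * h)"
    by (simp add: omega_square flip: mult.assoc)
  have "(1 - omega) * h = - ((omega - 1) * h)"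
    by (simp add: algebra_simps)
  with 1 have 2: "(1 - omega) * h = - (omega * (omega * h))"
    by simp
  consider "g = 1" | "g = omega" | "g = omega - 1" | "g = -1" | "g = -omega" | "g = 1 - omega"
    using assms(1) by (auto simp: hexagon_def)
  then show ?thesis
    by cases (use assms(2) in \<open>simp_all add: 1 2 hexagon_omega_mult hexagon_minus\<close>)
qed

lemma hexagon_inverse:
  assumes "h \<in> hexagon" obtains g where "g \<in> hexagon" "g * h = 1" "h * g = 1"
proof -
  have "\<exists>g\<in>hexagon. g * h = 1"
    using assms unfolding hexagon_def
    by (elim insertE emptyE; hypsubst; simp add: right_diff_distrib left_diff_distrib omega_square)
  then show ?thesis
    using that by (auto simp: mult.commute)
qed

lemma hexagon_mult_image:
  assumes "h \<in> hexagon" shows "(\<lambda>g. g * h) ` hexagon = hexagon"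
proof
  show "(\<lambda>g. g * h) ` hexagon \<subseteq> hexagon"
    using assms hexagon_mult by blast
  obtain k where k: "k \<in> hexagon" "k * h = 1"
    using assms by (rule hexagon_inverse)
  show "hexagon \<subseteq> (\<lambda>g. g * h) ` hexagon"
  proof
    fix g assume "g \<in> hexagon"
    with k have "g * k \<in> hexagon" "g = (g * k) * h"
      by (auto simp: hexagon_mult mult.assoc)
    then show "g \<in> (\<lambda>g. g * h) ` hexagon" by blast
  qed
qed

text \<open>A ring of six points has no first one: the direction describing it may be replaced by
  any of the six.\<close>

lemma hexagon_image_rotate:
  assumes "h \<in> hexagon"
  shows "(\<lambda>g. f (g * (h * u))) ` hexagon = (\<lambda>g. f (g * u)) ` hexagon"
  (is "?l = ?r")
proof -
  have "?l = (\<lambda>g. f (g * u)) ` (\<lambda>g. g * h) ` hexagon"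
    by (simp add: image_image mult.assoc)
  then show ?thesis
    using assms by (simp add: hexagon_mult_image)
qed

lemma hexagon_dist_ge:
  assumes "g \<in> hexagon" "h \<in> hexagon" "g \<noteq> h"
  shows "1 \<le> cmod (g - h)"
proof -
  obtain k where k: "k \<in> hexagon" "k * h = 1"
    using assms(2) by (rule hexagon_inverse)
  have "g - h = h * (g * k - 1)"
    using k by (metis mult.commute mult.left_commute mult.right_neutral right_diff_distrib)
  then have "cmod (g - h) = cmod (g * k - 1)"
    by (simp add: norm_mult norm_hexagon assms)
  moreover have "g * k \<in> hexagon" "g * k \<noteq> 1"
    using assms k hexagon_mult
     apply blast
    by (metis assms(3) k(2) mult.commute mult.left_commute mult.right_neutral)
  moreover have "1 \<le> cmod (m - 1)" if "m \<in> hexagon" "m \<noteq> 1" for m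
    using that unfolding hexagon_def
    by (elim insertE emptyE; hypsubst) (simp_all add: cmod_def power_divide)
  ultimately show ?thesis by simp
qed

text \<open>After division by \<open>h\<close> only the roots with real part \<open>1/2\<close> are
  at distance 1 from 1. Since \<open>1 - omega\<close> is the inverse of \<open>omega\<close>, the
  alternatives are the turns by \<open>pi / 3\<close> in either sense.\<close>

lemma hexagon_adjacent:
  assumes "g \<in> hexagon" "h \<in> hexagon" "cmod (g - h) = 1"
  shows "g = omega * h \<or> g = (1 - omega) * h"
proof -
  obtain k where k: "k \<in> hexagon" "k * h = 1" using assms(2) by (rule hexagon_inverse)
  have gk: "g = (g * k) * h" using k by simp
  have gkH: "g * k \<in> hexagon" using hexagon_mult assms k by blast
  have "g - h = (g * k - 1) * h"
    using k by (simp add: algebra_simps)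
  then have "cmod (g * k - 1) = 1"
    using assms by (simp add: norm_mult norm_hexagon)
  then have "(cmod (g * k - 1))\<^sup>2 = 1" by simp
  moreover have "m = omega \<or> m = 1 - omega" if "m \<in> hexagon" "(cmod (m - 1))\<^sup>2 = 1" for m
    using that unfolding hexagon_def
    by (elim insertE emptyE; hypsubst) (simp_all add: cmod_power2 power_divide)
  ultimately show ?thesis using gkH gk by metis
qed

text \<open>Five successive turns reach the other roots. Closure results are proved for the single
  rotation by \<open>omega\<close> and extended to whole hexagons in this way.\<close>

lemma hexagon_closed:
  assumes "\<And>U. U \<in> A \<Longrightarrow> omega * U \<in> A" "U \<in> A" "h \<in> hexagon"
  shows "h * U \<in> A"
proof -
  have eqs: "omega * (omega * U) = (omega - 1) * U" "omega * ((omega - 1) * U) = - 1 * U"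
    "omega * (- 1 * U) = - omega * U" "omega * (- omega * U) = (1 - omega) * U"
    by (simp_all add: omega_square right_diff_distrib left_diff_distrib flip: mult.assoc)
  note 1 = assms(1)[OF assms(2)]
  note 2 = assms(1)[OF 1, unfolded eqs]
  note 3 = assms(1)[OF 2, unfolded eqs]
  note 4 = assms(1)[OF 3, unfolded eqs]
  note 5 = assms(1)[OF 4, unfolded eqs]
  consider "h = 1" | "h = omega" | "h = omega - 1" | "h = -1" | "h = -omega" | "h = 1 - omega"
    using assms(3) by (auto simp: hexagon_def)
  then show ?thesis
    by cases (use assms(2) 1 2 3 4 5 in simp_all)
qed

text \<open>One of six equally spaced directions makes an angle of at most \<open>pi / 6\<close>
  with \<open>z\<close>, and \<open>cos (pi / 6)\<close> is \<open>sqrt 3 / 2\<close>.\<close>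

lemma hexagon_nearest:
  assumes "cmod u = 1"
  obtains h where "h \<in> hexagon" "sqrt 3 / 2 * cmod z \<le> Re (z * cnj (h * u))"
proof -
  define w where "w = z * cnj u"
  have cw: "cmod w = cmod z"
    using assms by (simp add: w_def norm_mult)
  define x y where "x = Re w" and "y = Im w"
  have ex: "\<exists>h\<in>hexagon. sqrt 3 / 2 * cmod w \<le> Re (w * cnj h)"
  proof (rule ccontr)
    assume "\<not> ?thesis"
    then have *: "Re (w * cnj h) < sqrt 3 / 2 * cmod w" if "h \<in> hexagon" for h
      using that by fastforce
    \<comment> \<open>Since \<open>-h\<close> is also a root, the bound holds for the absolute value
      and can be squared. The cases 1, \<open>omega\<close> and \<open>1 - omega\<close> then
      contradict one another.\<close>
    have sq: "(Re (w * cnj h))\<^sup>2 < 3 / 4 * (x\<^sup>2 + y\<^sup>2)" if "h \<in> hexagon" for h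
    proof -
      have "\<bar>Re (w * cnj h)\<bar> < sqrt 3 / 2 * cmod w"
        using *[OF that] *[OF hexagon_minus[OF that]] by (simp only: abs_less_iff) simp
      then have "\<bar>Re (w * cnj h)\<bar>\<^sup>2 < (sqrt 3 / 2 * cmod w)\<^sup>2"
        by (intro power_strict_mono) auto
      then show ?thesis
        by (simp add: power_mult_distrib power_divide cmod_power2 x_def y_def)
    qed
    have 1: "x\<^sup>2 < 3 * y\<^sup>2"
      using sq[of 1] by (simp add: x_def y_def)
    have 2: "sqrt 3 * (x * y) < x\<^sup>2"
      using sq[of omega] by (simp add: flip: x_def y_def) (simp add: power2_eq_square algebra_simps)
    have 3: "- (sqrt 3 * (x * y)) < x\<^sup>2"
      using sq[of "1 - omega"] by (simp add: flip: x_def y_def) (simp add: power2_eq_square algebra_simps)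
    have "x\<^sup>2 > 0" using 2 3 by linarith
    have "(sqrt 3 * (x * y))\<^sup>2 < (x\<^sup>2)\<^sup>2"
      using 2 3 by (metis abs_less_iff abs_of_nonneg minus_less_iff power2_abs power2_less_eq_zero_iff zero_le_power2 power_strict_mono abs_ge_zero pos2)
    then have "x\<^sup>2 * (3 * y\<^sup>2) < x\<^sup>2 * x\<^sup>2"
      by (simp add: power_mult_distrib power2_eq_square algebra_simps)
    then have "3 * y\<^sup>2 < x\<^sup>2"
      using \<open>x\<^sup>2 > 0\<close> mult_less_cancel_left_pos by blast
    with 1 show False by simp
  qed
  then show ?thesis
    using that cw by (auto simp: w_def mult_ac)
qed

text \<open>The law of cosines for a step of length \<open>a\<close> in the best direction. It
  serves with \<open>a = 2 * r\<close> for the descent through small discs and with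
  \<open>a = 2\<close> for points around a hexagon of unit discs.\<close>

lemma hexagon_nearest_dist:
  assumes "cmod u = 1" "0 \<le> a"
  obtains h where "h \<in> hexagon"
    "(cmod (z - a * (h * u)))\<^sup>2 \<le> (cmod z)\<^sup>2 + a\<^sup>2 - a * (sqrt 3 * cmod z)"
proof -
  obtain h where h: "h \<in> hexagon" "sqrt 3 / 2 * cmod z \<le> Re (z * cnj (h * u))"
    using assms(1) by (rule hexagon_nearest)
  have "cmod (h * u) = 1"
    using assms h by (simp add: norm_mult norm_hexagon)
  then have "(Re (h * u))\<^sup>2 + (Im (h * u))\<^sup>2 = 1"
    by (metis cmod_power2 one_power2)
  then have "(cmod (z - a * (h * u)))\<^sup>2 = (cmod z)\<^sup>2 + a\<^sup>2 - 2 * a * Re (z * cnj (h * u))"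
    unfolding cmod_power2
    by (simp del: times_complex.sel add: complex_mult_cnj times_complex.sel(1)[of z] Re_complex_of_real)
      (simp add: power2_eq_square, algebra)
  moreover have "2 * a * (sqrt 3 / 2 * cmod z) \<le> 2 * a * Re (z * cnj (h * u))"
    by (rule mult_left_mono[OF h(2)]) (simp add: assms)
  ultimately show ?thesis
    using that[OF h(1)] by (simp add: mult_ac)
qed

section \<open>Packings as separation conditions on centres\<close>

lemma packing_iff:
  "packing P \<longleftrightarrow> (\<forall>D\<in>P. 0 < radius D) \<and>
     (\<forall>D\<in>P. \<forall>E\<in>P. D \<noteq> E \<longrightarrow> radius D + radius E \<le> dist (centre D) (centre E))"
proof -
  have "ball a s \<inter> ball b t = {} \<longleftrightarrow> s + t \<le> dist a b" if "0 < s" "0 < t" for a b :: complex and s t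
  proof
    assume "s + t \<le> dist a b"
    then show "ball a s \<inter> ball b t = {}" by (rule disjoint_ballI)
  next
    assume *: "ball a s \<inter> ball b t = {}"
    show "s + t \<le> dist a b"
    proof (rule ccontr)
      assume "\<not> s + t \<le> dist a b"
      then have d: "dist a b < s + t" by simp
      \<comment> \<open>The point dividing the segment in the ratio \<open>s : t\<close> lies in
        both balls when they are too close.\<close>
      define p where "p = a + (s / (s + t)) *\<^sub>R (b - a)"
      have "p - b = - (t / (s + t)) *\<^sub>R (b - a)"
        using that by (simp add: p_def complex_eq_iff field_simps)
      then have "cmod (p - b) = t / (s + t) * cmod (b - a)"
        using that by (simp del: scaleR_minus_left)
      then have "dist b p = t / (s + t) * dist a b"
        by (simp add: dist_norm norm_minus_commute)
      moreover have "dist a p = s / (s + t) * dist a b"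
        using that by (simp add: p_def dist_norm norm_minus_commute)
      moreover have "t / (s + t) * dist a b < t" "s / (s + t) * dist a b < s"
        using that mult_strict_left_mono[OF d, of t] mult_strict_left_mono[OF d, of s]
        by (simp_all add: field_simps)
      ultimately have "p \<in> ball a s \<inter> ball b t" by simp
      with * show False by blast
    qed
  qed
  then show ?thesis
    unfolding packing_def pairwise_def region_def interior_cball by blast
qed

section \<open>Coronas in polar coordinates\<close>

lemma angle_at_cis:
  fixes \<rho> \<sigma> :: real
  assumes "0 < \<rho>" "0 < \<sigma>" "cmod v = 1"
  shows "angle_at c (c + \<rho> * cis a * v) (c + \<sigma> * cis b * v) = arccos (cos (b - a))"
proof -
  have v: "Re v * Re v + Im v * Im v = 1"
    using assms(3) by (metis cmod_power2 one_power2 power2_eq_square)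
  have "(\<rho> * cis a * v) \<bullet> (\<sigma> * cis b * v) = \<rho> * \<sigma> * cos (b - a) * (Re v * Re v + Im v * Im v)"
    by (simp add: inner_complex_def cos_diff algebra_simps)
  then show ?thesis
    using assms by (simp add: angle_at_def norm_mult v)
qed

text \<open>
  The angle of a triangle is at most the counterclockwise gap between its sides. Both kinds of angles
  sum to \<open>2 * pi\<close> along a corona, so they agree, and consecutive centres differ by a rotation.
\<close>

lemma compact_packing_corona:
  assumes "compact_packing P" "D \<in> P"
  obtains n :: nat and X :: "nat \<Rightarrow> disc" where "0 < n" "\<And>j. neighbours P D = X ` {j..<j + n}" "\<And>i. X (i + n) = X i"
    "\<And>i. tangent (X i) (X (Suc i))"
    "(\<Sum>i<n. angle_at (centre D) (centre (X i)) (centre (X (Suc i)))) = 2 * pi"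
    "\<And>i. centre (X (Suc i)) - centre D =
       (radius D + radius (X (Suc i))) / (radius D + radius (X i)) *
       cis (angle_at (centre D) (centre (X i)) (centre (X (Suc i)))) * (centre (X i) - centre D)"
proof -
  define c where "c = centre D"
  obtain Ds where cor: "corona P D Ds"
    and tan: "\<And>i. i < length Ds \<Longrightarrow> tangent (Ds ! i) (Ds ! (Suc i mod length Ds))"
    and ang: "(\<Sum>i<length Ds. angle_at c (centre (Ds ! i)) (centre (Ds ! (Suc i mod length Ds)))) = 2 * pi"
    using assms unfolding compact_packing_def c_def by blast
  define n where "n = length Ds"
  \<comment> \<open>Indices wrap modulo \<open>n\<close>, so that a corona can be read from any
    starting disc.\<close>
  define X where "X i = Ds ! (i mod n)" for i
  have n: "0 < n"
    using ang by (cases Ds) (auto simp: n_def)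
  have pos: "0 < radius E" if "E \<in> P" for E
    using assms(1) that by (auto simp: compact_packing_def packing_def)
  have nb: "X i \<in> neighbours P D" for i
    using cor n by (metis X_def corona_def mod_less_divisor n_def nth_mem)
  have tD: "cmod (centre (X i) - c) = radius D + radius (X i)" for i
    using nb[of i] by (auto simp: neighbours_def tangent_def dist_norm c_def norm_minus_commute[of _ "centre D"])
  have rpos: "0 < radius D + radius (X i)" for i
    using nb[of i] pos[of D] pos[of "X i"] assms(2) by (simp add: neighbours_def)
  have tX: "tangent (X i) (X (Suc i))" for i
    using tan[of "i mod n"] n unfolding X_def n_def[symmetric] by (simp add: mod_Suc_eq)
  have per: "X (i + n) = X i" for i by (simp add: X_def)
  define v where "v = (centre (X 0) - c) / (radius D + radius (X 0))"
  have v: "cmod v = 1"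
    using rpos[of 0] by (simp add: v_def norm_divide tD del: of_real_add)
  \<comment> \<open>Index \<open>n\<close> is the first disc again, but with argument
    \<open>2 * pi\<close> instead of 0, so that the gaps telescope to a full turn.\<close>
  define A where "A i = (if i < n then Arg2pi ((centre (X i) - c) / (centre (X 0) - c)) else 2 * pi)" for i
  have A0: "A 0 = 0"
    using n tD[of 0] rpos[of 0] by (auto simp: A_def Arg2pi_eq_0)
  have An: "A n = 2 * pi" by (simp add: A_def)
  have Aless: "A i < A (Suc i)" if "i < n" for i
  proof (cases "Suc i < n")
    case True
    have "cyclic_order c (map centre Ds)"
      using cor by (simp add: corona_def c_def)
    then have "sorted_wrt (<) (map (\<lambda>z. Arg2pi ((z - c) / (centre (X 0) - c))) (map centre Ds))"
      using n by (simp add: cyclic_order_def hd_map hd_conv_nth X_def n_def)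
    from sorted_wrt_nth_less[OF this, of i "Suc i"] show ?thesis
      using True by (simp add: n_def A_def X_def)
  next
    case False
    then show ?thesis using that by (simp add: A_def Arg2pi_lt_2pi)
  qed
  have Xpos: "centre (X i) = c + (radius D + radius (X i)) * cis (A i) * v" if "i < n" for i
  proof -
    let ?w = "(centre (X i) - c) / (centre (X 0) - c)"
    have "?w = cmod ?w * cis (A i)"
      using that Arg2pi_eq[of ?w] by (simp add: A_def cis_conv_exp)
    moreover have "centre (X 0) - c \<noteq> 0" using tD[of 0] rpos[of 0] by auto
    ultimately have "centre (X i) - c = cmod ?w * cis (A i) * (centre (X 0) - c)"
      by (metis nonzero_divide_eq_eq)
    also have "\<dots> = (radius D + radius (X i)) * cis (A i) * v"
      by (simp add: v_def norm_divide tD del: of_real_add)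
    finally show ?thesis by (simp add: algebra_simps)
  qed
  have Xpos': "centre (X (Suc i)) = c + (radius D + radius (X (Suc i))) * cis (A (Suc i)) * v" if "i < n" for i
  proof (cases "Suc i < n")
    case False
    then have "Suc i = n" using that by simp
    then have "X (Suc i) = X 0" "cis (A (Suc i)) = cis (A 0)"
      using per[of 0] A0 An by (simp_all add: cis_2pi)
    then show ?thesis using Xpos[OF n] by simp
  qed (rule Xpos)
  define g where "g i = angle_at c (centre (X i)) (centre (X (Suc i)))" for i
  have g: "g i = arccos (cos (A (Suc i) - A i))" if "i < n" for i
    unfolding g_def
    by (subst Xpos[OF that], subst Xpos'[OF that], rule angle_at_cis) (use rpos v in auto)
  have le: "g i \<le> A (Suc i) - A i" if "i < n" for i
  proof (cases "A (Suc i) - A i \<le> pi")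
    case True
    then show ?thesis using Aless[OF that] by (simp add: g[OF that] arccos_cos)
  next
    case False
    then show ?thesis using arccos_ubound[of "cos (A (Suc i) - A i)"] g[OF that] by simp
  qed
  have sumg: "(\<Sum>i<n. g i) = 2 * pi"
    unfolding ang[symmetric] n_def[symmetric] g_def X_def
    by (rule sum.cong) auto
  have "(\<Sum>i<n. A (Suc i) - A i) = 2 * pi"
    by (simp add: sum_lessThan_telescope A0 An)
  then have eq: "g i = A (Suc i) - A i" if "i < n" for i
    using sum_mono_inv[of g "{..<n}" "\<lambda>i. A (Suc i) - A i" i] sumg le that by auto
  have rot1: "centre (X (Suc i)) - c = (radius D + radius (X (Suc i))) / (radius D + radius (X i)) *
       cis (g i) * (centre (X i) - c)" if "i < n" for i
  proof -
    have "cis (A (Suc i)) = cis (g i) * cis (A i)"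
      by (simp add: cis_mult eq[OF that])
    moreover have "complex_of_real (radius D + radius (X i)) \<noteq> 0"
      using rpos[of i] by (metis less_irrefl of_real_eq_0_iff)
    ultimately show ?thesis
      using Xpos[OF that] Xpos'[OF that] by (simp del: of_real_add)
  qed
  have Xmod: "X (i mod n) = X i" "X (Suc (i mod n)) = X (Suc i)" for i
    by (simp_all add: X_def mod_Suc_eq)
  have rot: "centre (X (Suc i)) - c = (radius D + radius (X (Suc i))) / (radius D + radius (X i)) *
       cis (g i) * (centre (X i) - c)" for i
    using rot1[of "i mod n"] n by (simp add: Xmod g_def)
  have img: "neighbours P D = X ` {j..<j + n}" for j
  proof
    show "neighbours P D \<subseteq> X ` {j..<j + n}"
    proof
      fix E assume "E \<in> neighbours P D"
      then obtain i where i: "i < n" "E = X i"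
        using cor unfolding corona_def n_def by (metis X_def in_set_conv_nth mod_less n_def)
      \<comment> \<open>At least \<open>j\<close> and congruent to \<open>i\<close> modulo
        \<open>n\<close>: adding \<open>j * (n - 1)\<close> cancels \<open>j\<close> without
        subtracting it from \<open>i\<close>.\<close>
      define k where "k = j + (i + j * (n - 1)) mod n"
      have "k mod n = (j + (i + j * (n - 1))) mod n"
        by (simp add: k_def mod_add_right_eq)
      also have "j + (i + j * (n - 1)) = i + j * n"
        using n by (cases n) auto
      finally have "k mod n = i" using i by simp
      then have "X k = E" using i by (simp add: X_def)
      moreover have "k \<in> {j..<j + n}" using n by (simp add: k_def)
      ultimately show "E \<in> X ` {j..<j + n}" by blast
    qed
  qed (use nb in auto)
  show ?thesis
    by (rule that[OF n img per tX]) (use sumg rot in \<open>auto simp: g_def c_def\<close>)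
qed

text \<open>The law of cosines in the triangle of centres with sides \<open>R + x\<close>,
  \<open>R + y\<close> and \<open>x + y\<close>.\<close>

definition corona_angle :: "real \<Rightarrow> real \<Rightarrow> real \<Rightarrow> real" where
  "corona_angle R x y = arccos (((R + x)\<^sup>2 + (R + y)\<^sup>2 - (x + y)\<^sup>2) / (2 * (R + x) * (R + y)))"

lemma angle_at_tangent:
  assumes "tangent D E" "tangent D F" "tangent E F"
  shows "angle_at (centre D) (centre E) (centre F) = corona_angle (radius D) (radius E) (radius F)"
proof -
  let ?p = "centre E - centre D" and ?q = "centre F - centre D"
  have n: "norm ?p = radius D + radius E" "norm ?q = radius D + radius F"
    "norm (?p - ?q) = radius E + radius F"
    using assms by (simp_all add: tangent_def dist_norm norm_minus_commute)
  have "?p \<bullet> ?q = ((norm ?p)\<^sup>2 + (norm ?q)\<^sup>2 - (norm (?p - ?q))\<^sup>2) / 2"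
    by (simp add: power2_norm_eq_inner inner_diff inner_commute)
  then have "?p \<bullet> ?q = ((radius D + radius E)\<^sup>2 + (radius D + radius F)\<^sup>2 - (radius E + radius F)\<^sup>2) / 2"
    by (simp only: n)
  then show ?thesis
    by (simp only: angle_at_def n corona_angle_def mult.assoc divide_divide_eq_left)
qed

text \<open>The pair holds a radius and an angle measured from \<open>u\<close>. For
  \<open>u\<close> of modulus 1 and positive radii, tangency to \<open>D\<close> is built
  in.\<close>

definition polar_disc :: "disc \<Rightarrow> complex \<Rightarrow> real \<times> real \<Rightarrow> disc" where
  "polar_disc D u p = (centre D + (radius D + fst p) * cis (snd p) * u, fst p)"

text \<open>Repeating the first pair one turn later makes the cyclic condition one on consecutive
  entries. Steps of at most \<open>pi\<close> coincide with the angles of the triangles, so these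
  telescope to \<open>2 * pi\<close>.\<close>

lemma corona_criterion:
  fixes ps :: "(real \<times> real) list"
  assumes u: "cmod u = 1" and D: "0 < radius D" and ne: "ps \<noteq> []" and pos: "\<And>p. p \<in> set ps \<Longrightarrow> 0 < fst p"
    and nbs: "polar_disc D u ` set ps = neighbours P D"
    and succ: "successively (\<lambda>p q. snd p < snd q \<and> snd q \<le> snd p + pi \<and> tangent (polar_disc D u p) (polar_disc D u q))
      (ps @ [(fst (hd ps), snd (hd ps) + 2 * pi)])"
  shows "\<exists>Ds. corona P D Ds \<and>
        (\<forall>i<length Ds. tangent (Ds ! i) (Ds ! (Suc i mod length Ds))) \<and>
        (\<Sum>i<length Ds.
           angle_at (centre D) (centre (Ds ! i)) (centre (Ds ! (Suc i mod length Ds)))) = 2 * pi"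
proof -
  define n where "n = length ps"
  have n: "0 < n" using ne by (simp add: n_def)
  define q where "q i = (if i < n then ps ! i else (fst (hd ps), snd (hd ps) + 2 * pi))" for i
  define Ds where "Ds = map (polar_disc D u) ps"
  have len: "length Ds = n" by (simp add: Ds_def n_def)
  have q: "(ps @ [(fst (hd ps), snd (hd ps) + 2 * pi)]) ! i = q i" if "i \<le> n" for i
    using that by (auto simp: q_def nth_append n_def)
  have step: "snd (q i) < snd (q (Suc i))" "snd (q (Suc i)) \<le> snd (q i) + pi"
    "tangent (polar_disc D u (q i)) (polar_disc D u (q (Suc i)))" if "i < n" for i
    using succ that unfolding successively_conv_nth by (auto simp: n_def[symmetric] q[symmetric])
  have qn: "snd (q n) = snd (q 0) + 2 * pi"
    using n ne by (simp add: q_def hd_conv_nth)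
  have pq: "0 < fst (q i)" for i
    using pos ne by (auto simp: q_def n_def)
  have Ds: "Ds ! i = polar_disc D u (q i)" if "i < n" for i
    using that by (simp add: Ds_def q_def n_def)
  have Ds': "Ds ! (Suc i mod n) = polar_disc D u (q (Suc i))" if "i < n" for i
  proof (cases "Suc i < n")
    case False
    with that have "Suc i = n" by simp
    then show ?thesis
      using Ds[OF n] n ne by (simp add: polar_disc_def q_def hd_conv_nth flip: cis_mult)
  qed (simp add: Ds)
  have mono: "snd (q i) < snd (q j)" if "i < j" "j \<le> n" for i j
    using that
  proof (induction j)
    case (Suc j)
    then show ?case using step(1)[of j] by (cases "i = j") auto
  qed simp
  have "angle_at (centre D) (centre (Ds ! i)) (centre (Ds ! (Suc i mod n))) = snd (q (Suc i)) - snd (q i)"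
    if "i < n" for i
  proof -
    have "angle_at (centre D) (centre (Ds ! i)) (centre (Ds ! (Suc i mod n))) =
      arccos (cos (snd (q (Suc i)) - snd (q i)))"
      unfolding Ds[OF that] Ds'[OF that] polar_disc_def fst_conv
      by (rule angle_at_cis) (use D pq u in \<open>auto intro: add_pos_pos\<close>)
    then show ?thesis
      using step(1,2)[OF that] by (simp add: arccos_cos)
  qed
  then have "(\<Sum>i<n. angle_at (centre D) (centre (Ds ! i)) (centre (Ds ! (Suc i mod n)))) =
    (\<Sum>i<n. snd (q (Suc i)) - snd (q i))"
    by (intro sum.cong) auto
  also have "\<dots> = 2 * pi"
    by (simp add: sum_lessThan_telescope[of "\<lambda>i. snd (q i)"] qn)
  finally have sum: "(\<Sum>i<n. angle_at (centre D) (centre (Ds ! i)) (centre (Ds ! (Suc i mod n)))) = 2 * pi" .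
  \<comment> \<open>Arguments are taken relative to the first disc, so the list may start at any
    angle, even a negative one; only the spread below a full turn matters.\<close>
  have arg: "Arg2pi ((centre (Ds ! i) - centre D) / (centre (Ds ! 0) - centre D)) = snd (q i) - snd (q 0)"
    if "i < n" for i
  proof (rule Arg2pi_unique)
    have "radius D + fst (q i) > 0" for i using D pq[of i] by simp
    moreover from this have "complex_of_real (radius D + fst (q 0)) \<noteq> 0"
      by (metis less_irrefl of_real_eq_0_iff)
    moreover have "u \<noteq> 0" using u by auto
    ultimately show "0 < (radius D + fst (q i)) / (radius D + fst (q 0))"
      "complex_of_real ((radius D + fst (q i)) / (radius D + fst (q 0))) *
        exp (\<i> * complex_of_real (snd (q i) - snd (q 0))) =
        (centre (Ds ! i) - centre D) / (centre (Ds ! 0) - centre D)"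
      by (simp_all add: Ds[OF that] Ds[OF n] polar_disc_def flip: cis_conv_exp cis_divide del: of_real_add of_real_diff)
    show "0 \<le> snd (q i) - snd (q 0)" using mono[of 0 i] that by (cases "i = 0") auto
    show "snd (q i) - snd (q 0) < 2 * pi" using mono[of i n] that qn by simp
  qed
  have Ds_ne: "Ds \<noteq> []" using ne by (simp add: Ds_def)
  have "cyclic_order (centre D) (map centre Ds)"
    unfolding cyclic_order_def sorted_wrt_iff_nth_less
    using n ne mono by (auto simp: arg hd_map hd_conv_nth len Ds_ne)
  then have "corona P D Ds"
    using nbs by (simp add: corona_def Ds_def)
  moreover have "\<forall>i<length Ds. tangent (Ds ! i) (Ds ! (Suc i mod length Ds))"
    using step(3) by (metis Ds Ds' len)
  ultimately show ?thesis
    using sum by (auto simp: len)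
qed

section \<open>Coronas of small discs\<close>

text \<open>The quadratic has the roots \<open>r\<close> and \<open>1 / r\<close>; the bounds single
  out the smaller one and are sharp enough for the estimates of \<open>alpha\<close>.\<close>

locale block_radius =
  fixes r :: real
  assumes quadratic: "3 * r\<^sup>2 + 3 = (2 + 4 * sqrt 3) * r"
    and r_gt: "38 / 100 < r" and r_lt: "r < 39 / 100"
begin

lemma r_pos [simp]: "0 < r" "r \<noteq> 0" "r \<noteq> 1" "1 \<noteq> r" "0 < 1 + r" "1 + r \<noteq> 0" "r < 1" "\<bar>r\<bar> = r"
  using r_gt r_lt by auto

lemma of_real_r [simp]: "complex_of_real r \<noteq> 0" "1 + complex_of_real r \<noteq> 0"
  by (auto simp: complex_eq_iff)

definition s :: real where "s = sqrt 3 - 2 * r"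

lemma sqrt_3_bounds: "17 / 10 < sqrt 3" "sqrt 3 < 18 / 10"
  by (rule real_less_rsqrt real_less_lsqrt; simp add: power2_eq_square)+

text \<open>Pythagoras in half of the triangle of two unit discs and a small one, with legs
  \<open>s\<close> and 1. It is the quadratic for \<open>r\<close> rewritten.\<close>

lemma s_square: "s\<^sup>2 + 1 = (1 + r)\<^sup>2" and s_pos: "0 < s"
proof -
  show "0 < s" using sqrt_3_bounds r_lt by (simp add: s_def)
  have "s\<^sup>2 = 3 - 4 * sqrt 3 * r + 4 * r\<^sup>2"
    by (simp add: s_def power2_eq_square algebra_simps)
  with quadratic show "s\<^sup>2 + 1 = (1 + r)\<^sup>2"
    by (simp add: power2_eq_square algebra_simps)
qed

definition alpha :: real where "alpha = arccos (r / (1 + r))"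

lemma cos_alpha: "cos alpha = r / (1 + r)"
  unfolding alpha_def by (rule cos_arccos) (use r_gt in \<open>auto simp: field_simps\<close>)

text \<open>By the quadratic the square of \<open>2 - sqrt 3 * r\<close> is
  \<open>1 + 2 * r\<close>, which is \<open>(1 + r)^2 - r^2\<close>.\<close>

lemma sin_alpha: "sin alpha = (2 - sqrt 3 * r) / (1 + r)"
proof -
  have q: "(2 - sqrt 3 * r)\<^sup>2 = 1 + 2 * r"
  proof -
    have "(2 - sqrt 3 * r)\<^sup>2 = 4 - 4 * sqrt 3 * r + 3 * r\<^sup>2"
      by (simp add: power2_eq_square algebra_simps)
    then show ?thesis using quadratic by (simp add: algebra_simps)
  qed
  have "sqrt 3 * r \<le> 18 / 10 * 1"
    using sqrt_3_bounds r_gt r_lt by (intro mult_mono) auto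
  then have nn: "0 \<le> (2 - sqrt 3 * r) / (1 + r)"
    by (simp add: field_simps)
  have "-1 \<le> r / (1 + r)" "r / (1 + r) \<le> 1"
    using r_gt by (auto simp: field_simps)
  then have "sin alpha = sqrt (1 - (r / (1 + r))\<^sup>2)"
    unfolding alpha_def by (rule sin_arccos)
  also have "1 - (r / (1 + r))\<^sup>2 = ((2 - sqrt 3 * r) / (1 + r))\<^sup>2"
    by (simp add: power_divide q divide_simps) (simp add: algebra_simps power2_eq_square)
  finally show ?thesis using nn by (simp only: real_sqrt_abs abs_of_nonneg)
qed

text \<open>The endpoints are values of \<open>alpha\<close> at which other coronas would close:
  four unit discs at \<open>5 * pi / 12\<close>, three unit discs and a small one at
  \<open>pi / 3\<close>.\<close>

lemma alpha_bounds: "pi / 3 < alpha" "alpha < 5 * pi / 12"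
proof -
  have le: "0 \<le> alpha" "alpha \<le> pi"
    unfolding alpha_def using r_gt by (auto intro!: arccos_lbound arccos_ubound simp: field_simps)
  have "cos alpha < cos (pi / 3)"
    using r_lt by (simp add: cos_alpha cos_60 field_simps)
  then show "pi / 3 < alpha"
    using le by (subst (asm) cos_mono_less_eq) auto
  have "38 / 138 < cos alpha"
    using r_gt by (simp add: cos_alpha field_simps)
  then have "(38 / 138)\<^sup>2 < (cos alpha)\<^sup>2"
    by (intro power_strict_mono) auto
  \<comment> \<open>Doubling allows a comparison with \<open>5 * pi / 6\<close>, whose cosine is
    known; \<open>17 / 20\<close> is half of the lower bound for \<open>sqrt 3\<close>.\<close>
  then have "-(17 / 20) < cos (2 * alpha)"
    by (simp add: cos_double_cos power2_eq_square)
  moreover have "cos (5 * pi / 6) = - (sqrt 3 / 2)"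
  proof -
    have "5 * pi / 6 = pi - pi / 6" by simp
    then show ?thesis by (simp only: cos_pi_minus cos_30)
  qed
  ultimately have *: "cos (5 * pi / 6) < cos (2 * alpha)"
    using sqrt_3_bounds by simp
  have "cos alpha > 0" by (simp add: cos_alpha)
  then have "alpha < pi / 2"
    using le by (metis cos_monotone_0_pi_le cos_pi_half leI less_le_not_le pi_ge_zero pi_half_ge_zero)
  then show "alpha < 5 * pi / 12"
    using * le by (subst (asm) cos_mono_less_eq) auto
qed

text \<open>\<open>2 * pi / 3 - alpha\<close> is half the angle between two tangent unit discs seen
  from the small disc, in the right triangle with legs \<open>s\<close>, 1 and hypotenuse
  \<open>1 + r\<close>.\<close>

lemma cis_half_angle: "(1 + r) * cis (2 * pi / 3 - alpha) = s + \<i>"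
proof -
  have "cos (2 * pi / 3 - alpha) = s / (1 + r)" "sin (2 * pi / 3 - alpha) = 1 / (1 + r)"
    unfolding cos_diff sin_diff cos_120 sin_120 cos_alpha sin_alpha
    using r_gt by (simp_all add: divide_simps s_def) (simp_all add: algebra_simps)
  then show ?thesis
    by (simp add: complex_eq_iff)
qed

lemma corona_angle_small:
  "corona_angle r r r = pi / 3" "corona_angle r 1 r = alpha" "corona_angle r r 1 = alpha"
  "corona_angle r 1 1 = 4 * pi / 3 - 2 * alpha"
proof -
  have "arccos (1/2) = pi / 3"
    using arccos_cos[of "pi / 3"] by (simp add: cos_60)
  then show "corona_angle r r r = pi / 3"
    by (simp add: corona_angle_def power2_eq_square field_simps)
  show "corona_angle r 1 r = alpha" "corona_angle r r 1 = alpha"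
    unfolding corona_angle_def alpha_def
    by (rule arg_cong[of _ _ arccos], use r_gt in \<open>simp add: divide_simps\<close>, simp add: power2_eq_square algebra_simps)+
  have "sin (2 * pi / 3 - alpha) = 1 / (1 + r)"
    using arg_cong[OF cis_half_angle, of Im] by (simp add: field_simps)
  then have "cos (2 * (2 * pi / 3 - alpha)) = 1 - 2 / (1 + r)\<^sup>2"
    using cos_double_sin[of "2 * pi / 3 - alpha"] by (simp only: power_divide power_one times_divide_eq_right mult_1_right)
  also have "\<dots> = ((r + 1)\<^sup>2 + (r + 1)\<^sup>2 - (1 + 1)\<^sup>2) / (2 * (r + 1) * (r + 1))"
    using r_gt by (simp add: divide_simps) (simp add: power2_eq_square algebra_simps)
  finally have "corona_angle r 1 1 = arccos (cos (2 * (2 * pi / 3 - alpha)))"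
    by (simp add: corona_angle_def)
  also have "\<dots> = 4 * pi / 3 - 2 * alpha"
    using alpha_bounds by (subst arccos_cos) auto
  finally show "corona_angle r 1 1 = 4 * pi / 3 - 2 * alpha" .
qed

text \<open>The arguments tell whether the two neighbours are unit discs.\<close>

definition small_angle :: "bool \<Rightarrow> bool \<Rightarrow> real" where
  "small_angle b c = (if b \<and> c then 4 * pi / 3 - 2 * alpha else if b \<or> c then alpha else pi / 3)"

lemma small_angle_bounds: "pi / 3 \<le> small_angle b c" "small_angle b c < 2 * pi / 3"
  using alpha_bounds by (auto simp: small_angle_def)

lemma small_angle_six: "small_angle b c = pi / 3 \<longleftrightarrow> \<not> b \<and> \<not> c"
  using alpha_bounds by (auto simp: small_angle_def)

text \<open>Every pattern has a sum linear in \<open>alpha\<close>. It stays below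
  \<open>2 * pi\<close> or equals it only for \<open>alpha\<close> among \<open>pi / 3\<close>,
  \<open>5 * pi / 12\<close>, \<open>pi / 2\<close> and \<open>2 * pi / 3\<close>, all
  excluded.\<close>

lemma no_four_corona:
  "small_angle b0 b1 + small_angle b1 b2 + small_angle b2 b3 + small_angle b3 b0 \<noteq> 2 * pi"
  using alpha_bounds unfolding small_angle_def
  by (cases b0; cases b1; cases b2; cases b3) simp_all

text \<open>For exactly two unit discs, adjacent, the terms in \<open>alpha\<close> cancel and the
  sum is \<open>2 * pi\<close>. Any other pattern gives \<open>5 * pi / 3\<close> or closes only for
  an \<open>alpha\<close> outside the allowed open interval.\<close>

lemma five_corona:
  assumes "small_angle b0 b1 + small_angle b1 b2 + small_angle b2 b3 + small_angle b3 b4 + small_angle b4 b0 = 2 * pi"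
  shows "b0 \<and> b1 \<and> \<not> b2 \<and> \<not> b3 \<and> \<not> b4 \<or> b1 \<and> b2 \<and> \<not> b3 \<and> \<not> b4 \<and> \<not> b0 \<or>
    b2 \<and> b3 \<and> \<not> b4 \<and> \<not> b0 \<and> \<not> b1 \<or> b3 \<and> b4 \<and> \<not> b0 \<and> \<not> b1 \<and> \<not> b2 \<or>
    b4 \<and> b0 \<and> \<not> b1 \<and> \<not> b2 \<and> \<not> b3"
  using assms alpha_bounds unfolding small_angle_def
  by (cases b0; cases b1; cases b2; cases b3; cases b4) simp_all

text \<open>In the mixed corona, \<open>u\<close> points to the middle one of the three small discs.\<close>

definition small_corona :: "complex \<Rightarrow> complex \<Rightarrow> disc set" where
  "small_corona x u = (\<lambda>h. (x + 2 * r * (h * u), r)) ` hexagon"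

definition mixed_corona :: "complex \<Rightarrow> complex \<Rightarrow> disc set" where
  "mixed_corona x u = {(x - (s - \<i>) * u, 1), (x - (s + \<i>) * u, 1),
     (x + complex_of_real (2 * r) * ((1 - omega) * u), r), (x + complex_of_real (2 * r) * u, r),
     (x + complex_of_real (2 * r) * (omega * u), r)}"

text \<open>Each angle lies in \<open>[pi / 3, 2 * pi / 3)\<close>, so a full turn takes four, five
  or six of them. Six forces all of them to be \<open>pi / 3\<close>; for five, the rotations along
  the corona fix every position from the first unit disc on.\<close>

lemma small_disc_corona:
  assumes cp: "compact_packing P" and rad: "\<forall>D\<in>P. radius D = 1 \<or> radius D = r" and x: "(x, r) \<in> P"
  shows "\<exists>u. cmod u = 1 \<and>
    (neighbours P (x, r) = small_corona x u \<or> neighbours P (x, r) = mixed_corona x u)"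
proof -
  obtain n :: nat and X :: "nat \<Rightarrow> disc" where n: "0 < n" "\<And>j. neighbours P (x, r) = X ` {j..<j + n}"
    and per: "\<And>i. X (i + n) = X i"
    and tan: "\<And>i. tangent (X i) (X (Suc i))"
    and sum: "(\<Sum>i<n. angle_at x (centre (X i)) (centre (X (Suc i)))) = 2 * pi"
    and rot: "\<And>i. centre (X (Suc i)) - x = (r + radius (X (Suc i))) / (r + radius (X i)) *
       cis (angle_at x (centre (X i)) (centre (X (Suc i)))) * (centre (X i) - x)"
    using compact_packing_corona[OF cp x] by auto
  have nb: "X i \<in> neighbours P (x, r)" for i
    using n(1) by (subst n(2)[of i]) simp
  define b where "b i \<longleftrightarrow> radius (X i) = 1" for i
  have radX: "radius (X i) = (if b i then 1 else r)" for i
    using nb[of i] rad by (auto simp: b_def neighbours_def)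
  define d where "d i = centre (X i) - x" for i
  have X: "X i = (x + d i, if b i then 1 else r)" for i
    by (simp add: d_def prod_eq_iff radX)
  have "angle_at x (centre (X i)) (centre (X (Suc i))) = corona_angle r (radius (X i)) (radius (X (Suc i)))" for i
    using angle_at_tangent[of "(x, r)" "X i" "X (Suc i)"] tan nb by (auto simp: neighbours_def)
  then have ang: "angle_at x (centre (X i)) (centre (X (Suc i))) = small_angle (b i) (b (Suc i))" for i
    by (simp add: radX small_angle_def corona_angle_small)
  have sum: "(\<Sum>i<n. small_angle (b i) (b (Suc i))) = 2 * pi"
    using sum by (simp add: ang)
  have rot: "d (Suc i) = (r + (if b (Suc i) then 1 else r)) / (r + (if b i then 1 else r)) *
       cis (small_angle (b i) (b (Suc i))) * d i" for i
    using rot[of i] by (simp add: d_def radX ang)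
  have dn: "cmod (d i) = r + (if b i then 1 else r)" for i
    using nb[of i] by (simp add: neighbours_def tangent_def dist_norm X)
  have perb: "b (i + n) = b i" for i by (simp add: b_def per)
  have "n * (pi / 3) \<le> (\<Sum>i<n. small_angle (b i) (b (Suc i)))"
    using sum_bounded_below[of "{..<n}" "pi / 3" "\<lambda>i. small_angle (b i) (b (Suc i))"] small_angle_bounds by simp
  then have "n * (pi / 3) \<le> 6 * (pi / 3)" using sum by simp
  then have "n \<le> 6" by (subst (asm) mult_le_cancel_right_pos) auto
  moreover have "(\<Sum>i<n. small_angle (b i) (b (Suc i))) < n * (2 * pi / 3)"
    using sum_bounded_above_strict[of "{..<n}" "\<lambda>i. small_angle (b i) (b (Suc i))" "2 * pi / 3"] small_angle_bounds n(1) by simp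
  then have "3 * (2 * pi / 3) < n * (2 * pi / 3)" using sum by simp
  then have "3 < n" by (subst (asm) mult_less_cancel_right_pos) auto
  ultimately consider "n = 4" | "n = 5" | "n = 6" by linarith
  then show ?thesis
  proof cases
    case 1
    then show ?thesis
      using sum no_four_corona[of "b 0" "b 1" "b 2" "b 3"] perb[of 0] by (simp add: eval_nat_numeral)
  next
    case 2
    have "b 0 \<and> b 1 \<and> \<not> b 2 \<and> \<not> b 3 \<and> \<not> b 4 \<or> b 1 \<and> b 2 \<and> \<not> b 3 \<and> \<not> b 4 \<and> \<not> b 0 \<or>
      b 2 \<and> b 3 \<and> \<not> b 4 \<and> \<not> b 0 \<and> \<not> b 1 \<or> b 3 \<and> b 4 \<and> \<not> b 0 \<and> \<not> b 1 \<and> \<not> b 2 \<or>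
      b 4 \<and> b 0 \<and> \<not> b 1 \<and> \<not> b 2 \<and> \<not> b 3"
      using sum perb[of 0] 2 by (intro five_corona) (simp add: eval_nat_numeral)
    \<comment> \<open>Indices beyond 4 wrap around, so a shift \<open>j\<close> puts the pair of
      unit discs first.\<close>
    moreover have "b 5 = b 0" "b 6 = b 1" "b 7 = b 2" "b 8 = b 3"
      using perb[of 0] perb[of 1] perb[of 2] perb[of 3] 2 by (simp_all add: eval_nat_numeral)
    ultimately have "\<exists>j\<in>{0, 1, 2, 3, 4}. b j \<and> b (j + 1) \<and> \<not> b (j + 2) \<and> \<not> b (j + 3) \<and> \<not> b (j + 4)"
      by (simp add: eval_nat_numeral)
    then obtain j where j: "b j" "b (Suc j)" "\<not> b (Suc (Suc j))" "\<not> b (Suc (Suc (Suc j)))" "\<not> b (Suc (Suc (Suc (Suc j))))"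
      by (auto simp: eval_nat_numeral)
    define c where "c = cis (2 * pi / 3 - alpha)"
    have cc: "c * cnj c = 1" by (simp add: c_def cis_cnj cis_mult)
    have c: "(1 + r) * c = s + \<i>" using cis_half_angle by (simp add: c_def)
    then have c': "(1 + r) * cnj c = s - \<i>"
      by (simp add: complex_eq_iff)
    have cK: "c * cis alpha = omega - 1"
      by (simp add: c_def cis_mult complex_eq_iff cos_120 sin_120)
    have cA: "cis (4 * pi / 3 - 2 * alpha) = c * c"
      by (simp add: c_def cis_mult)
    \<comment> \<open>\<open>c\<close> is half the turn between the two unit discs, so
      \<open>c * d j\<close> points midway between them and its opposite toward the middle small
      disc. The length is \<open>1 + r\<close>.\<close>
    define u where "u = - (c * d j / (1 + r))"
    have u: "cmod u = 1"
    proof -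
      have "cmod (1 + complex_of_real r) = 1 + r"
        by (metis abs_of_pos norm_of_real of_real_1 of_real_add r_pos(5))
      then show ?thesis
        using dn[of j] j by (simp add: u_def norm_mult norm_divide c_def)
    qed
    have 0: "d j = - (s - \<i>) * u"
    proof -
      have "- (s - \<i>) * u = (c * cnj c) * d j"
        unfolding c'[symmetric] u_def by simp
      then show ?thesis by (simp add: cc)
    qed
    have 1: "d (Suc j) = - (s + \<i>) * u"
      using rot[of j] j unfolding c[symmetric] u_def by (simp add: small_angle_def cA add.commute)
    have "d (Suc (Suc j)) = 2 * r / (1 + r) * cis alpha * d (Suc j)"
      using rot[of "Suc j"] j by (simp add: small_angle_def add.commute)
    also have "\<dots> = - 2 * r * (c * cis alpha) * u"
      unfolding 1 c[symmetric] by simp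
    finally have 2: "d (Suc (Suc j)) = 2 * r * ((1 - omega) * u)"
      unfolding cK by (simp add: algebra_simps)
    have 3: "d (Suc (Suc (Suc j))) = 2 * r * u"
    proof -
      have "d (Suc (Suc (Suc j))) = omega * d (Suc (Suc j))"
        using rot[of "Suc (Suc j)"] j by (simp add: small_angle_def cis_pi_div_3)
      also have "\<dots> = 2 * r * ((omega - omega * omega) * u)"
        unfolding 2 by (simp add: algebra_simps)
      finally show ?thesis by (simp add: omega_square)
    qed
    have 4: "d (Suc (Suc (Suc (Suc j)))) = 2 * r * (omega * u)"
      using rot[of "Suc (Suc (Suc j))"] j by (simp add: small_angle_def cis_pi_div_3 3)
    have "{j..<j + 5} = {j, Suc j, Suc (Suc j), Suc (Suc (Suc j)), Suc (Suc (Suc (Suc j)))}"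
      by auto
    then have "neighbours P (x, r) = mixed_corona x u"
      unfolding n(2)[of j] \<open>n = 5\<close> mixed_corona_def
      by (simp only: image_insert image_empty X 0 1 2 3 4 j if_True if_False mult_minus_left add_uminus_conv_diff)
    then show ?thesis using u by blast
  next
    case 3
    have "small_angle (b i) (b (Suc i)) = pi / 3" if "i < n" for i
      using sum_mono_inv[of "\<lambda>i. pi / 3" "{..<n}" "\<lambda>i. small_angle (b i) (b (Suc i))" i]
        small_angle_bounds sum 3 that by simp
    then have nb: "\<not> b i" if "i < 6" for i
      using that 3 small_angle_six by blast
    moreover have "\<not> b 6" using nb[of 0] perb[of 0] 3 by simp
    ultimately have nb: "\<not> b i" if "i \<le> 6" for i
      using that by (cases "i = 6") auto
    define u where "u = d 0 / (2 * r)"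
    have u: "cmod u = 1"
      using dn[of 0] nb[of 0] by (simp add: u_def norm_mult norm_divide)
    have step: "d (Suc i) = omega * d i" if "i < 6" for i
      using that rot[of i] nb[of i] nb[of "Suc i"] by (simp add: small_angle_def cis_pi_div_3)
    have d0: "d 0 = 2 * r * u" by (simp add: u_def)
    have "neighbours P (x, r) = X ` {0..<6}" using n(2)[of 0] 3 by simp
    also have "{0..<6} = {0, 1, 2, 3, 4, 5::nat}" by auto
    also have "X ` {0, 1, 2, 3, 4, 5} = small_corona x u"
    proof -
      have 1: "d 1 = 2 * r * (omega * u)" using step[of 0] d0 by simp
      have 2: "d 2 = 2 * r * ((omega - 1) * u)"
        using step[of 1] unfolding 1 omega_square[symmetric] by (simp add: eval_nat_numeral)
      have 3: "d 3 = 2 * r * (- 1 * u)"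
      proof -
        have "d 3 = 2 * r * ((omega * omega - omega) * u)"
          using step[of 2] unfolding 2 by (simp add: eval_nat_numeral algebra_simps)
        then show ?thesis by (simp add: omega_square)
      qed
      have 4: "d 4 = 2 * r * (- omega * u)"
        using step[of 3] unfolding 3 by (simp add: eval_nat_numeral)
      have 5: "d 5 = 2 * r * ((1 - omega) * u)"
      proof -
        have "d 5 = 2 * r * (- (omega * omega) * u)"
          using step[of 4] unfolding 4 by (simp add: eval_nat_numeral)
        then show ?thesis by (simp add: omega_square)
      qed
      show ?thesis
        using nb[of 0] nb[of 1] nb[of 2] nb[of 3] nb[of 4] nb[of 5]
        by (simp only: X image_insert image_empty if_False small_corona_def hexagon_def d0 1 2 3 4 5 mult_1_left)
    qed
    finally show ?thesis using u by blast
  qed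
qed

end

section \<open>Compact packings arise from lattices\<close>

lemma tangent_Pair: "tangent (x, a) (y, b) \<longleftrightarrow> cmod (y - x) = a + b"
  by (simp add: tangent_def dist_norm norm_minus_commute)

text \<open>If the vertex nearest in direction differs from \<open>e\<close>, it is at distance at
  least 2 from it, and the law of cosines with an angle of at most \<open>pi / 6\<close> pushes
  \<open>e\<close> out to \<open>2 * sqrt 3\<close>, the second distance of the lattice.\<close>

lemma hexagon_surrounded:
  assumes U: "cmod U = 1" and e: "e \<noteq> c"
    and sep: "\<And>h. h \<in> hexagon \<Longrightarrow> e = c + 2 * (h * U) \<or> 2 \<le> cmod (e - (c + 2 * (h * U)))"
  shows "(\<exists>h\<in>hexagon. e = c + 2 * (h * U)) \<or> 2 * sqrt 3 \<le> cmod (e - c)"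
proof -
  obtain h where h: "h \<in> hexagon"
    "(cmod (e - c - of_real 2 * (h * U)))\<^sup>2 \<le> (cmod (e - c))\<^sup>2 + 2\<^sup>2 - 2 * (sqrt 3 * cmod (e - c))"
    using hexagon_nearest_dist[OF U, of 2 "e - c"] by auto
  show ?thesis
  proof (cases "e = c + 2 * (h * U)")
    case False
    then have "2 \<le> cmod (e - c - of_real 2 * (h * U))"
      using sep[OF h(1)] by (simp add: algebra_simps)
    then have "2\<^sup>2 \<le> (cmod (e - c - of_real 2 * (h * U)))\<^sup>2"
      by (intro power_mono) auto
    with h(2) have "2 * sqrt 3 * cmod (e - c) \<le> cmod (e - c) * cmod (e - c)"
      by (simp add: power2_eq_square)
    then show ?thesis using e by simp
  qed (use h in blast)
qed

context block_radius
begin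

lemma abs_one_plus_r [simp]: "\<bar>1 + r\<bar> = 1 + r" and r_nonneg [simp]: "0 \<le> r"
  using r_gt by linarith+

lemma small_corona_rotate: "h \<in> hexagon \<Longrightarrow> small_corona x (h * u) = small_corona x u"
  unfolding small_corona_def
  by (rule hexagon_image_rotate[where f = "\<lambda>z. (x + complex_of_real (2 * r) * z, r)"])

lemma mixed_corona_small:
  "(x + complex_of_real (2 * r) * v, r) \<in> mixed_corona x u \<longleftrightarrow> v = (1 - omega) * u \<or> v = u \<or> v = omega * u"
  by (auto simp: mixed_corona_def)

lemma small_corona_small:
  "(x + complex_of_real (2 * r) * v, r) \<in> small_corona x u \<longleftrightarrow> v \<in> (\<lambda>h. h * u) ` hexagon"
  by (auto simp: small_corona_def)

lemma mixed_corona_unit: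
  "(z, 1) \<in> mixed_corona x u \<longleftrightarrow> z = x - (s - \<i>) * u \<or> z = x - (s + \<i>) * u"
  by (auto simp: mixed_corona_def)

lemma small_corona_unit: "(z, 1) \<notin> small_corona x u"
  by (auto simp: small_corona_def)

text \<open>Among three consecutive directions only the middle one keeps both of its turns by
  \<open>pi / 3\<close> in the set. This identifies the middle small disc of a mixed corona.\<close>

lemma sector_unique:
  assumes "u \<noteq> 0" "v = (1 - omega) * u \<or> v = u \<or> v = omega * u"
    "omega * v = (1 - omega) * u \<or> omega * v = u \<or> omega * v = omega * u"
    "(1 - omega) * v = (1 - omega) * u \<or> (1 - omega) * v = u \<or> (1 - omega) * v = omega * u"
  shows "v = u"
proof -
  have sq: "(1 - omega) * (1 - omega) = - omega" "omega * omega = omega - 1"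
    by (simp_all add: algebra_simps omega_square)
  have "\<not> v = (1 - omega) * u"
  proof
    assume "v = (1 - omega) * u"
    then have "(1 - omega) * v = - omega * u" by (simp flip: mult.assoc add: sq)
    then have "- omega = 1 - omega \<or> - omega = 1 \<or> - omega = omega"
      using assms(4) mult_right_cancel[OF assms(1)] by (metis mult_1)
    then show False by (auto simp: complex_eq_iff)
  qed
  moreover have "\<not> v = omega * u"
  proof
    assume "v = omega * u"
    then have "omega * v = (omega - 1) * u" by (simp flip: mult.assoc add: sq)
    then have "omega - 1 = 1 - omega \<or> omega - 1 = 1 \<or> omega - 1 = omega"
      using assms(3) mult_right_cancel[OF assms(1)] by (metis mult_1)
    then show False by (auto simp: complex_eq_iff)
  qed
  ultimately show ?thesis using assms(2) by blast
qed

text \<open>The three factors have positive real parts, so a mixed corona never holds two opposite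
  small discs.\<close>

lemma sector_not_opposite:
  assumes "u \<noteq> 0" "v = (1 - omega) * u \<or> v = u \<or> v = omega * u"
    "- v = (1 - omega) * u \<or> - v = u \<or> - v = omega * u"
  shows False
proof -
  have ex: "\<exists>a\<in>{1 - omega, 1, omega}. w = a * u" if "w = (1 - omega) * u \<or> w = u \<or> w = omega * u" for w
    using that by auto
  obtain a b where ab: "v = a * u" "- v = b * u" "a \<in> {1 - omega, 1, omega}" "b \<in> {1 - omega, 1, omega}"
    using ex[OF assms(2)] ex[OF assms(3)] by blast
  have "(a + b) * u = 0" unfolding distrib_right ab(1,2)[symmetric] by simp
  then have "Re (a + b) = 0" using assms(1) by simp
  then show False using ab(3,4) by auto
qed

text \<open>Up to sign and rotation, the vector from a lateral small disc of a mixed corona to the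
  unit disc next to it; the two are thus tangent. The identity \<open>s = sqrt 3 - 2 * r\<close>
  makes the extra terms cancel.\<close>

lemma norm_outer_unit: "cmod (s + r + \<i> * (1 - sqrt 3 * r)) = 1 + r"
proof -
  have "(s + r)\<^sup>2 + (1 - sqrt 3 * r)\<^sup>2 = (s\<^sup>2 + 1) + 2 * r * s + 4 * r\<^sup>2 - 2 * sqrt 3 * r"
    by (simp add: power2_eq_square algebra_simps)
  also have "\<dots> = (1 + r)\<^sup>2"
    unfolding s_square by (simp add: s_def power2_eq_square algebra_simps)
  finally show ?thesis by (simp add: cmod_def)
qed

lemma norm_s_i: "cmod (s + \<i>) = 1 + r" "cmod (s - \<i>) = 1 + r"
  using s_square by (simp_all add: cmod_def)

end

section \<open>Discs whose six neighbours are all small\<close>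

locale block_packing = block_radius +
  fixes P :: "disc set"
  assumes compact: "compact_packing P"
    and radii: "\<forall>D\<in>P. radius D = 1 \<or> radius D = r"
    and unit_disc: "\<exists>D\<in>P. radius D = 1"
begin

lemma separated: "D \<in> P \<Longrightarrow> E \<in> P \<Longrightarrow> D \<noteq> E \<Longrightarrow> radius D + radius E \<le> dist (centre D) (centre E)"
  using compact by (auto simp: compact_packing_def packing_iff)

definition inner :: "complex \<Rightarrow> bool" where
  "inner x \<longleftrightarrow> (x, r) \<in> P \<and> (\<exists>u. cmod u = 1 \<and> neighbours P (x, r) = small_corona x u)"

lemma inner_in: "inner x \<Longrightarrow> (x, r) \<in> P"
  by (simp add: inner_def)

lemma not_inner_mixed:
  assumes "(x, r) \<in> P" "\<not> inner x"
  obtains u where "cmod u = 1" "neighbours P (x, r) = mixed_corona x u"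
  using small_disc_corona[OF compact radii assms(1)] assms by (auto simp: inner_def)

lemma neighbour_unit_mixed:
  assumes "(x, r) \<in> P" "(z, 1) \<in> P" "cmod (z - x) = 1 + r"
  obtains u where "cmod u = 1" "neighbours P (x, r) = mixed_corona x u"
proof -
  have "(z, 1) \<in> neighbours P (x, r)"
    using assms by (simp add: neighbours_def tangent_Pair)
  then have "\<not> inner x" by (auto simp: inner_def small_corona_unit)
  then show ?thesis using that not_inner_mixed assms(1) by blast
qed

text \<open>Otherwise the middle disc has a mixed corona too, whose own middle disc must be
  \<open>x\<close>. The lateral disc \<open>p\<close> then touches a unit disc of each corona,
  \<open>b\<close> and \<open>b'\<close>. But the two unit discs of the mixed corona of
  \<open>p\<close> are at distance 2, while \<open>b\<close> and \<open>b'\<close> are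
  \<open>2 * r + 2 * s = 2 * sqrt 3 - 2 * r\<close> apart.\<close>

lemma mixed_middle_inner:
  assumes x: "(x, r) \<in> P" and u: "cmod u = 1" and mixed: "neighbours P (x, r) = mixed_corona x u"
  shows "inner (x + complex_of_real (2 * r) * u)"
proof (rule ccontr)
  define y where "y = x + complex_of_real (2 * r) * u"
  define p where "p = x + complex_of_real (2 * r) * ((1 - omega) * u)"
  define q where "q = x + complex_of_real (2 * r) * (omega * u)"
  have in_P: "E \<in> P" if "E \<in> mixed_corona x u" for E
    using mixed that by (auto simp: neighbours_def)
  have y: "(y, r) \<in> P" and p: "(p, r) \<in> P" and q: "(q, r) \<in> P"
    by (auto simp: y_def p_def q_def mixed_corona_def intro!: in_P)
  assume "\<not> inner (x + complex_of_real (2 * r) * u)"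
  then obtain u' where u': "cmod u' = 1" "neighbours P (y, r) = mixed_corona y u'"
    using not_inner_mixed y by (auto simp: y_def)
  have nb: "(y + complex_of_real (2 * r) * v, r) \<in> mixed_corona y u'"
    if "(y + complex_of_real (2 * r) * v, r) \<in> P" "cmod v = 1" for v
    using that by (simp add: neighbours_def tangent_Pair norm_mult flip: u')
  have "x = y + complex_of_real (2 * r) * (- u)" "p = y + complex_of_real (2 * r) * (omega * (- u))"
    "q = y + complex_of_real (2 * r) * ((1 - omega) * (- u))"
    by (simp_all add: y_def p_def q_def algebra_simps)
  then have "- u = u'"
    using nb[of "- u"] nb[of "omega * (- u)"] nb[of "(1 - omega) * (- u)"] x p q u u'(1)
    unfolding mixed_corona_small
    by (intro sector_unique) (auto simp: norm_mult norm_hexagon)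
  define b where "b = x - (s + \<i>) * u"
  define b' where "b' = y + (s - \<i>) * u"
  have b: "(b, 1) \<in> P" by (auto simp: b_def mixed_corona_def intro!: in_P)
  have "(b', 1) \<in> mixed_corona y u'"
    by (simp add: b'_def mixed_corona_unit flip: \<open>- u = u'\<close>)
  then have b': "(b', 1) \<in> P" using u'(2) by (auto simp: neighbours_def)
  have "b - p = - (s + r + \<i> * (1 - sqrt 3 * r)) * u"
  proof -
    have "s + \<i> + complex_of_real (2 * r) * (1 - omega) = s + r + \<i> * (1 - sqrt 3 * r)"
      by (simp add: complex_eq_iff)
    moreover have "b - p = - (s + \<i> + complex_of_real (2 * r) * (1 - omega)) * u"
      by (simp add: b_def p_def algebra_simps)
    ultimately show ?thesis by (simp only:)
  qed
  then have bp: "cmod (b - p) = 1 + r"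
    using norm_outer_unit u by (simp only: norm_mult norm_minus_cancel mult_1_right)
  have "b' - p = cnj (s + r + \<i> * (1 - sqrt 3 * r)) * u"
  proof -
    have "s - \<i> + complex_of_real (2 * r) * omega = cnj (s + r + \<i> * (1 - sqrt 3 * r))"
      by (simp add: complex_eq_iff)
    moreover have "b' - p = (s - \<i> + complex_of_real (2 * r) * omega) * u"
      by (simp add: b'_def p_def y_def algebra_simps)
    ultimately show ?thesis by simp
  qed
  then have b'p: "cmod (b' - p) = 1 + r"
    using norm_outer_unit u by (simp only: norm_mult complex_mod_cnj mult_1_right)
  obtain w where w: "cmod w = 1" "neighbours P (p, r) = mixed_corona p w"
    using neighbour_unit_mixed[OF p b bp] by blast
  have "b \<in> {p - (s - \<i>) * w, p - (s + \<i>) * w}" "b' \<in> {p - (s - \<i>) * w, p - (s + \<i>) * w}"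
  proof -
    have "(b, 1) \<in> neighbours P (p, r)" "(b', 1) \<in> neighbours P (p, r)"
      using b b' bp b'p by (simp_all add: neighbours_def tangent_Pair)
    then show "b \<in> {p - (s - \<i>) * w, p - (s + \<i>) * w}" "b' \<in> {p - (s - \<i>) * w, p - (s + \<i>) * w}"
      unfolding w(2) mixed_corona_unit by simp_all
  qed
  \<comment> \<open>Both are among the two unit discs seen from \<open>p\<close>, so they coincide
    or are tangent.\<close>
  then have "b' - b \<in> {0, 2 * \<i> * w, - (2 * \<i> * w)}"
    by (elim insertE emptyE) (simp_all only: insert_iff empty_iff, simp_all add: left_diff_distrib distrib_right)
  then have "cmod (b' - b) \<le> 2" using w by (auto simp: norm_mult)
  moreover have "b' - b = complex_of_real (2 * r + 2 * s) * u"
    by (simp add: b'_def b_def y_def algebra_simps)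
  then have "cmod (b' - b) = 2 * r + 2 * s"
    using u s_pos by (simp add: norm_mult del: of_real_add)
  ultimately show False
    using sqrt_3_bounds r_lt by (simp add: s_def)
qed

lemma inner_corona_towards:
  assumes "inner y" "(y + complex_of_real (2 * r) * v, r) \<in> P" "cmod v = 1"
  shows "neighbours P (y, r) = small_corona y v"
proof -
  obtain u where u: "cmod u = 1" "neighbours P (y, r) = small_corona y u"
    using assms(1) by (auto simp: inner_def)
  have "(y + complex_of_real (2 * r) * v, r) \<in> neighbours P (y, r)"
    using assms by (simp add: neighbours_def tangent_Pair norm_mult)
  then obtain h where "h \<in> hexagon" "v = h * u"
    unfolding u(2) small_corona_small by blast
  then show ?thesis using u small_corona_rotate by simp
qed

lemma small_corona_in:
  assumes "neighbours P (y, r) = small_corona y v" "h \<in> hexagon"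
  shows "(y + complex_of_real (2 * r) * (h * v), r) \<in> P"
proof -
  have "(y + complex_of_real (2 * r) * (h * v), r) \<in> neighbours P (y, r)"
    unfolding assms(1) small_corona_small using assms(2) by blast
  then show ?thesis by (simp add: neighbours_def)
qed

text \<open>The common neighbour \<open>p\<close> of two tangent inner discs has small discs on
  opposite sides, one from each corona, which a mixed corona cannot contain.\<close>

lemma inner_turn:
  assumes y: "inner y" and x: "inner (y + complex_of_real (2 * r) * v)" and v: "cmod v = 1"
  shows "inner (y + complex_of_real (2 * r) * (omega * v))"
proof (rule ccontr)
  define p where "p = y + complex_of_real (2 * r) * (omega * v)"
  define x' where "x' = y + complex_of_real (2 * r) * v"
  have Ny: "neighbours P (y, r) = small_corona y v"
    using inner_corona_towards[OF y inner_in[OF x] v] .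
  have "x' + complex_of_real (2 * r) * (- v) = y" by (simp add: x'_def)
  then have "neighbours P (x', r) = small_corona x' (- v)"
    using inner_corona_towards[of x' "- v"] x inner_in[OF y] v by (simp add: x'_def)
  then have 1: "(x' + complex_of_real (2 * r) * ((- omega) * (- v)), r) \<in> P"
    by (rule small_corona_in) (simp add: hexagon_def)
  have 2: "(y + complex_of_real (2 * r) * ((omega - 1) * v), r) \<in> P"
    by (rule small_corona_in[OF Ny]) (simp add: hexagon_def)
  assume "\<not> inner (y + complex_of_real (2 * r) * (omega * v))"
  moreover have p: "(p, r) \<in> P"
    unfolding p_def by (rule small_corona_in[OF Ny]) simp
  ultimately obtain w where w: "cmod w = 1" "neighbours P (p, r) = mixed_corona p w"
    using not_inner_mixed by (auto simp: p_def)
  have nb: "(p + complex_of_real (2 * r) * v, r) \<in> mixed_corona p w"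
    if "(p + complex_of_real (2 * r) * v, r) \<in> P" "cmod v = 1" for v
    using that by (simp add: neighbours_def tangent_Pair norm_mult flip: w)
  have "x' + complex_of_real (2 * r) * ((- omega) * (- v)) = p + complex_of_real (2 * r) * v"
    "y + complex_of_real (2 * r) * ((omega - 1) * v) = p + complex_of_real (2 * r) * (- v)"
    by (simp_all add: p_def x'_def algebra_simps)
  with 1 2 v nb[of v] nb[of "- v"] w(1) show False
    unfolding mixed_corona_small by (intro sector_not_opposite[of w v]) auto
qed

text \<open>Tangent inner discs reproduce themselves in all six directions. Stepping toward a fixed
  unit disc would then lower the squared distance by a constant amount indefinitely.\<close>

lemma inner_not_adjacent:
  assumes "inner y" "(x, r) \<in> neighbours P (y, r)"
  shows "\<not> inner x"
proof
  assume "inner x"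
  define L where "L = {y. inner y \<and> (\<exists>v. cmod v = 1 \<and> inner (y + complex_of_real (2 * r) * v))}"
  have turn: "inner (y + complex_of_real (2 * r) * (h * v))"
    if "inner y" "inner (y + complex_of_real (2 * r) * v)" "cmod v = 1" "h \<in> hexagon" for y v h
  proof -
    have "h * v \<in> {v. cmod v = 1 \<and> inner (y + complex_of_real (2 * r) * v)}"
      by (rule hexagon_closed) (use that inner_turn in \<open>auto simp: norm_mult\<close>)
    then show ?thesis by simp
  qed
  have L: "\<exists>u. cmod u = 1 \<and> (\<forall>h\<in>hexagon. y + complex_of_real (2 * r) * (h * u) \<in> L)" if "y \<in> L" for y
  proof -
    obtain v where v: "inner y" "cmod v = 1" "inner (y + complex_of_real (2 * r) * v)"
      using \<open>y \<in> L\<close> by (auto simp: L_def)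
    \<comment> \<open>The disc reached has an inner neighbour because the step back by
      \<open>- (h * v)\<close> leads to \<open>y\<close>.\<close>
    have "y + complex_of_real (2 * r) * (h * v) \<in> L" if "h \<in> hexagon" for h
      unfolding L_def using turn[OF v(1,3,2) that] v(1) norm_hexagon[OF that] v(2)
      by (auto intro!: exI[of _ "- (h * v)"] simp: norm_mult)
    then show ?thesis using v(2) by blast
  qed
  obtain z where z: "(z, 1) \<in> P" using unit_disc by (metis prod.collapse)
  \<comment> \<open>The drop granted by \<open>hexagon_nearest_dist\<close> for steps of length
    \<open>2 * r\<close> at distance at least \<open>1 + r\<close>, the least possible between a
    small and a unit disc.\<close>
  define \<delta> where "\<delta> = 2 * r * (sqrt 3 * (1 + r)) - (2 * r)\<^sup>2"
  have "\<delta> = 2 * r * (sqrt 3 * (1 + r) - 2 * r)"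
    by (simp add: \<delta>_def power2_eq_square algebra_simps)
  moreover have "1 * 1 \<le> sqrt 3 * (1 + r)"
    using sqrt_3_bounds r_gt by (intro mult_mono) auto
  ultimately have \<delta>: "0 < \<delta>" using r_lt by simp
  \<comment> \<open>From any point of \<open>L\<close> some neighbour in \<open>L\<close> is closer to \<open>z\<close> by at least \<open>\<delta>\<close> in squared distance.\<close>
  have descent: "n * \<delta> \<le> (cmod (z - y))\<^sup>2" if "y \<in> L" for n :: nat and y
    using that
  proof (induction n arbitrary: y)
    case (Suc n)
    obtain u where u: "cmod u = 1" "\<And>h. h \<in> hexagon \<Longrightarrow> y + complex_of_real (2 * r) * (h * u) \<in> L"
      using L[OF Suc.prems] by blast
    obtain h where h: "h \<in> hexagon" "(cmod (z - y - complex_of_real (2 * r) * (h * u)))\<^sup>2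
        \<le> (cmod (z - y))\<^sup>2 + (2 * r)\<^sup>2 - 2 * r * (sqrt 3 * cmod (z - y))"
      using hexagon_nearest_dist[OF u(1) less_imp_le, of "2 * r" "z - y"] by auto
    have "n * \<delta> \<le> (cmod (z - y - complex_of_real (2 * r) * (h * u)))\<^sup>2"
      using Suc.IH[OF u(2)[OF h(1)]] by (simp add: algebra_simps)
    moreover have "1 + r \<le> cmod (z - y)"
      using separated[OF z, of "(y, r)"] Suc.prems by (auto simp: L_def inner_def dist_norm)
    then have "2 * r * (sqrt 3 * (1 + r)) \<le> 2 * r * (sqrt 3 * cmod (z - y))"
      by (intro mult_left_mono) auto
    ultimately show ?case using h(2) by (simp add: \<delta>_def algebra_simps)
  qed simp
  have "y \<in> L"
  proof -
    have "cmod (x - y) = 2 * r"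
      using assms(2) by (simp add: neighbours_def tangent_Pair)
    then have "cmod ((x - y) / complex_of_real (2 * r)) = 1"
      by (simp add: norm_divide norm_mult)
    moreover have "y + complex_of_real (2 * r) * ((x - y) / complex_of_real (2 * r)) = x"
      by simp
    ultimately show ?thesis
      using \<open>inner x\<close> assms(1) unfolding L_def by (metis (mono_tags, lifting) mem_Collect_eq)
  qed
  moreover obtain n :: nat where "(cmod (z - y))\<^sup>2 < n * \<delta>"
    using reals_Archimedean3[OF \<delta>] by blast
  ultimately show False using descent by (meson not_le)
qed

end

section \<open>Triangular lattices described locally\<close>

lemma norm_sqrt_3_i: "cmod (sqrt 3 - \<i>) = 2" "cmod (sqrt 3 + \<i>) = 2"
  by (simp_all add: cmod_def)

lemma sqrt_3_i_omega: "(sqrt 3 - \<i>) * omega = sqrt 3 + \<i>"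
  by (simp add: complex_eq_iff)

text \<open>A triangular lattice of side 2 without a basis: the hexagon at each point has its own
  orientation, which is what local arguments provide.\<close>

definition hexagonal :: "complex set \<Rightarrow> bool" where
  "hexagonal C \<longleftrightarrow> pairwise (\<lambda>c d. 2 \<le> cmod (c - d)) C \<and>
     (\<forall>c\<in>C. \<exists>U. cmod U = 1 \<and> (\<forall>h\<in>hexagon. c + 2 * (h * U) \<in> C))"

lemma hexagonal_neighbours:
  assumes C: "pairwise (\<lambda>c d. 2 \<le> cmod (c - d)) C" "cmod U = 1" "\<And>h. h \<in> hexagon \<Longrightarrow> c + 2 * (h * U) \<in> C"
  shows "{d \<in> C. cmod (d - c) = 2} = (\<lambda>h. c + 2 * (h * U)) ` hexagon"
proof -
  have "d \<in> (\<lambda>h. c + 2 * (h * U)) ` hexagon" if d: "d \<in> C" "cmod (d - c) = 2" for d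
  proof -
    have "(\<exists>h\<in>hexagon. d = c + 2 * (h * U)) \<or> 2 * sqrt 3 \<le> cmod (d - c)"
      by (rule hexagon_surrounded[OF C(2)]) (use d C(1,3) in \<open>auto simp: pairwise_def\<close>)
    moreover have "1 < sqrt 3" by simp
    ultimately show ?thesis using d by auto
  qed
  then show ?thesis
    using C by (auto simp: norm_mult norm_hexagon)
qed

lemma triangular_lattice_packing_hexagonal:
  assumes "hexagonal C" "C \<noteq> {}"
  shows "triangular_lattice_packing ((\<lambda>c. (c, 1)) ` C)"
proof -
  let ?T = "(\<lambda>c. (c, 1 :: real)) ` C"
  have pw: "pairwise (\<lambda>c d. 2 \<le> cmod (c - d)) C"
    using assms by (simp add: hexagonal_def)
  then have "packing ?T"
    by (auto simp: packing_iff pairwise_def dist_norm)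
  moreover have "card (neighbours ?T (c, 1)) = 6" if "c \<in> C" for c
  proof -
    obtain U where U: "cmod U = 1" "\<And>h. h \<in> hexagon \<Longrightarrow> c + 2 * (h * U) \<in> C"
      using assms \<open>c \<in> C\<close> unfolding hexagonal_def by blast
    have "neighbours ?T (c, 1) = (\<lambda>c. (c, 1)) ` {d \<in> C. cmod (d - c) = 2}"
      by (auto simp: neighbours_def tangent_Pair)
    also have "\<dots> = (\<lambda>c. (c, 1)) ` (\<lambda>h. c + 2 * (h * U)) ` hexagon"
      using hexagonal_neighbours[OF pw U] by simp
    also have "card \<dots> = card hexagon"
      unfolding image_image using U(1) by (intro card_image) (auto simp: inj_on_def)
    finally show ?thesis by (simp add: card_hexagon)
  qed
  ultimately show ?thesis
    using assms by (auto simp: triangular_lattice_packing_def)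
qed

context block_radius
begin

lemma sqrt_3_s: "complex_of_real (sqrt 3) = 2 * r + s"
  by (simp add: s_def)

text \<open>Seen from a unit disc, the small disc in the pocket of two tangent unit discs lies
  perpendicularly above their point of contact, at height \<open>s\<close>.\<close>

lemma cis_corona_angle_unit: "(1 + r) * cis (corona_angle 1 1 r) = 1 + \<i> * s"
proof -
  have arg: "((1 + 1)\<^sup>2 + (1 + r)\<^sup>2 - (1 + r)\<^sup>2) / (2 * (1 + 1) * (1 + r)) = 1 / (1 + r)"
    using r_gt by (simp add: divide_simps)
  have b: "-1 \<le> 1 / (1 + r)" "1 / (1 + r) \<le> 1"
    using r_gt by (simp_all add: divide_simps)
  have "1 - (1 / (1 + r))\<^sup>2 = (s / (1 + r))\<^sup>2"
    by (simp add: power_divide divide_simps) (use s_square in simp)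
  moreover have "0 \<le> s / (1 + r)" using s_pos by simp
  ultimately have "sin (corona_angle 1 1 r) = s / (1 + r)"
    unfolding corona_angle_def arg sin_arccos[OF b] by (simp only: real_sqrt_abs abs_of_nonneg)
  moreover have "cos (corona_angle 1 1 r) = 1 / (1 + r)"
    unfolding corona_angle_def arg by (rule cos_arccos[OF b])
  ultimately show ?thesis
    by (simp add: complex_eq_iff)
qed

lemma corona_angle_units: "corona_angle 1 1 1 = pi / 3"
  using arccos_cos[of "pi / 3"] by (simp add: corona_angle_def cos_60)

end

section \<open>The centres after exchanging blocks for unit discs\<close>

context block_packing
begin

text \<open>A neighbour of an inner disc is not inner, hence mixed. It shares with the inner disc
  two small neighbours, one on either side, so \<open>sector_unique\<close> makes the inner disc the
  middle one.\<close>

lemma inner_neighbour_corona: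
  assumes y: "inner y" and x: "(y + complex_of_real (2 * r) * v, r) \<in> P" and v: "cmod v = 1"
  shows "neighbours P (y + complex_of_real (2 * r) * v, r) = mixed_corona (y + complex_of_real (2 * r) * v) (- v)"
proof -
  define x where "x = y + complex_of_real (2 * r) * v"
  have Ny: "neighbours P (y, r) = small_corona y v"
    using inner_corona_towards[OF y x v] .
  have "(x, r) \<in> neighbours P (y, r)"
    unfolding x_def using x v by (simp add: neighbours_def tangent_Pair norm_mult)
  then have "\<not> inner x" using inner_not_adjacent[OF y] by blast
  then obtain w where w: "cmod w = 1" "neighbours P (x, r) = mixed_corona x w"
    using not_inner_mixed x by (auto simp: x_def)
  have nb: "a = (1 - omega) * w \<or> a = w \<or> a = omega * w"
    if "(x + complex_of_real (2 * r) * a, r) \<in> P" "cmod a = 1" for a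
  proof -
    have "(x + complex_of_real (2 * r) * a, r) \<in> neighbours P (x, r)"
      using that by (simp add: neighbours_def tangent_Pair norm_mult)
    then show ?thesis unfolding w(2) mixed_corona_small .
  qed
  have eqs: "x + complex_of_real (2 * r) * (- v) = y"
    "x + complex_of_real (2 * r) * (omega * (- v)) = y + complex_of_real (2 * r) * ((1 - omega) * v)"
    "x + complex_of_real (2 * r) * ((1 - omega) * (- v)) = y + complex_of_real (2 * r) * (omega * v)"
    by (simp_all add: x_def algebra_simps)
  have "- v = w"
  proof (rule sector_unique)
    show "w \<noteq> 0" using w by auto
    show "- v = (1 - omega) * w \<or> - v = w \<or> - v = omega * w"
      by (rule nb) (use inner_in[OF y] v in \<open>simp_all only: eqs norm_minus_cancel\<close>)
    show "omega * (- v) = (1 - omega) * w \<or> omega * (- v) = w \<or> omega * (- v) = omega * w"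
      by (rule nb, unfold eqs, rule small_corona_in[OF Ny]) (use v in \<open>simp_all add: norm_mult\<close>)
    show "(1 - omega) * (- v) = (1 - omega) * w \<or> (1 - omega) * (- v) = w \<or> (1 - omega) * (- v) = omega * w"
      by (rule nb, unfold eqs, rule small_corona_in[OF Ny]) (use v norm_hexagon[of "1 - omega"] in \<open>simp_all add: norm_mult\<close>)
  qed
  then show ?thesis using w by (simp add: x_def)
qed

lemma mixed_corona_middle:
  "x + complex_of_real (2 * r) * w - (x - (s - \<i>) * w) = (sqrt 3 - \<i>) * w"
  "x + complex_of_real (2 * r) * w - (x - (s + \<i>) * w) = (sqrt 3 + \<i>) * w"
  unfolding sqrt_3_s by (simp_all add: algebra_simps)

text \<open>The outer disc in direction \<open>h * u\<close> has unit neighbours at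
  \<open>(sqrt 3 - \<i>) * (h * u)\<close> and at its turn by \<open>pi / 3\<close>. The latter
  belongs to the next outer disc as well, so one family over all \<open>h\<close> is the whole
  ring.\<close>

lemma inner_units:
  assumes "inner y"
  shows "\<exists>u. cmod u = 1 \<and> neighbours P (y, r) = small_corona y u \<and>
    (\<forall>h\<in>hexagon. (y + (sqrt 3 - \<i>) * (h * u), 1) \<in> P)"
proof -
  obtain u where u: "cmod u = 1" "neighbours P (y, r) = small_corona y u"
    using assms by (auto simp: inner_def)
  have "(y + (sqrt 3 - \<i>) * (h * u), 1) \<in> P" if h: "h \<in> hexagon" for h
  proof -
    define x where "x = y + complex_of_real (2 * r) * (h * u)"
    have hu: "cmod (h * u) = 1" using h u by (simp add: norm_mult norm_hexagon)
    have N: "neighbours P (x, r) = mixed_corona x (- (h * u))"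
      unfolding x_def using inner_neighbour_corona[OF assms small_corona_in[OF u(2) h] hu] .
    have "x - (s - \<i>) * (- (h * u)) = y + (sqrt 3 - \<i>) * (h * u)"
      unfolding sqrt_3_s by (simp add: x_def algebra_simps)
    then have "(y + (sqrt 3 - \<i>) * (h * u), 1) \<in> neighbours P (x, r)"
      unfolding N mixed_corona_unit by simp
    then show ?thesis by (simp add: neighbours_def)
  qed
  then show ?thesis using u by blast
qed

text \<open>The centres of the triangular lattice packing in which every block is exchanged for a unit disc.\<close>

definition lattice :: "complex set" where
  "lattice = {z. (z, 1) \<in> P} \<union> {y. inner y}"

lemma inner_not_unit: "inner y \<Longrightarrow> (y, 1) \<notin> P"
  using separated[of "(y, 1)" "(y, r)"] r_pos(5) by (auto simp: inner_def not_le[symmetric] simp del: r_pos(5))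

lemma inner_hexagon:
  assumes "inner y"
  shows "\<exists>U. cmod U = 1 \<and> (\<forall>h\<in>hexagon. (y + 2 * (h * U), 1) \<in> P)"
proof -
  obtain u where u: "cmod u = 1" "\<And>h. h \<in> hexagon \<Longrightarrow> (y + (sqrt 3 - \<i>) * (h * u), 1) \<in> P"
    using inner_units[OF assms] by blast
  define U where "U = (sqrt 3 - \<i>) / 2 * u"
  have "cmod U = 1"
    using u(1) norm_sqrt_3_i by (simp add: U_def norm_mult norm_divide)
  moreover have "(sqrt 3 - \<i>) * (h * u) = 2 * (h * U)" for h
    by (simp add: U_def)
  ultimately show ?thesis using u(2) by metis
qed

lemma inner_unit_dist:
  assumes y: "inner y" and c: "(c, 1) \<in> P"
  shows "cmod (c - y) = 2 \<or> 2 * sqrt 3 \<le> cmod (c - y)"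
proof -
  obtain U where U: "cmod U = 1" "\<And>h. h \<in> hexagon \<Longrightarrow> (y + 2 * (h * U), 1) \<in> P"
    using inner_hexagon[OF y] by blast
  have "(\<exists>h\<in>hexagon. c = y + 2 * (h * U)) \<or> 2 * sqrt 3 \<le> cmod (c - y)"
  proof (rule hexagon_surrounded[OF U(1)])
    show "c \<noteq> y" using inner_not_unit[OF y] c by auto
    show "c = y + 2 * (h * U) \<or> 2 \<le> cmod (c - (y + 2 * (h * U)))" if "h \<in> hexagon" for h
      using separated[OF c U(2)[OF that]] by (auto simp: dist_norm)
  qed
  then show ?thesis using U(1) by (auto simp: norm_mult norm_hexagon)
qed

text \<open>The ring of \<open>y\<close> consists of unit discs, which are at distance at least 2
  from the inner centre \<open>c\<close>; and \<open>c\<close> is not on the ring, since no unit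
  disc is centred there.\<close>

lemma inner_inner_dist:
  assumes y: "inner y" and c: "inner c" "c \<noteq> y"
  shows "2 * sqrt 3 \<le> cmod (c - y)"
proof -
  obtain U where U: "cmod U = 1" "\<And>h. h \<in> hexagon \<Longrightarrow> (y + 2 * (h * U), 1) \<in> P"
    using inner_hexagon[OF y] by blast
  have "(\<exists>h\<in>hexagon. c = y + 2 * (h * U)) \<or> 2 * sqrt 3 \<le> cmod (c - y)"
  proof (rule hexagon_surrounded[OF U(1) c(2)])
    show "c = y + 2 * (h * U) \<or> 2 \<le> cmod (c - (y + 2 * (h * U)))" if "h \<in> hexagon" for h
      using inner_unit_dist[OF c(1) U(2)[OF that]] sqrt_3_bounds by (auto simp: norm_minus_commute)
  qed
  then show ?thesis using U(2) inner_not_unit[OF c(1)] by auto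
qed

lemma lattice_separated: "pairwise (\<lambda>c d. 2 \<le> cmod (c - d)) lattice"
proof (rule pairwiseI)
  fix c d assume "c \<in> lattice" "d \<in> lattice" "c \<noteq> d"
  then show "2 \<le> cmod (c - d)"
    using inner_inner_dist[of d c] inner_unit_dist[of c d] inner_unit_dist[of d c]
      separated[of "(c, 1)" "(d, 1)"] sqrt_3_bounds
    by (auto simp: lattice_def norm_minus_commute dist_norm)
qed

lemma lattice_inner_neighbour:
  assumes "inner y" "d \<in> lattice" "cmod (d - y) = 2" "h \<in> hexagon"
  shows "y + h * (d - y) \<in> lattice"
proof -
  obtain U where U: "cmod U = 1" "\<And>h. h \<in> hexagon \<Longrightarrow> (y + 2 * (h * U), 1) \<in> P"
    using inner_hexagon[OF assms(1)] by blast
  then have "y + 2 * (h * U) \<in> lattice" if "h \<in> hexagon" for h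
    using that by (simp add: lattice_def)
  from hexagonal_neighbours[OF lattice_separated U(1) this] assms
  obtain g where g: "g \<in> hexagon" "d = y + 2 * (g * U)" by auto
  then have eq: "y + h * (d - y) = y + 2 * ((h * g) * U)" by simp
  show ?thesis
    unfolding eq using U(2) hexagon_mult[OF assms(4) g(1)] by (simp add: lattice_def)
qed

text \<open>The disc \<open>g\<close> following \<open>d\<close> counterclockwise around
  \<open>c\<close> is either the unit disc at the third vertex or a small disc in the pocket between
  \<open>c\<close> and \<open>d\<close>. In the latter case the third vertex is the middle small
  disc in the corona of \<open>g\<close>, which is inner.\<close>

lemma unit_corona_turn:
  assumes c: "(c, 1) \<in> P" and d: "(d, 1) \<in> P" and cd: "cmod (d - c) = 2"
  shows "c + omega * (d - c) \<in> lattice"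
proof -
  obtain n :: nat and X :: "nat \<Rightarrow> disc" where "0 < n" and n: "\<And>j. neighbours P (c, 1) = X ` {j..<j + n}"
    and "\<And>i. X (i + n) = X i" and tan: "\<And>i. tangent (X i) (X (Suc i))"
    and "(\<Sum>i<n. angle_at c (centre (X i)) (centre (X (Suc i)))) = 2 * pi"
    and rot: "\<And>i. centre (X (Suc i)) - c = (1 + radius (X (Suc i))) / (1 + radius (X i)) *
       cis (angle_at c (centre (X i)) (centre (X (Suc i)))) * (centre (X i) - c)"
    using compact_packing_corona[OF compact c] by auto
  have nb: "X i \<in> neighbours P (c, 1)" for i
    using \<open>0 < n\<close> by (subst n[of i]) simp
  have "(d, 1) \<in> neighbours P (c, 1)"
    using d cd by (simp add: neighbours_def tangent_Pair)
  then obtain i where i: "X i = (d, 1)" using n[of 0] by auto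
  obtain g \<rho> where g: "X (Suc i) = (g, \<rho>)" by (cases "X (Suc i)")
  have gP: "(g, \<rho>) \<in> P" and cg: "cmod (g - c) = 1 + \<rho>"
    using nb[of "Suc i"] by (auto simp: g neighbours_def tangent_Pair)
  have dg: "cmod (d - g) = 1 + \<rho>"
    using tan[of i] by (simp add: i g tangent_Pair norm_minus_commute)
  have "angle_at c d g = corona_angle 1 1 \<rho>"
    using angle_at_tangent[of "(c, 1)" "X i" "X (Suc i)"] tan[of i] nb[of i] nb[of "Suc i"]
    by (simp add: i g neighbours_def)
  then have rot: "g - c = (1 + \<rho>) / 2 * cis (corona_angle 1 1 \<rho>) * (d - c)"
    using rot[of i] by (simp add: i g)
  consider "\<rho> = 1" | "\<rho> = r" using radii gP by auto
  then show ?thesis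
  proof cases
    case 1
    then have "c + omega * (d - c) = g"
      using rot by (simp add: corona_angle_units cis_pi_div_3 algebra_simps)
    then show ?thesis using gP 1 by (simp add: lattice_def)
  next
    case 2
    have g_eq: "2 * (g - c) = (1 + \<i> * s) * (d - c)"
      unfolding rot 2 cis_corona_angle_unit[symmetric] by simp
    have gr: "(g, r) \<in> P" using gP 2 by simp
    obtain w where w: "cmod w = 1" "neighbours P (g, r) = mixed_corona g w"
      using neighbour_unit_mixed[OF gr c] cg 2 by (auto simp: norm_minus_commute)
    have "(c, 1) \<in> neighbours P (g, r)" "(d, 1) \<in> neighbours P (g, r)"
      using c d cg dg 2 by (auto simp: neighbours_def tangent_Pair norm_minus_commute add.commute)
    then have cd_mem: "c = g - (s - \<i>) * w \<or> c = g - (s + \<i>) * w" "d = g - (s - \<i>) * w \<or> d = g - (s + \<i>) * w"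
      unfolding w(2) mixed_corona_unit by simp_all
    have "c \<noteq> d" using cd by auto
    \<comment> \<open>Orientation decides which of the two unit discs is \<open>c\<close>: the other
      choice puts \<open>g\<close> on the wrong side and forces \<open>s = 0\<close>.\<close>
    have c_eq: "c = g - (s - \<i>) * w"
    proof (rule ccontr)
      assume "c \<noteq> g - (s - \<i>) * w"
      then have "c = g - (s + \<i>) * w" "d = g - (s - \<i>) * w"
        using cd_mem \<open>c \<noteq> d\<close> by blast+
      then have "g - c = (s + \<i>) * w" "d - c = (s + \<i>) * w - (s - \<i>) * w"
        by (simp_all only:) (simp_all add: algebra_simps)
      then have "2 * ((s + \<i>) * w) = (1 + \<i> * s) * (2 * \<i> * w)"
        using g_eq by (simp add: left_diff_distrib distrib_right)
      then have "s + \<i> = (1 + \<i> * s) * \<i>"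
        using w(1) by auto
      then show False using s_pos by (simp add: complex_eq_iff)
    qed
    then have d_eq: "d = g - (s + \<i>) * w" using cd_mem \<open>c \<noteq> d\<close> by blast
    have "d - c = - 2 * \<i> * w" unfolding c_eq d_eq by (simp add: algebra_simps)
    moreover have "omega * (- 2 * \<i>) = sqrt 3 - \<i>" by (simp add: complex_eq_iff)
    ultimately have "omega * (d - c) = (sqrt 3 - \<i>) * w"
      by (metis mult.assoc)
    moreover have "g + complex_of_real (2 * r) * w - c = (sqrt 3 - \<i>) * w"
      using mixed_corona_middle(1)[of g w] unfolding c_eq[symmetric] .
    ultimately have "c + omega * (d - c) = g + complex_of_real (2 * r) * w"
      by (simp only: diff_eq_eq add.commute)
    then show ?thesis
      using mixed_middle_inner[OF gr w] by (simp add: lattice_def)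
  qed
qed

text \<open>Turning \<open>c\<close> about \<open>d\<close> by \<open>- (pi / 3)\<close> gives the
  same point as turning \<open>d\<close> about \<open>c\<close> by \<open>pi / 3\<close>, so the
  ring of an inner disc settles the case of either centre being inner.\<close>

lemma lattice_turn:
  assumes "c \<in> lattice" "d \<in> lattice" "cmod (d - c) = 2"
  shows "c + omega * (d - c) \<in> lattice"
proof -
  consider "inner c" | "inner d" | "(c, 1) \<in> P" "(d, 1) \<in> P"
    using assms by (auto simp: lattice_def)
  then show ?thesis
  proof cases
    case 1
    then show ?thesis using lattice_inner_neighbour assms by simp
  next
    case 2
    have "d + (1 - omega) * (c - d) \<in> lattice"
      using lattice_inner_neighbour[OF 2 assms(1)] assms(3) by (simp add: norm_minus_commute)
    then show ?thesis by (simp add: algebra_simps)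
  next
    case 3
    then show ?thesis using unit_corona_turn assms(3) by simp
  qed
qed

lemma small_disc_in_block:
  assumes "(x, r) \<in> P"
  shows "\<exists>y. inner y \<and> (x = y \<or> (x, r) \<in> neighbours P (y, r))"
proof (cases "inner x")
  case False
  then obtain w where w: "cmod w = 1" "neighbours P (x, r) = mixed_corona x w"
    using not_inner_mixed assms by blast
  have "(x, r) \<in> neighbours P (x + complex_of_real (2 * r) * w, r)"
    using assms w(1) by (simp add: neighbours_def tangent_Pair norm_mult)
  then show ?thesis using mixed_middle_inner[OF assms w] by blast
qed blast

text \<open>A small neighbour of a unit disc belongs to a block, whose centre is at distance 2 from
  the unit disc.\<close>

lemma lattice_has_neighbour:
  assumes "c \<in> lattice"
  shows "\<exists>d\<in>lattice. cmod (d - c) = 2"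
proof (cases "inner c")
  case True
  then obtain U where U: "cmod U = 1" "\<And>h. h \<in> hexagon \<Longrightarrow> (c + 2 * (h * U), 1) \<in> P"
    using inner_hexagon by blast
  then show ?thesis
    using U(2)[of 1] by (intro bexI[of _ "c + 2 * U"]) (auto simp: lattice_def norm_mult)
next
  case False
  then have c: "(c, 1) \<in> P" using assms by (simp add: lattice_def)
  obtain n :: nat and X :: "nat \<Rightarrow> disc" where "neighbours P (c, 1) = X ` {0..<0 + n}" "0 < n"
    using compact_packing_corona[OF compact c] by metis
  then have "X 0 \<in> neighbours P (c, 1)" by simp
  then obtain g \<rho> where g: "(g, \<rho>) \<in> P" "cmod (g - c) = 1 + \<rho>"
    by (cases "X 0") (auto simp: neighbours_def tangent_Pair)
  consider "\<rho> = 1" | "\<rho> = r" using radii g by auto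
  then show ?thesis
  proof cases
    case 1
    then show ?thesis using g by (auto simp: lattice_def)
  next
    case 2
    have cg: "cmod (c - g) = 1 + r" and gr: "(g, r) \<in> P" using g 2 by (simp_all add: norm_minus_commute)
    then obtain w where w: "cmod w = 1" "neighbours P (g, r) = mixed_corona g w"
      using neighbour_unit_mixed c by blast
    have "(c, 1) \<in> neighbours P (g, r)"
      using c cg by (simp add: neighbours_def tangent_Pair add.commute)
    then have "g + complex_of_real (2 * r) * w - c \<in> {(sqrt 3 - \<i>) * w, (sqrt 3 + \<i>) * w}"
      unfolding w(2) mixed_corona_unit using mixed_corona_middle[of g w] by auto
    then have "cmod (g + complex_of_real (2 * r) * w - c) = 2"
      using norm_sqrt_3_i w(1) by (auto simp: norm_mult)
    then show ?thesis using mixed_middle_inner[OF gr w] by (auto simp: lattice_def)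
  qed
qed

lemma hexagonal_lattice: "hexagonal lattice"
  unfolding hexagonal_def
proof (intro conjI ballI)
  fix c assume c: "c \<in> lattice"
  then obtain d where d: "d \<in> lattice" "cmod (d - c) = 2"
    using lattice_has_neighbour by blast
  define A where "A = {U. cmod U = 1 \<and> c + 2 * U \<in> lattice}"
  have "c + 2 * ((d - c) / 2) = d" by (simp del: right_diff_distrib_numeral)
  then have "(d - c) / 2 \<in> A" unfolding A_def using d by (simp only: mem_Collect_eq) (simp add: norm_divide)
  moreover have "omega * U \<in> A" if "U \<in> A" for U
    using that lattice_turn[OF c, of "c + 2 * U"] by (simp add: A_def norm_mult mult_ac)
  ultimately have "h * ((d - c) / 2) \<in> A" if "h \<in> hexagon" for h
    using hexagon_closed that by blast
  then show "\<exists>U. cmod U = 1 \<and> (\<forall>h\<in>hexagon. c + 2 * (h * U) \<in> lattice)"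
    using d(2) by (intro exI[of _ "(d - c) / 2"]) (auto simp: A_def norm_divide)
qed (rule lattice_separated)

lemma inner_block:
  assumes "inner y"
  shows "hexagonal_block r ((\<lambda>c. (c, 1)) ` lattice) (y, 1) (insert (y, r) (neighbours P (y, r)))"
proof -
  obtain u where u: "cmod u = 1" "neighbours P (y, r) = small_corona y u"
    "\<And>h. h \<in> hexagon \<Longrightarrow> (y + (sqrt 3 - \<i>) * (h * u), 1) \<in> P"
    using inner_units[OF assms] by blast
  let ?T = "(\<lambda>c. (c, 1 :: real)) ` lattice"
  define f where "f h = (y + complex_of_real (2 * r) * (h * u), r)" for h
  \<comment> \<open>Counterclockwise order: the successor modulo 6 is multiplication by
    \<open>omega\<close>.\<close>
  define hs where "hs = [1, omega, omega - 1, -1, -omega, 1 - omega]"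
  have hs: "hs ! i \<in> hexagon" "hs ! (Suc i mod 6) = omega * hs ! i" if "i < 6" for i
  proof -
    have "i \<in> {0, 1, 2, 3, 4, 5}" using that by auto
    moreover have "omega - 1 \<in> hexagon" "- omega \<in> hexagon" by (simp_all add: hexagon_def)
    ultimately have "hs ! i \<in> hexagon \<and> hs ! (Suc i mod 6) = omega * hs ! i"
      by (elim insertE emptyE) (simp_all add: hs_def right_diff_distrib omega_square)
    then show "hs ! i \<in> hexagon" "hs ! (Suc i mod 6) = omega * hs ! i" by simp_all
  qed
  have len: "length hs = 6" by (simp add: hs_def)
  have "u \<noteq> 0" using u(1) by auto
  have inj: "inj f" using \<open>u \<noteq> 0\<close> by (auto simp: f_def inj_on_def)
  have hs_set: "set hs = hexagon" by (simp add: hs_def hexagon_def)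
  then have "distinct hs" by (intro card_distinct) (simp add: len card_hexagon)
  then have dist: "distinct (map f hs)"
    using inj_on_subset[OF inj subset_UNIV] by (simp add: distinct_map)
  have set: "set (map f hs) = neighbours P (y, r)"
    unfolding u(2) small_corona_def by (simp add: hs_set f_def)
  have block: "radius (f h) = r" "tangent (f h) (y, r)" "tangent (f h) (f (omega * h))"
    "\<exists>E\<in>neighbours ?T (y, 1). \<exists>F\<in>neighbours ?T (y, 1). tangent E F \<and> tangent (f h) E \<and> tangent (f h) F"
    if h: "h \<in> hexagon" for h
  proof -
    have hu: "cmod (h * u) = 1" using h u by (simp add: norm_mult norm_hexagon)
    show "radius (f h) = r" by (simp add: f_def)
    show "tangent (f h) (y, r)"
      using hu by (simp add: f_def tangent_Pair norm_mult)
    have "y + complex_of_real (2 * r) * (omega * h * u) - (y + complex_of_real (2 * r) * (h * u))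
      = complex_of_real (2 * r) * (omega - 1) * (h * u)"
      by (simp add: algebra_simps)
    moreover have "cmod (omega - 1) = 1" by (rule norm_hexagon) (simp add: hexagon_def)
    ultimately show "tangent (f h) (f (omega * h))"
      using hu by (simp add: f_def tangent_Pair norm_mult)
    define E where "E = y + (sqrt 3 - \<i>) * (h * u)"
    define F where "F = y + (sqrt 3 + \<i>) * (h * u)"
    have "F = y + (sqrt 3 - \<i>) * ((omega * h) * u)"
      by (simp add: F_def mult.assoc flip: sqrt_3_i_omega)
    then have "(E, 1) \<in> P" "(F, 1) \<in> P"
      using u(3)[OF h] u(3)[OF hexagon_omega_mult[OF h]] by (auto simp: E_def)
    then have "(E, 1) \<in> neighbours ?T (y, 1)" "(F, 1) \<in> neighbours ?T (y, 1)"
      using hu norm_sqrt_3_i by (auto simp: E_def F_def lattice_def neighbours_def tangent_Pair norm_mult)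
    moreover have "F - E = 2 * \<i> * (h * u)" by (simp add: E_def F_def algebra_simps)
    then have "tangent (E, 1) (F, 1)" using hu by (simp add: tangent_Pair norm_mult)
    moreover have "E - (y + complex_of_real (2 * r) * (h * u)) = (s - \<i>) * (h * u)"
      "F - (y + complex_of_real (2 * r) * (h * u)) = (s + \<i>) * (h * u)"
      unfolding E_def F_def sqrt_3_s by (simp_all add: algebra_simps)
    then have "tangent (f h) (E, 1)" "tangent (f h) (F, 1)"
      using hu norm_s_i by (simp_all add: f_def tangent_Pair norm_mult)
    ultimately show "\<exists>E\<in>neighbours ?T (y, 1). \<exists>F\<in>neighbours ?T (y, 1). tangent E F \<and> tangent (f h) E \<and> tangent (f h) F"
      by blast
  qed
  show ?thesis
    unfolding hexagonal_block_def
    by (rule exI[of _ "map f hs"]) (use dist set block hs len in auto)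
qed

theorem is_block_replacement:
  assumes "\<exists>D\<in>P. radius D = r"
  shows "\<exists>T S. triangular_lattice_packing T \<and> S \<subseteq> T \<and> S \<noteq> {} \<and>
                (\<forall>D\<in>S. \<forall>E\<in>S. \<not> tangent D E) \<and> block_replacement r T S P"
proof -
  let ?T = "(\<lambda>c. (c, 1 :: real)) ` lattice" and ?S = "(\<lambda>c. (c, 1 :: real)) ` {y. inner y}"
  define B where "B D = insert (centre D, r) (neighbours P (centre D, r))" for D :: disc
  obtain x where x: "(x, r) \<in> P" using assms by (metis prod.collapse)
  have "lattice \<noteq> {}" using small_disc_in_block[OF x] by (auto simp: lattice_def)
  then have "triangular_lattice_packing ?T"
    using triangular_lattice_packing_hexagonal[OF hexagonal_lattice] by simp
  moreover have "?S \<subseteq> ?T" by (auto simp: lattice_def)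
  moreover have "?S \<noteq> {}" using small_disc_in_block[OF x] by auto
  moreover have "\<not> tangent (c, 1) (d, 1)" if "inner c" "inner d" for c d
    using inner_inner_dist[OF that(1,2)] sqrt_3_bounds by (cases "c = d") (auto simp: tangent_Pair)
  moreover have "P = (?T - ?S) \<union> (\<Union>D\<in>?S. B D)"
  proof (intro set_eqI iffI)
    fix D assume D: "D \<in> P"
    obtain z a where za: "D = (z, a)" by (cases D)
    then consider "a = 1" | "a = r" using radii D by auto
    then show "D \<in> (?T - ?S) \<union> (\<Union>D\<in>?S. B D)"
    proof cases
      case 1
      then show ?thesis using D za inner_not_unit by (auto simp: lattice_def)
    next
      case 2
      then show ?thesis using small_disc_in_block[of z] D za by (auto simp: B_def)
    qed
  next
    fix D assume "D \<in> (?T - ?S) \<union> (\<Union>D\<in>?S. B D)"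
    then show "D \<in> P" by (auto simp: lattice_def B_def neighbours_def inner_in)
  qed
  then have "block_replacement r ?T ?S P"
    unfolding block_replacement_def using inner_block by (intro exI[of _ B]) (auto simp: B_def)
  ultimately show ?thesis by blast
qed

end

section \<open>Lattices with blocks are compact packings\<close>

lemma hexagon_power: "hexagon = (\<lambda>k. omega ^ k) ` {..<6}"
proof -
  have "omega ^ 2 = omega - 1" by (simp add: power2_eq_square omega_square)
  moreover from this have "omega ^ 3 = -1"
    by (simp add: eval_nat_numeral right_diff_distrib omega_square)
  moreover from this have "omega ^ 4 = - omega" "omega ^ 5 = 1 - omega"
    by (simp_all add: eval_nat_numeral omega_square right_diff_distrib)
  moreover have "{..<6} = {0, 1, 2, 3, 4, 5::nat}" by auto
  ultimately show ?thesis by (simp add: hexagon_def)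
qed

lemma omega_power: "omega ^ k = cis (k * (pi / 3))"
  by (simp only: cis_pi_div_3[symmetric] Complex.DeMoivre)

lemma omega_power_6: "omega ^ 6 = 1"
  by (simp add: omega_power cis_2pi)

text \<open>Unit vectors at distance at least 1 subtend at least \<open>pi / 3\<close>, and six such
  gaps exhaust the turn, so each is exact. Distributing arguments over six sectors measured from
  \<open>w\<close> avoids sorting the points.\<close>

lemma kissing_turn:
  assumes N: "card N = 6" "\<And>z. z \<in> N \<Longrightarrow> cmod z = 1" "pairwise (\<lambda>z w. 1 \<le> cmod (z - w)) N"
    and w: "w \<in> N"
  shows "omega * w \<in> N"
proof -
  have w0: "w \<noteq> 0" "cmod w = 1" using N(2)[OF w] by auto
  define f where "f z = Arg2pi (z / w)" for z
  have f: "0 \<le> f z" "f z < 2 * pi" for z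
    using Arg2pi[of "z / w"] by (auto simp: f_def)
  have fz: "z = cis (f z) * w" if "z \<in> N" for z
    using Arg2pi_eq[of "z / w"] N(2)[OF that] w0
    by (simp add: f_def norm_divide cis_conv_exp field_simps)
  \<comment> \<open>The chord bounds the difference of arguments on both sides, since the points are
    also apart the other way round.\<close>
  have gap: "pi / 3 \<le> \<bar>f z - f z'\<bar>" "\<bar>f z - f z'\<bar> \<le> 5 * pi / 3" if "z \<in> N" "z' \<in> N" "z \<noteq> z'" for z z'
  proof -
    let ?a = "\<bar>f z - f z'\<bar>"
    have "1 \<le> cmod (z - z')" using N(3) that by (auto simp: pairwise_def)
    also have "z - z' = (cis (f z) - cis (f z')) * w"
      using fz[OF that(1)] fz[OF that(2)] by (simp add: left_diff_distrib)
    finally have "1 \<le> cmod (cis (f z) - cis (f z'))" using w0 by (simp add: norm_mult)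
    then have "1 \<le> (cmod (cis (f z) - cis (f z')))\<^sup>2" by simp
    also have "\<dots> = 2 - 2 * cos (f z - f z')"
    proof -
      have "(a - b)\<^sup>2 + (c - d)\<^sup>2 = (a\<^sup>2 + c\<^sup>2) + (b\<^sup>2 + d\<^sup>2) - 2 * (a * b + c * d)" for a b c d :: real
        by (simp add: power2_eq_square algebra_simps)
      then show ?thesis by (simp add: cmod_power2 cos_diff)
    qed
    finally have c: "cos ?a \<le> cos (pi / 3)" by (simp add: cos_60 cos_abs_real)
    have lt: "?a < 2 * pi" using f[of z] f[of z'] by auto
    show "pi / 3 \<le> ?a"
    proof (rule ccontr)
      assume "\<not> ?thesis"
      then have "cos (pi / 3) < cos ?a" by (intro cos_monotone_0_pi) auto
      with c show False by simp
    qed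
    show "?a \<le> 5 * pi / 3"
    proof (rule ccontr)
      assume "\<not> ?thesis"
      then have "cos (pi / 3) < cos (2 * pi - ?a)" using lt by (intro cos_monotone_0_pi) auto
      with c show False by simp
    qed
  qed
  \<comment> \<open>Each of the six sectors of angle \<open>pi / 3\<close> holds exactly one point; going down from the last sector,
    where the argument is at most \<open>5 * pi / 3\<close>, each argument is the least one in its sector.\<close>
  define b where "b z = nat \<lfloor>f z / (pi / 3)\<rfloor>" for z
  have b: "real (b z) * (pi / 3) \<le> f z" "f z < (real (b z) + 1) * (pi / 3)" for z
  proof -
    have "real (b z) = of_int \<lfloor>f z / (pi / 3)\<rfloor>" using f[of z] by (simp add: b_def)
    then have "real (b z) \<le> f z / (pi / 3)" "f z / (pi / 3) < real (b z) + 1" by linarith+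
    then show "real (b z) * (pi / 3) \<le> f z" "f z < (real (b z) + 1) * (pi / 3)"
      by (simp_all only: pos_le_divide_eq pos_divide_less_eq pi_gt_zero divide_pos_pos zero_less_numeral)
  qed
  have "inj_on b N"
  proof (rule inj_onI, rule ccontr)
    fix z z' assume z: "z \<in> N" "z' \<in> N" "b z = b z'" "z \<noteq> z'"
    then have "\<bar>f z - f z'\<bar> < pi / 3"
      using b[of z] b[of z'] unfolding abs_less_iff by (simp add: distrib_right)
    with gap(1)[OF z(1,2,4)] show False by simp
  qed
  moreover have "b z < 6" for z
  proof -
    have "real (b z) * (pi / 3) < 6 * (pi / 3)" using b(1)[of z] f(2)[of z] by linarith
    then show ?thesis by (subst (asm) mult_less_cancel_right_pos) auto
  qed
  ultimately have img: "b ` N = {..<6}"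
    using N(1) by (intro card_subset_eq) (auto simp: card_image)
  have ex: "\<exists>z\<in>N. b z = k" if "k < 6" for k
    using img that by (metis imageE lessThan_iff)
  have fw: "f w = 0" using w0 by (simp add: f_def Arg2pi_eq_0)
  have "\<exists>z\<in>N. b z = 5 - j \<and> f z = (5 - real j) * (pi / 3)" if "j \<le> 4" for j
    using that
  proof (induction j)
    case 0
    obtain z where z: "z \<in> N" "b z = 5" using ex[of 5] by auto
    have "0 < f z" using b(1)[of z] pi_gt_zero unfolding z(2) by linarith
    then have "z \<noteq> w" using fw by auto
    then have "f z \<le> 5 * pi / 3" using gap(2)[OF z(1) w] fw f(1)[of z] by simp
    then show ?case using z b(1)[of z] by auto
  next
    case (Suc j)
    then obtain z where z: "z \<in> N" "b z = 5 - j" "f z = (5 - real j) * (pi / 3)" by auto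
    obtain z' where z': "z' \<in> N" "b z' = 5 - Suc j" using ex[of "5 - Suc j"] Suc.prems by force
    have r: "real (5 - Suc j) = 5 - real (Suc j)" using Suc.prems by simp
    have "z \<noteq> z'" using z z' Suc.prems by auto
    moreover have "f z' < f z"
      using b(2)[of z'] unfolding z(3) z'(2) r by simp
    ultimately have "f z' \<le> f z - pi / 3" using gap(1)[OF z(1) z'(1)] by simp
    then have "f z' \<le> (5 - real (Suc j)) * (pi / 3)" unfolding z(3) by (simp add: algebra_simps)
    then have "f z' = (5 - real (Suc j)) * (pi / 3)" using b(1)[of z'] unfolding z'(2) r by linarith
    then show ?case using z' by blast
  qed
  \<comment> \<open>Four steps down from sector 5 end in sector 1, whose point is
    \<open>omega * w\<close>.\<close>
  from this[of 4] obtain z where "z \<in> N" "f z = pi / 3" by auto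
  then show ?thesis using fz by (metis cis_pi_div_3)
qed

lemma triangular_lattice_packing_centres:
  assumes "triangular_lattice_packing T"
  shows "hexagonal (centre ` T)" "T = (\<lambda>c. (c, 1)) ` centre ` T"
proof -
  let ?C = "centre ` T"
  show T: "T = (\<lambda>c. (c, 1)) ` ?C"
    using assms by (force simp: triangular_lattice_packing_def image_image)
  have mem: "(c, 1) \<in> T \<longleftrightarrow> c \<in> ?C" for c by (subst T) auto
  have pw: "pairwise (\<lambda>c d. 2 \<le> cmod (c - d)) ?C"
  proof (rule pairwiseI)
    fix c d assume "c \<in> ?C" "d \<in> ?C" "c \<noteq> d"
    then show "2 \<le> cmod (c - d)"
      using assms mem by (force simp: triangular_lattice_packing_def packing_iff dist_norm)
  qed
  have "\<exists>U. cmod U = 1 \<and> (\<forall>h\<in>hexagon. c + 2 * (h * U) \<in> ?C)" if c: "c \<in> ?C" for c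
  proof -
    define N where "N = {z. cmod z = 1 \<and> c + 2 * z \<in> ?C}"
    have "neighbours T (c, 1) = (\<lambda>z. (c + 2 * z, 1)) ` N"
    proof (intro set_eqI iffI)
      fix E assume E: "E \<in> neighbours T (c, 1)"
      then have "E = (centre E, 1)" "cmod (centre E - c) = 2"
        using assms by (auto simp: neighbours_def triangular_lattice_packing_def prod_eq_iff tangent_def dist_norm norm_minus_commute)
      moreover have "centre E = c + 2 * ((centre E - c) / 2)"
        by (simp del: right_diff_distrib_numeral)
      moreover have "centre E \<in> ?C" using E by (auto simp: neighbours_def)
      ultimately have "(centre E - c) / 2 \<in> N" by (simp only: N_def mem_Collect_eq) (simp add: norm_divide)
      then show "E \<in> (\<lambda>z. (c + 2 * z, 1)) ` N"
        using \<open>E = (centre E, 1)\<close> \<open>centre E = c + 2 * ((centre E - c) / 2)\<close>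
        by (metis (mono_tags, lifting) image_eqI)
    next
      fix E :: disc assume "E \<in> (\<lambda>z. (c + 2 * z, 1)) ` N"
      then obtain z where z: "E = (c + 2 * z, 1)" "cmod z = 1" "c + 2 * z \<in> ?C"
        by (auto simp only: N_def)
      then show "E \<in> neighbours T (c, 1)"
        using mem[of "c + 2 * z"] by (simp add: neighbours_def tangent_Pair norm_mult)
    qed
    moreover have "card (neighbours T (c, 1)) = 6"
      using assms c mem by (auto simp: triangular_lattice_packing_def)
    ultimately have card: "card N = 6"
      by (simp add: card_image inj_on_def)
    have "pairwise (\<lambda>z w. 1 \<le> cmod (z - w)) N"
    proof (rule pairwiseI)
      fix z w assume "z \<in> N" "w \<in> N" "z \<noteq> w"
      then have "2 \<le> cmod ((c + 2 * z) - (c + 2 * w))"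
        by (intro pairwiseD[OF pw]) (simp_all add: N_def)
      also have "(c + 2 * z) - (c + 2 * w) = 2 * (z - w)" by (simp add: algebra_simps)
      finally show "1 \<le> cmod (z - w)" by (simp only: norm_mult) simp
    qed
    then have turn: "omega * z \<in> N" if "z \<in> N" for z
      using kissing_turn[OF card _ _ that] by (auto simp: N_def)
    obtain U where "U \<in> N" using card by fastforce
    then show ?thesis
      using hexagon_closed[of N U] turn by (intro exI[of _ U]) (auto simp: N_def)
  qed
  then show "hexagonal ?C" using pw by (simp add: hexagonal_def)
qed

section \<open>Coronas from the angles of tangent triples\<close>

lemma corona_angle_bounds:
  assumes "0 < R" "0 < x" "0 < y"
  shows "0 < corona_angle R x y" "corona_angle R x y < pi"
    "cos (corona_angle R x y) = ((R + x)\<^sup>2 + (R + y)\<^sup>2 - (x + y)\<^sup>2) / (2 * (R + x) * (R + y))"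
proof -
  let ?a = "((R + x)\<^sup>2 + (R + y)\<^sup>2 - (x + y)\<^sup>2) / (2 * (R + x) * (R + y))"
  define X where "X = (R + x) * (R + y)"
  \<comment> \<open>The cosine becomes \<open>1 - 2 * x * y / X\<close>, and its bounds reduce to
    \<open>0 < x * y < X\<close>.\<close>
  have num: "(R + x)\<^sup>2 + (R + y)\<^sup>2 - (x + y)\<^sup>2 = 2 * X - 4 * (x * y)" and den: "2 * (R + x) * (R + y) = 2 * X"
    by (simp_all add: X_def power2_eq_square algebra_simps)
  have "0 < x * y" "0 < R * x" "0 < R * y" "0 < R * R" using assms by auto
  moreover from this have "x * y < X" by (simp add: X_def algebra_simps)
  ultimately have "-1 < ?a" "?a < 1"
    unfolding num den by (simp_all add: pos_less_divide_eq pos_divide_less_eq)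
  then show "0 < corona_angle R x y" "corona_angle R x y < pi" "cos (corona_angle R x y) = ?a"
    unfolding corona_angle_def using arccos_lt_bounded by (auto intro!: cos_arccos)
qed

lemma polar_disc_tangent:
  assumes "cmod u = 1" "0 < radius D" "0 < fst p" "0 < fst q"
    "snd q = snd p + corona_angle (radius D) (fst p) (fst q)"
  shows "tangent (polar_disc D u p) (polar_disc D u q)"
proof -
  define a b where "a = radius D + fst p" and "b = radius D + fst q"
  let ?t = "corona_angle (radius D) (fst p) (fst q)"
  have ab: "0 < a" "0 < b" using assms by (simp_all add: a_def b_def)
  have "centre (polar_disc D u q) - centre (polar_disc D u p) = (b * cis (snd q) - a * cis (snd p)) * u"
    by (simp add: polar_disc_def a_def b_def algebra_simps)
  then have "cmod (centre (polar_disc D u q) - centre (polar_disc D u p)) = cmod (b * cis (snd q) - a * cis (snd p))"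
    using assms(1) by (simp only: norm_mult mult_1_right)
  also have "b * cis (snd q) - a * cis (snd p) = cis (snd p) * (b * cis ?t - a)"
    by (simp add: assms(5) algebra_simps flip: cis_mult)
  also have "cmod \<dots> = cmod (b * cis ?t - a)"
    by (simp add: norm_mult)
  finally have n: "cmod (centre (polar_disc D u q) - centre (polar_disc D u p)) = cmod (b * cis ?t - a)" .
  have "(b * C - a)\<^sup>2 + (b * S)\<^sup>2 = b\<^sup>2 * (C\<^sup>2 + S\<^sup>2) + a\<^sup>2 - 2 * a * b * C" for C S
    by (simp add: power2_eq_square algebra_simps)
  then have "(cmod (b * cis ?t - a))\<^sup>2 = b\<^sup>2 + a\<^sup>2 - 2 * a * b * cos ?t"
    by (simp add: cmod_power2)
  also have "2 * a * b * cos ?t = a\<^sup>2 + b\<^sup>2 - (fst p + fst q)\<^sup>2"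
    using ab unfolding corona_angle_bounds(3)[OF assms(2-4)] by (simp flip: a_def b_def)
  finally have "(cmod (b * cis ?t - a))\<^sup>2 = (fst p + fst q)\<^sup>2" by simp
  then have "cmod (b * cis ?t - a) = fst p + fst q"
    using assms(3,4) by (simp add: power2_eq_iff_nonneg)
  then show ?thesis
    using n by (simp add: tangent_def dist_norm norm_minus_commute polar_disc_def)
qed

lemma corona_criterion_angles:
  fixes ps :: "(real \<times> real) list"
  assumes u: "cmod u = 1" and D: "0 < radius D" and ne: "ps \<noteq> []" and pos: "\<And>p. p \<in> set ps \<Longrightarrow> 0 < fst p"
    and nbs: "polar_disc D u ` set ps = neighbours P D"
    and succ: "successively (\<lambda>p q. snd q = snd p + corona_angle (radius D) (fst p) (fst q))
      (ps @ [(fst (hd ps), snd (hd ps) + 2 * pi)])"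
  shows "\<exists>Ds. corona P D Ds \<and>
        (\<forall>i<length Ds. tangent (Ds ! i) (Ds ! (Suc i mod length Ds))) \<and>
        (\<Sum>i<length Ds.
           angle_at (centre D) (centre (Ds ! i)) (centre (Ds ! (Suc i mod length Ds)))) = 2 * pi"
proof (rule corona_criterion[OF u D ne pos nbs])
  show "successively (\<lambda>p q. snd p < snd q \<and> snd q \<le> snd p + pi \<and> tangent (polar_disc D u p) (polar_disc D u q))
      (ps @ [(fst (hd ps), snd (hd ps) + 2 * pi)])"
  proof (rule successively_mono[OF succ])
    fix p q assume "p \<in> set (ps @ [(fst (hd ps), snd (hd ps) + 2 * pi)])"
      "q \<in> set (ps @ [(fst (hd ps), snd (hd ps) + 2 * pi)])"
      and q: "snd q = snd p + corona_angle (radius D) (fst p) (fst q)"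
    moreover have "0 < fst p'" if "p' \<in> set (ps @ [(fst (hd ps), snd (hd ps) + 2 * pi)])" for p'
      using that pos pos[OF hd_in_set[OF ne]] by (cases "p' \<in> set ps") auto
    ultimately have "0 < fst p" "0 < fst q" by blast+
    then show "snd p < snd q \<and> snd q \<le> snd p + pi \<and> tangent (polar_disc D u p) (polar_disc D u q)"
      using polar_disc_tangent[OF u D _ _ q] corona_angle_bounds[OF D, of "fst p" "fst q"] q by simp
  qed
qed

text \<open>A corona is assembled from six sectors of one or two discs; \<open>L n\<close>, the
  first sector one turn later, contributes only its head.\<close>

lemma successively_concat_upt:
  assumes "\<And>k. k \<le> n \<Longrightarrow> L k \<noteq> []" "\<And>k. k < n \<Longrightarrow> successively Q (L k)"
    "\<And>k. k < n \<Longrightarrow> Q (last (L k)) (hd (L (Suc k)))"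
  shows "successively Q (concat (map L [0..<n]) @ [hd (L n)])"
  using assms
proof (induction n)
  case (Suc n)
  then have "successively Q (concat (map L [0..<n]) @ [hd (L n)])" by simp
  then show ?case
    using Suc.prems(1)[of n] Suc.prems(2,3)[of n] by (auto simp: successively_append_iff)
qed simp

section \<open>The position of a block among its unit discs\<close>

context block_radius
begin

text \<open>The law of cosines for a block centre, an outer small disc and a unit disc tangent to
  it: sides \<open>2 * r\<close>, 2 and \<open>1 + r\<close>, angle \<open>pi / 6\<close> at the
  centre.\<close>

lemma sqrt_3_r: "4 * (sqrt 3 * r) = 4 * r\<^sup>2 + 4 - (1 + r)\<^sup>2"
  using quadratic by (simp add: power2_eq_square algebra_simps)

text \<open>Differences of the three circle equations are linear; the first gives \<open>x\<close>,
  the second \<open>y\<close>.\<close>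

lemma block_disc_position:
  assumes e: "cmod e = 1" and z: "cmod z = 2 * r" "cmod (z - 2 * e) = 1 + r" "cmod (z - 2 * (omega * e)) = 1 + r"
  shows "z = r * (sqrt 3 + \<i>) * e"
proof -
  define t where "t = z / e"
  have "e \<noteq> 0" using e by auto
  then have zt: "z = t * e" by (simp add: t_def)
  define x y where "x = Re t" and "y = Im t"
  have "cmod t = 2 * r" using z(1) e by (simp add: zt norm_mult)
  then have 1: "x\<^sup>2 + y\<^sup>2 = 4 * r\<^sup>2"
    by (simp add: x_def y_def flip: cmod_power2)
  have "z - 2 * e = (t - 2) * e" by (simp add: zt algebra_simps)
  then have "cmod (t - 2) = 1 + r" using z(2) e by (simp add: norm_mult)
  then have "(cmod (t - 2))\<^sup>2 = (1 + r)\<^sup>2" by simp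
  then have "(x - 2)\<^sup>2 + y\<^sup>2 = (1 + r)\<^sup>2"
    by (simp add: x_def y_def cmod_power2)
  then have "4 * x = x\<^sup>2 + y\<^sup>2 + 4 - (1 + r)\<^sup>2"
    by (simp add: power2_eq_square algebra_simps)
  then have x: "x = sqrt 3 * r" unfolding 1 sqrt_3_r[symmetric] by simp
  have "z - 2 * (omega * e) = (t - 2 * omega) * e" by (simp add: zt algebra_simps)
  then have "cmod (t - 2 * omega) = 1 + r" using z(3) e by (simp add: norm_mult)
  then have "(cmod (t - 2 * omega))\<^sup>2 = (1 + r)\<^sup>2" by simp
  then have "(x - 1)\<^sup>2 + (y - sqrt 3)\<^sup>2 = (1 + r)\<^sup>2"
    by (simp add: x_def y_def cmod_power2)
  then have "2 * x + 2 * (sqrt 3 * y) = x\<^sup>2 + y\<^sup>2 + 4 - (1 + r)\<^sup>2"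
    by (simp add: power2_eq_square algebra_simps)
  then have "2 * x + 2 * (sqrt 3 * y) = 4 * (sqrt 3 * r)" unfolding 1 sqrt_3_r .
  then have "2 * (sqrt 3 * y) = 2 * (sqrt 3 * r)" unfolding x by simp
  then have y: "y = r" by simp
  have "t = r * (sqrt 3 + \<i>)"
    using x y by (simp add: complex_eq_iff x_def y_def)
  then show ?thesis using zt by simp
qed

lemma card_small_corona: "cmod u = 1 \<Longrightarrow> card (small_corona x u) = 6"
  unfolding small_corona_def by (subst card_image) (auto simp: inj_on_def card_hexagon)

text \<open>The two unit discs touching a disc of the block are consecutive in the hexagon, which
  leaves six positions. Six distinct discs fill them, whatever their numbering.\<close>

lemma hexagonal_block_small_corona:
  assumes T: "triangular_lattice_packing T" and D: "(c, 1) \<in> T"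
    and block: "hexagonal_block r T (c, 1) B"
  shows "\<exists>v. cmod v = 1 \<and> B = insert (c, r) (small_corona c v) \<and>
    (\<forall>h\<in>hexagon. c + (sqrt 3 - \<i>) * (h * v) \<in> centre ` T)"
proof -
  have pw: "pairwise (\<lambda>c d. 2 \<le> cmod (c - d)) (centre ` T)"
    using triangular_lattice_packing_centres(1)[OF T] by (simp add: hexagonal_def)
  obtain U where U: "cmod U = 1" "\<And>h. h \<in> hexagon \<Longrightarrow> c + 2 * (h * U) \<in> centre ` T"
    using triangular_lattice_packing_centres(1)[OF T] D unfolding hexagonal_def by force
  have nb: "\<exists>h\<in>hexagon. E = (c + 2 * (h * U), 1)" if "E \<in> neighbours T (c, 1)" for E
  proof -
    have "E = (centre E, 1)" "centre E \<in> centre ` T" "cmod (centre E - c) = 2"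
      using that T by (auto simp: neighbours_def triangular_lattice_packing_def prod_eq_iff tangent_def
        dist_norm norm_minus_commute)
    then show ?thesis using hexagonal_neighbours[OF pw U] by (metis (mono_tags, lifting) imageE mem_Collect_eq)
  qed
  \<comment> \<open>Half of \<open>sqrt 3 + \<i>\<close> is the turn by \<open>pi / 6\<close>: outer
    discs point midway between unit discs.\<close>
  define v where "v = (sqrt 3 + \<i>) / 2 * U"
  have v: "cmod v = 1" using U(1) norm_sqrt_3_i by (simp add: v_def norm_mult norm_divide)
  have vU: "(sqrt 3 - \<i>) * v = 2 * U"
  proof -
    have "(sqrt 3 - \<i>) * (sqrt 3 + \<i>) = 4" by (simp add: complex_eq_iff)
    moreover have "(sqrt 3 - \<i>) * v = (sqrt 3 - \<i>) * (sqrt 3 + \<i>) / 2 * U" by (simp add: v_def)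
    ultimately show ?thesis by simp
  qed
  obtain bs where bs: "length bs = 6" "distinct bs" "B = insert (c, r) (set bs)"
    "\<And>i. i < 6 \<Longrightarrow> radius (bs ! i) = r \<and> tangent (bs ! i) (c, r) \<and>
      (\<exists>E\<in>neighbours T (c, 1). \<exists>F\<in>neighbours T (c, 1). tangent E F \<and> tangent (bs ! i) E \<and> tangent (bs ! i) F)"
    using block unfolding hexagonal_block_def by auto
  have pos: "z = complex_of_real (2 * r) * (h * v)"
    if "h \<in> hexagon" "cmod z = 2 * r" "cmod (z - 2 * (h * U)) = 1 + r" "cmod (z - 2 * (omega * (h * U))) = 1 + r" for z h
    using block_disc_position[of "h * U" z] that U(1) by (simp add: norm_mult norm_hexagon v_def)
  have "bs ! i \<in> small_corona c v" if i: "i < 6" for i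
  proof -
    define z where "z = centre (bs ! i) - c"
    have bz: "bs ! i = (c + z, r)" using bs(4)[OF i] by (simp add: z_def prod_eq_iff)
    obtain E F where EF: "E \<in> neighbours T (c, 1)" "F \<in> neighbours T (c, 1)"
      "tangent E F" "tangent (bs ! i) E" "tangent (bs ! i) F" using bs(4)[OF i] by blast
    obtain h g where hg: "h \<in> hexagon" "E = (c + 2 * (h * U), 1)" "g \<in> hexagon" "F = (c + 2 * (g * U), 1)"
      using nb[OF EF(1)] nb[OF EF(2)] by blast
    have z: "cmod z = 2 * r"
      using bs(4)[OF i] by (simp add: bz tangent_Pair norm_minus_commute)
    have E: "cmod (z - 2 * (h * U)) = 1 + r" and F: "cmod (z - 2 * (g * U)) = 1 + r"
      using EF(4,5) by (simp_all add: bz hg tangent_Pair norm_minus_commute add.commute)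
    have "2 * (g * U) - 2 * (h * U) = 2 * (g - h) * U" by (simp add: algebra_simps)
    moreover have "cmod (2 * (g * U) - 2 * (h * U)) = 2" using EF(3) by (simp add: hg tangent_Pair)
    ultimately have "cmod (g - h) = 1" using U(1) by (simp only: norm_mult) simp
    then consider "g = omega * h" | "g = (1 - omega) * h" using hexagon_adjacent hg by blast
    then show ?thesis
    proof cases
      case 1
      then have "z = complex_of_real (2 * r) * (h * v)"
        using pos[OF hg(1) z E] F by (simp add: mult.assoc)
      then show ?thesis using hg(1) by (auto simp: small_corona_def bz)
    next
      case 2
      \<comment> \<open>Here \<open>F\<close> precedes \<open>E\<close>, so \<open>g\<close> takes
        the role of \<open>h\<close>.\<close>
      then have "omega * g = h"
        by (simp add: right_diff_distrib left_diff_distrib omega_square flip: mult.assoc)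
      then have "z = complex_of_real (2 * r) * (g * v)"
        using pos[OF hg(3) z F] E by (simp flip: mult.assoc)
      then show ?thesis using hg(3) by (auto simp: small_corona_def bz)
    qed
  qed
  then have "set bs \<subseteq> small_corona c v"
    using bs(1) by (metis in_set_conv_nth subsetI)
  moreover have "card (set bs) = card (small_corona c v)"
    using bs(1,2) card_small_corona[OF v] by (simp add: distinct_card)
  moreover have "finite (small_corona c v)" by (simp add: small_corona_def)
  ultimately have "set bs = small_corona c v" by (intro card_subset_eq) auto
  moreover have "c + (sqrt 3 - \<i>) * (h * v) \<in> centre ` T" if "h \<in> hexagon" for h
  proof -
    have "(sqrt 3 - \<i>) * (h * v) = h * ((sqrt 3 - \<i>) * v)" by (simp only: mult_ac)
    also have "\<dots> = 2 * (h * U)" unfolding vU by simp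
    finally show ?thesis using U(2)[OF that] by (simp only:)
  qed
  ultimately show ?thesis using v bs(3) by blast
qed

text \<open>Seen from the outer disc in direction 1, two unit discs of the ring are tangent, the two
  at a right angle have squared distance \<open>4 + 4 * r^2\<close>, and the two behind are already
  too far in real part.\<close>

lemma outer_unit_dist:
  assumes "g \<in> hexagon"
  shows "1 + r \<le> cmod ((sqrt 3 - \<i>) * g - 2 * r)"
    "cmod ((sqrt 3 - \<i>) * g - 2 * r) = 1 + r \<longleftrightarrow> g = 1 \<or> g = omega"
proof -
  have gt: "1 + r < cmod z" if "(1 + r)\<^sup>2 < (cmod z)\<^sup>2" for z
    using that r_pos(5) by (meson norm_ge_zero power_less_imp_less_base)
  have rr: "(1 + r)\<^sup>2 < 4 + 4 * r\<^sup>2" 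
  proof -
    have "0 < sqrt 3 * r" by simp
    then show ?thesis using sqrt_3_r by linarith
  qed
  have big: "1 + r < cmod z" if "Re z < - (1 + r)" for z
    using that abs_Re_le_cmod[of z] by linarith
  have 1: "cmod ((sqrt 3 - \<i>) * 1 - 2 * r) = 1 + r"
    using norm_s_i by (simp add: sqrt_3_s)
  have 2: "cmod ((sqrt 3 - \<i>) * omega - 2 * r) = 1 + r"
    using norm_s_i unfolding sqrt_3_i_omega by (simp add: sqrt_3_s)
  have 3: "1 + r < cmod ((sqrt 3 - \<i>) * (omega - 1) - 2 * r)"
    "1 + r < cmod ((sqrt 3 - \<i>) * (1 - omega) - 2 * r)"
  proof -
    have "(sqrt 3 - \<i>) * (omega - 1) = 2 * \<i>" "(sqrt 3 - \<i>) * (1 - omega) = - 2 * \<i>"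
      by (simp_all add: complex_eq_iff)
    then show "1 + r < cmod ((sqrt 3 - \<i>) * (omega - 1) - 2 * r)" "1 + r < cmod ((sqrt 3 - \<i>) * (1 - omega) - 2 * r)"
      using rr by (intro gt; simp only: cmod_power2; simp add: power_mult_distrib)+
  qed
  have 4: "1 + r < cmod ((sqrt 3 - \<i>) * (- 1) - 2 * r)"
    by (rule big) (use sqrt_3_bounds r_gt in simp)
  have 5: "1 + r < cmod ((sqrt 3 - \<i>) * (- omega) - 2 * r)"
    by (rule big) (use sqrt_3_bounds r_gt in simp)
  have om: "omega - 1 \<noteq> 1" "omega - 1 \<noteq> omega" "1 - omega \<noteq> 1" "1 - omega \<noteq> omega" "- 1 \<noteq> omega"
    "- omega \<noteq> 1" "- omega \<noteq> omega" "(- 1 :: complex) \<noteq> 1"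
    by (auto simp: complex_eq_iff)
  define Q where "Q g \<longleftrightarrow> 1 + r \<le> cmod ((sqrt 3 - \<i>) * g - 2 * r) \<and>
    (cmod ((sqrt 3 - \<i>) * g - 2 * r) = 1 + r \<longleftrightarrow> g = 1 \<or> g = omega)" for g
  have strict: "Q g" if "1 + r < cmod ((sqrt 3 - \<i>) * g - 2 * r)" "g \<noteq> 1" "g \<noteq> omega" for g
    using that unfolding Q_def by linarith
  have "Q 1" "Q omega" unfolding Q_def 1 2 by simp_all
  moreover have "Q (omega - 1)" "Q (1 - omega)" "Q (- 1)" "Q (- omega)"
    using 3 4 5 om by (auto intro!: strict)
  ultimately have "Q g" using assms by (auto simp: hexagon_def)
  then show "1 + r \<le> cmod ((sqrt 3 - \<i>) * g - 2 * r)"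
    "cmod ((sqrt 3 - \<i>) * g - 2 * r) = 1 + r \<longleftrightarrow> g = 1 \<or> g = omega"
    unfolding Q_def by simp_all
qed

end

section \<open>Blocks as sets of centres\<close>

context block_radius
begin

text \<open>With \<open>b = corona_angle 1 1 r\<close>, a block replacing a unit neighbour shows two
  small discs at angles \<open>pi / 3 - b\<close> on either side of the old direction. The angles
  \<open>b\<close>, \<open>2 * pi / 3 - 2 * b\<close>, \<open>b\<close> fill the sector between the
  neighbours before and after.\<close>

lemma unit_block_angle:
  "corona_angle 1 r r = 2 * pi / 3 - 2 * corona_angle 1 1 r" "corona_angle 1 r 1 = corona_angle 1 1 r"
  "(1 + r) * cis (pi / 3 - corona_angle 1 1 r) = 2 - sqrt 3 * r + \<i> * r"
proof -
  let ?b = "corona_angle 1 1 r"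
  have b: "(1 + r) * cos ?b = 1" "(1 + r) * sin ?b = s"
    using arg_cong[OF cis_corona_angle_unit, of Re] arg_cong[OF cis_corona_angle_unit, of Im] by auto
  have cs: "(1 + r) * cos (pi / 3 - ?b) = 2 - sqrt 3 * r" "(1 + r) * sin (pi / 3 - ?b) = r"
  proof -
    have "2 * ((1 + r) * cos (pi / 3 - ?b)) = (1 + r) * cos ?b + sqrt 3 * ((1 + r) * sin ?b)"
      unfolding cos_diff cos_60 sin_60 by (simp add: field_simps)
    then show "(1 + r) * cos (pi / 3 - ?b) = 2 - sqrt 3 * r"
      unfolding b by (simp add: s_def algebra_simps)
    have "2 * ((1 + r) * sin (pi / 3 - ?b)) = sqrt 3 * ((1 + r) * cos ?b) - (1 + r) * sin ?b"
      unfolding sin_diff cos_60 sin_60 by (simp add: field_simps)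
    then show "(1 + r) * sin (pi / 3 - ?b) = r"
      unfolding b by (simp add: s_def)
  qed
  then show "(1 + r) * cis (pi / 3 - ?b) = 2 - sqrt 3 * r + \<i> * r"
    by (simp add: complex_eq_iff)
  show "corona_angle 1 r 1 = ?b"
    unfolding corona_angle_def by (simp add: algebra_simps)
  have "cos ?b = 1 / (1 + r)" using b(1) r_pos(6) by (metis nonzero_mult_div_cancel_left)
  moreover have "1 / 2 < 1 / (1 + r)" using r_gt r_lt by (simp add: divide_simps)
  ultimately have "cos (pi / 3) < cos ?b" by (simp add: cos_60)
  then have lt: "?b < pi / 3" 
    using corona_angle_bounds(1,2)[of 1 1 r] by (subst (asm) cos_mono_less_eq) auto
  have "cos (2 * (pi / 3 - ?b)) = 1 - 2 * (r / (1 + r))\<^sup>2"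
  proof -
    have "sin (pi / 3 - ?b) = r / (1 + r)" using cs(2) r_pos(6) by (metis nonzero_mult_div_cancel_left)
    then show ?thesis using cos_double_sin[of "pi / 3 - ?b"] by simp
  qed
  also have "\<dots> = ((1 + r)\<^sup>2 + (1 + r)\<^sup>2 - (r + r)\<^sup>2) / (2 * (1 + r) * (1 + r))"
    using r_gt by (simp add: divide_simps power_divide) (simp add: power2_eq_square algebra_simps)
  finally have "corona_angle 1 r r = arccos (cos (2 * (pi / 3 - ?b)))"
    by (simp add: corona_angle_def)
  also have "\<dots> = 2 * (pi / 3 - ?b)"
    using lt corona_angle_bounds(1)[of 1 1 r] by (intro arccos_cos) auto
  finally show "corona_angle 1 r r = 2 * pi / 3 - 2 * ?b" by simp
qed

definition block :: "complex \<Rightarrow> complex \<Rightarrow> complex set" where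
  "block c v = insert c ((\<lambda>h. c + complex_of_real (2 * r) * (h * v)) ` hexagon)"

lemma block_discs: "insert (c, r) (small_corona c v) = (\<lambda>z. (z, r)) ` block c v"
  by (simp add: block_def small_corona_def image_image)

lemma block_near: "cmod v = 1 \<Longrightarrow> z \<in> block c v \<Longrightarrow> cmod (z - c) \<le> 2 * r"
  by (auto simp: block_def norm_mult norm_hexagon)

lemma block_separated:
  assumes "cmod v = 1" "z \<in> block c v" "z' \<in> block c v" "z \<noteq> z'"
  shows "2 * r \<le> cmod (z - z')"
proof -
  have "2 * r \<le> cmod (complex_of_real (2 * r) * (h * v) - complex_of_real (2 * r) * (g * v))"
    if "g \<in> hexagon" "h \<in> hexagon" "g \<noteq> h" for g h
  proof -
    have "complex_of_real (2 * r) * (h * v) - complex_of_real (2 * r) * (g * v) = complex_of_real (2 * r) * ((h - g) * v)"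
      by (simp add: algebra_simps)
    then have "cmod (complex_of_real (2 * r) * (h * v) - complex_of_real (2 * r) * (g * v)) = 2 * r * cmod (h - g)"
      using assms(1) by (simp only: norm_mult) simp
    then show ?thesis using hexagon_dist_ge[of h g] that by simp
  qed
  then show ?thesis
    using assms by (auto simp: block_def norm_mult norm_hexagon)
qed

end

text \<open>\<open>V c\<close> is the direction of one outer disc of the block at \<open>c\<close>;
  the last assumption orients the block so that its outer discs point between consecutive lattice
  neighbours.\<close>

locale block_lattice = block_radius +
  fixes C S :: "complex set" and V :: "complex \<Rightarrow> complex"
  assumes lattice: "hexagonal C" and S_C: "S \<subseteq> C"
    and independent: "\<And>c d. c \<in> S \<Longrightarrow> d \<in> S \<Longrightarrow> cmod (d - c) \<noteq> 2"
    and V: "\<And>c. c \<in> S \<Longrightarrow> cmod (V c) = 1"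
    and V_C: "\<And>c h. c \<in> S \<Longrightarrow> h \<in> hexagon \<Longrightarrow> c + (sqrt 3 - \<i>) * (h * V c) \<in> C"
begin

definition P :: "disc set" where
  "P = (\<lambda>c. (c, 1)) ` (C - S) \<union> (\<Union>c\<in>S. (\<lambda>z. (z, r)) ` block c (V c))"

lemma C_separated: "pairwise (\<lambda>c d. 2 \<le> cmod (c - d)) C"
  using lattice by (simp add: hexagonal_def)

lemma S_neighbour:
  assumes "c \<in> S" "d \<in> C" "d \<noteq> c"
  shows "(\<exists>h\<in>hexagon. d = c + (sqrt 3 - \<i>) * (h * V c)) \<or> 2 * sqrt 3 \<le> cmod (d - c)"
proof -
  define U where "U = (sqrt 3 - \<i>) / 2 * V c"
  have U: "cmod U = 1"
    using V[OF assms(1)] norm_sqrt_3_i by (simp add: U_def norm_mult norm_divide)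
  have eq: "(sqrt 3 - \<i>) * (h * V c) = 2 * (h * U)" for h
    by (simp add: U_def)
  have "c + 2 * (h * U) \<in> C" if "h \<in> hexagon" for h
    using V_C[OF assms(1) that] by (simp add: eq)
  then show ?thesis
    unfolding eq using C_separated assms(2)
    by (intro hexagon_surrounded[OF U assms(3)]) (auto simp: pairwise_def)
qed

lemma S_far:
  assumes "c \<in> S" "d \<in> S" "d \<noteq> c"
  shows "2 * sqrt 3 \<le> cmod (d - c)"
proof -
  have "cmod ((sqrt 3 - \<i>) * (h * V c)) = 2" if "h \<in> hexagon" for h
    using V[OF assms(1)] norm_sqrt_3_i that by (simp add: norm_mult norm_hexagon)
  then have "cmod (d - c) = 2" if "h \<in> hexagon" "d = c + (sqrt 3 - \<i>) * (h * V c)" for h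
    using that by simp
  moreover have "d \<in> C" using S_C assms by blast
  ultimately show ?thesis
    using S_neighbour[of c d] independent[OF assms(1,2)] assms by blast
qed

text \<open>Centres in \<open>S\<close> are not lattice neighbours, hence at least
  \<open>2 * sqrt 3\<close> apart, and the centres in a block stay within \<open>2 * r\<close> of
  its own.\<close>

lemma blocks_apart:
  assumes "c \<in> S" "d \<in> S" "d \<noteq> c" "z \<in> block c (V c)" "z' \<in> block d (V d)"
  shows "2 * r < cmod (z' - z)"
proof -
  have "cmod (z - c) \<le> 2 * r" "cmod (z' - d) \<le> 2 * r"
    using block_near assms V by auto
  moreover have "d - c = (d - z') + (z' - z) + (z - c)" by simp
  then have "cmod (d - c) \<le> cmod (d - z') + cmod (z' - z) + cmod (z - c)"
    by (metis norm_triangle_le norm_triangle_ineq add_right_mono order_trans)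
  ultimately show ?thesis
    using S_far[OF assms(1-3)] sqrt_3_bounds r_lt by (simp add: norm_minus_commute)
qed

text \<open>Beyond the ring, \<open>2 * sqrt 3\<close> leaves ample room. On the ring, the inverse
  \<open>k\<close> of \<open>h\<close> turns the outer disc to direction 1, where
  \<open>outer_unit_dist\<close> applies.\<close>

lemma block_unit_dist:
  assumes c: "c \<in> S" and d: "d \<in> C - S" and z: "z \<in> block c (V c)"
  shows "1 + r \<le> cmod (d - z)"
    "cmod (d - z) = 1 + r \<longleftrightarrow> (\<exists>h\<in>hexagon. z = c + complex_of_real (2 * r) * (h * V c) \<and>
      (d = c + (sqrt 3 - \<i>) * (h * V c) \<or> d = c + (sqrt 3 + \<i>) * (h * V c)))" (is "_ \<longleftrightarrow> ?R")
proof -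
  have dc: "d \<noteq> c" using c d by auto
  have Vc: "cmod (V c) = 1" "V c \<noteq> 0" using V[OF c] by auto
  have R: "cmod (d - z) = 1 + r" if "?R"
  proof -
    from that obtain h where h: "h \<in> hexagon" "z = c + complex_of_real (2 * r) * (h * V c)"
      "d = c + (sqrt 3 - \<i>) * (h * V c) \<or> d = c + (sqrt 3 + \<i>) * (h * V c)" by blast
    then have "d - z = (s - \<i>) * (h * V c) \<or> d - z = (s + \<i>) * (h * V c)"
      unfolding sqrt_3_s by (auto simp: algebra_simps)
    then show ?thesis using norm_s_i Vc h(1) by (auto simp: norm_mult norm_hexagon)
  qed
  have "1 + r \<le> cmod (d - z) \<and> (cmod (d - z) = 1 + r \<longrightarrow> ?R)"
  proof (cases "2 * sqrt 3 \<le> cmod (d - c)")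
    case True
    have "cmod (d - c) \<le> cmod (d - z) + cmod (z - c)"
      using norm_triangle_ineq[of "d - z" "z - c"] by simp
    with True have "1 + r < cmod (d - z)"
      using block_near[OF Vc(1) z] sqrt_3_bounds r_lt by linarith
    then show ?thesis by simp
  next
    case False
    then obtain g where g: "g \<in> hexagon" "d = c + (sqrt 3 - \<i>) * (g * V c)"
      using S_neighbour[OF c _ dc] d by auto
    then have "cmod (d - c) = 2" using norm_sqrt_3_i Vc by (simp add: norm_mult norm_hexagon)
    show ?thesis
    proof (cases "z = c")
      case True
      then show ?thesis using \<open>cmod (d - c) = 2\<close> r_lt by simp
    next
      case False
      then obtain h where h: "h \<in> hexagon" "z = c + complex_of_real (2 * r) * (h * V c)"
        using z by (auto simp: block_def)
      obtain k where k: "k \<in> hexagon" "k * h = 1" using h(1) by (rule hexagon_inverse)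
      have gk: "g = (g * k) * h" using k by simp
      have gkH: "g * k \<in> hexagon" using hexagon_mult g k by blast
      have "d - z = ((sqrt 3 - \<i>) * (g * k) - 2 * r) * (h * V c)"
        unfolding g(2) h(2) by (subst gk) (simp add: algebra_simps)
      then have n: "cmod (d - z) = cmod ((sqrt 3 - \<i>) * (g * k) - 2 * r)"
        using Vc h by (simp add: norm_mult norm_hexagon)
      have "?R" if "g * k = 1 \<or> g * k = omega"
        using that
      proof
        assume "g * k = 1"
        then have "g = h" using gk by simp
        then show ?R using g h by blast
      next
        assume "g * k = omega"
        then have "g = omega * h" using gk by simp
        then have "d = c + (sqrt 3 + \<i>) * (h * V c)"
          by (simp add: g(2) mult.assoc flip: sqrt_3_i_omega)
        then show ?R using h by blast
      qed
      then show ?thesis unfolding n using outer_unit_dist[OF gkH] by blast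
    qed
  qed
  then show "1 + r \<le> cmod (d - z)" "cmod (d - z) = 1 + r \<longleftrightarrow> ?R" using R by blast+
qed

lemma packing_P: "packing P"
proof -
  have "radius D + radius E \<le> dist (centre D) (centre E)" if "D \<in> P" "E \<in> P" "D \<noteq> E" for D E
  proof -
    have DE: "(\<exists>d\<in>C - S. D = (d, 1)) \<or> (\<exists>c\<in>S. \<exists>z\<in>block c (V c). D = (z, r))" if "D \<in> P" for D
      using that by (auto simp: P_def)
    have uu: "2 \<le> cmod (d - e)" if "d \<in> C - S" "e \<in> C - S" "d \<noteq> e" for d e
      using C_separated that by (auto simp: pairwise_def)
    have bb: "2 * r \<le> cmod (z - z')" if "c \<in> S" "d \<in> S" "z \<in> block c (V c)" "z' \<in> block d (V d)" "z \<noteq> z'" for c d z z'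
      using block_separated[OF V, of c z c z'] blocks_apart[of d c z' z] that by (cases "c = d") auto
    consider d e where "d \<in> C - S" "e \<in> C - S" "D = (d, 1)" "E = (e, 1)"
      | d c z where "d \<in> C - S" "c \<in> S" "z \<in> block c (V c)" "D = (d, 1)" "E = (z, r)"
      | d c z where "d \<in> C - S" "c \<in> S" "z \<in> block c (V c)" "D = (z, r)" "E = (d, 1)"
      | c z c' z' where "c \<in> S" "z \<in> block c (V c)" "c' \<in> S" "z' \<in> block c' (V c')" "D = (z, r)" "E = (z', r)"
      using DE[OF \<open>D \<in> P\<close>] DE[OF \<open>E \<in> P\<close>] by blast
    then show ?thesis
    proof cases
      case 1
      then show ?thesis using uu[of d e] \<open>D \<noteq> E\<close> by (simp add: dist_norm)
    next
      case 2
      then show ?thesis using block_unit_dist(1)[of c d z] by (simp add: dist_norm)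
    next
      case 3
      then show ?thesis using block_unit_dist(1)[of c d z] by (simp add: dist_norm norm_minus_commute)
    next
      case 4
      then show ?thesis using bb[of c c' z z'] \<open>D \<noteq> E\<close> by (simp add: dist_norm)
    qed
  qed
  moreover have "0 < radius D" if "D \<in> P" for D
    using that by (auto simp: P_def)
  ultimately show ?thesis by (simp add: packing_iff)
qed

end

section \<open>The neighbours of each kind of disc\<close>

lemma sqrt_3_i_mult: "(sqrt 3 - \<i>) * (sqrt 3 + \<i>) = 4" "(sqrt 3 + \<i>) * (sqrt 3 - \<i>) = 4"
  "(1 - omega) * (sqrt 3 + \<i>) = sqrt 3 - \<i>"
  by (simp_all add: complex_eq_iff)

text \<open>The two factors have product 4. This translates directions at the centre of a block into
  directions at a unit disc of its ring.\<close>

lemma sqrt_3_i_cancel: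
  "(sqrt 3 - \<i>) * a = - 2 * b \<Longrightarrow> a = - (sqrt 3 + \<i>) / 2 * b"
  "(sqrt 3 + \<i>) * a = - 2 * b \<Longrightarrow> a = - (sqrt 3 - \<i>) / 2 * b"
proof -
  have *: "a = - y / 2 * b" if "x * a = - 2 * b" "y * x = 4" for x y :: complex
  proof -
    have "a = y * (x * a) / 4" using that(2) by (simp flip: mult.assoc)
    then show ?thesis unfolding that(1) by simp
  qed
  show "(sqrt 3 - \<i>) * a = - 2 * b \<Longrightarrow> a = - (sqrt 3 + \<i>) / 2 * b"
    "(sqrt 3 + \<i>) * a = - 2 * b \<Longrightarrow> a = - (sqrt 3 - \<i>) / 2 * b"
    using *[OF _ sqrt_3_i_mult(2)] *[OF _ sqrt_3_i_mult(1)] by blast+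
qed

context block_lattice
begin

lemma unit_in_P: "(d, 1) \<in> P \<longleftrightarrow> d \<in> C - S"
  by (auto simp: P_def)

lemma small_in_P: "(z, r) \<in> P \<longleftrightarrow> (\<exists>c\<in>S. z \<in> block c (V c))"
  by (auto simp: P_def)

lemma P_cases:
  assumes "E \<in> P"
  obtains d where "d \<in> C - S" "E = (d, 1)" | c z where "c \<in> S" "z \<in> block c (V c)" "E = (z, r)"
  using assms by (auto simp: P_def)

lemma neighbours_centre:
  assumes c: "c \<in> S"
  shows "neighbours P (c, r) = small_corona c (V c)"
proof (intro set_eqI iffI)
  fix E assume "E \<in> neighbours P (c, r)"
  then have E: "E \<in> P" "tangent (c, r) E" by (auto simp: neighbours_def)
  from E(1) show "E \<in> small_corona c (V c)"
  proof (cases rule: P_cases)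
    case (1 d)
    then have "2 \<le> cmod (d - c)"
      using pairwiseD[OF C_separated, of d c] S_C c by auto
    then show ?thesis using E 1 r_lt by (simp add: tangent_Pair)
  next
    case (2 c' z)
    then have z: "cmod (z - c) = 2 * r" using E by (simp add: tangent_Pair)
    moreover have "c \<in> block c (V c)" by (simp add: block_def)
    ultimately have "c' = c" using blocks_apart[of c c' c z] 2 c by auto
    then have "z \<in> block c (V c)" "z \<noteq> c" using 2 z by auto
    then show ?thesis using 2 by (auto simp: block_def small_corona_def)
  qed
next
  fix E assume E: "E \<in> small_corona c (V c)"
  then obtain h where h: "h \<in> hexagon" "E = (c + complex_of_real (2 * r) * (h * V c), r)"
    by (auto simp: small_corona_def)
  then have "E \<in> P" using c by (auto simp: small_in_P block_def)
  then show "E \<in> neighbours P (c, r)"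
    using h V[OF c] by (simp add: neighbours_def tangent_Pair norm_mult norm_hexagon)
qed

lemma neighbours_outer:
  assumes c: "c \<in> S" and h: "h \<in> hexagon"
  defines "v \<equiv> h * V c"
  defines "x \<equiv> c + complex_of_real (2 * r) * v"
  shows "neighbours P (x, r) = mixed_corona x (- v)"
proof -
  have v: "cmod v = 1" using V[OF c] h by (simp add: v_def norm_mult norm_hexagon)
  have mixed: "mixed_corona x (- v) = {(c + (sqrt 3 - \<i>) * v, 1), (c + (sqrt 3 + \<i>) * v, 1),
    (c + complex_of_real (2 * r) * (omega * v), r), (c, r), (c + complex_of_real (2 * r) * ((1 - omega) * v), r)}"
    unfolding mixed_corona_def sqrt_3_s by (simp add: x_def algebra_simps)
  have x: "x \<in> block c (V c)" using h by (auto simp: x_def v_def block_def)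
  show ?thesis
  proof (intro set_eqI iffI)
    fix E assume "E \<in> neighbours P (x, r)"
    then have E: "E \<in> P" "tangent (x, r) E" by (auto simp: neighbours_def)
    from E(1) show "E \<in> mixed_corona x (- v)"
    proof (cases rule: P_cases)
      case (1 d)
      then have "cmod (d - x) = 1 + r" using E by (simp add: tangent_Pair)
      then obtain h' where h': "x = c + complex_of_real (2 * r) * (h' * V c)"
        "d = c + (sqrt 3 - \<i>) * (h' * V c) \<or> d = c + (sqrt 3 + \<i>) * (h' * V c)"
        using block_unit_dist(2)[OF c 1(1) x] by blast
      then have "h' * V c = v" by (simp add: x_def)
      then show ?thesis using h'(2) 1 by (auto simp: mixed)
    next
      case (2 c' z)
      then have z: "cmod (z - x) = 2 * r" using E by (simp add: tangent_Pair)
      then have "c' = c" using blocks_apart[of c c' x z] 2 c x by auto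
      then consider "z = c" | g where "g \<in> hexagon" "z = c + complex_of_real (2 * r) * (g * V c)"
        using 2 by (auto simp: block_def)
      then show ?thesis
      proof cases
        case 1
        then show ?thesis using 2 by (simp add: mixed)
      next
        case (2 g)
        have "z - x = complex_of_real (2 * r) * ((g - h) * V c)"
          unfolding 2(2) by (simp add: x_def v_def algebra_simps)
        then have "2 * r * cmod (g - h) = 2 * r"
          using z V[OF c] by (simp only: norm_mult) simp
        then have "g = omega * h \<or> g = (1 - omega) * h"
          using hexagon_adjacent[OF 2(1) h] by simp
        then have "g * V c = omega * v \<or> g * V c = (1 - omega) * v"
          by (auto simp: v_def)
        then show ?thesis
          using 2(2) \<open>E = (z, r)\<close> by (auto simp: mixed simp del: of_real_mult)
      qed
    qed
  next
    fix E assume E: "E \<in> mixed_corona x (- v)"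
    have tan: "tangent (x, r) E"
    proof -
      have "cmod (1 - omega) = 1" by (rule norm_hexagon) simp
      then show ?thesis
        using E v norm_s_i unfolding mixed_corona_def
        by (elim insertE emptyE) (simp_all add: tangent_Pair norm_mult add.commute)
    qed
    \<comment> \<open>Lattice neighbours of a centre in \<open>S\<close> remain unit discs, since
      \<open>S\<close> has no two points at distance 2.\<close>
    have C2: "d \<in> C - S" if "d = c + (sqrt 3 - \<i>) * (g * V c)" "g \<in> hexagon" for d g
    proof -
      have "cmod (d - c) = 2" using that V[OF c] norm_sqrt_3_i by (simp add: norm_mult norm_hexagon)
      then show ?thesis using independent[OF c] V_C[OF c] that by blast
    qed
    have "c + (sqrt 3 - \<i>) * v \<in> C - S" by (rule C2[OF _ h]) (simp add: v_def)
    moreover have "c + (sqrt 3 + \<i>) * v \<in> C - S"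
      by (rule C2[OF _ hexagon_omega_mult[OF h]]) (simp add: v_def mult.assoc flip: sqrt_3_i_omega)
    moreover have "c + complex_of_real (2 * r) * (g * v) \<in> block c (V c)" if "g \<in> hexagon" for g
      using hexagon_mult[OF that h] by (auto simp: block_def v_def simp flip: mult.assoc)
    moreover have "c \<in> block c (V c)" by (simp add: block_def)
    ultimately have "E \<in> P"
      using E c omega_in_hexagon one_minus_omega_in_hexagon unfolding mixed
      by (elim insertE emptyE) (simp_all only: unit_in_P small_in_P, blast+)
    with tan show "E \<in> neighbours P (x, r)" by (simp add: neighbours_def)
  qed
qed

text \<open>A lattice neighbour carrying a block is replaced by the two outer discs that face
  \<open>d\<close>, placed symmetrically about the direction toward the block.\<close>

lemma neighbours_unit:
  assumes d: "d \<in> C - S" and U: "cmod U = 1" "\<And>h. h \<in> hexagon \<Longrightarrow> d + 2 * (h * U) \<in> C"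
  shows "neighbours P (d, 1) = (\<Union>h\<in>hexagon. if d + 2 * (h * U) \<in> S
    then {(d + (2 - sqrt 3 * r - \<i> * r) * (h * U), r), (d + (2 - sqrt 3 * r + \<i> * r) * (h * U), r)}
    else {(d + 2 * (h * U), 1)})" (is "_ = ?R")
proof (intro set_eqI iffI)
  have near: "\<exists>h\<in>hexagon. e = d + 2 * (h * U)" if "e \<in> C" "cmod (e - d) = 2" for e
    using hexagonal_neighbours[OF C_separated U] that by blast
  {
    fix E assume "E \<in> neighbours P (d, 1)"
    then have E: "E \<in> P" "tangent (d, 1) E" by (auto simp: neighbours_def)
    from E(1) show "E \<in> ?R"
    proof (cases rule: P_cases)
      case (1 e)
      then obtain h where "h \<in> hexagon" "e = d + 2 * (h * U)"
        using near[of e] E by (auto simp: tangent_Pair)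
      then show ?thesis using 1 by (auto intro!: bexI[of _ h])
    next
      case (2 c z)
      then have "cmod (d - z) = 1 + r" using E by (simp add: tangent_Pair norm_minus_commute)
      then obtain h where h: "h \<in> hexagon" "z = c + complex_of_real (2 * r) * (h * V c)"
        "d = c + (sqrt 3 - \<i>) * (h * V c) \<or> d = c + (sqrt 3 + \<i>) * (h * V c)"
        using block_unit_dist(2)[OF 2(1) d 2(2)] by blast
      have "cmod (c - d) = 2"
        using h(1,3) V[OF 2(1)] norm_sqrt_3_i by (auto simp: norm_mult norm_hexagon)
      then obtain k where k: "k \<in> hexagon" "c = d + 2 * (k * U)"
        using near[of c] S_C 2 by auto
      have "z = d + (2 - sqrt 3 * r - \<i> * r) * (k * U) \<or> z = d + (2 - sqrt 3 * r + \<i> * r) * (k * U)"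
        using h(3)
      proof
        assume "d = c + (sqrt 3 - \<i>) * (h * V c)"
        then have "(sqrt 3 - \<i>) * (h * V c) = d - c" by (metis add_diff_cancel_left')
        also have "d - c = - 2 * (k * U)" using k(2) by simp
        finally have "h * V c = - (sqrt 3 + \<i>) / 2 * (k * U)" by (rule sqrt_3_i_cancel)
        then have "z = d + 2 * (k * U) + complex_of_real (2 * r) * (- (sqrt 3 + \<i>) / 2 * (k * U))"
          by (simp only: h(2) k(2)[symmetric])
        also have "\<dots> = d + (2 - sqrt 3 * r - \<i> * r) * (k * U)" by (simp add: field_simps)
        finally show ?thesis ..
      next
        assume "d = c + (sqrt 3 + \<i>) * (h * V c)"
        then have "(sqrt 3 + \<i>) * (h * V c) = d - c" by (metis add_diff_cancel_left')
        also have "d - c = - 2 * (k * U)" using k(2) by simp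
        finally have "h * V c = - (sqrt 3 - \<i>) / 2 * (k * U)" by (rule sqrt_3_i_cancel)
        then have "z = d + 2 * (k * U) + complex_of_real (2 * r) * (- (sqrt 3 - \<i>) / 2 * (k * U))"
          by (simp only: h(2) k(2)[symmetric])
        also have "\<dots> = d + (2 - sqrt 3 * r + \<i> * r) * (k * U)" by (simp add: field_simps)
        finally show ?thesis ..
      qed
      then show ?thesis using k 2 by (auto intro!: bexI[of _ k])
    qed
  next
    fix E assume "E \<in> ?R"
    then obtain h where h: "h \<in> hexagon" "E \<in> (if d + 2 * (h * U) \<in> S
      then {(d + (2 - sqrt 3 * r - \<i> * r) * (h * U), r), (d + (2 - sqrt 3 * r + \<i> * r) * (h * U), r)}
      else {(d + 2 * (h * U), 1)})" by blast
    define w where "w = h * U"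
    have w: "cmod w = 1" using h U by (simp add: w_def norm_mult norm_hexagon)
    show "E \<in> neighbours P (d, 1)"
    proof (cases "d + 2 * w \<in> S")
      case False
      then have "E = (d + 2 * w, 1)" using h(2) by (simp add: w_def)
      then show ?thesis using False U(2)[OF h(1)] w
        by (simp add: neighbours_def unit_in_P tangent_Pair norm_mult w_def)
    next
      case True
      define c where "c = d + 2 * w"
      have c: "c \<in> S" using True by (simp add: c_def)
      then have "d \<noteq> c" using d by auto
      moreover have "cmod (d - c) = 2" using w by (simp add: c_def norm_mult)
      ultimately obtain g where g: "g \<in> hexagon" "d = c + (sqrt 3 - \<i>) * (g * V c)"
        using S_neighbour[OF c, of d] d sqrt_3_bounds by auto
      have "(sqrt 3 - \<i>) * (g * V c) = - 2 * w" using g(2) unfolding c_def by (simp add: algebra_simps)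
      then have gV: "g * V c = - (sqrt 3 + \<i>) / 2 * w" by (rule sqrt_3_i_cancel)
      have "(1 - omega) * (g * V c) = - ((1 - omega) * (sqrt 3 + \<i>)) / 2 * w"
        unfolding gV by (simp add: algebra_simps)
      \<comment> \<open>\<open>d\<close> is also the second unit disc of the outer disc one turn
        back, in direction \<open>(1 - omega) * g\<close>.\<close>
      then have gV': "(1 - omega) * g * V c = - (sqrt 3 - \<i>) / 2 * w"
        unfolding sqrt_3_i_mult by (simp add: mult.assoc)
      have "d + (2 - sqrt 3 * r - \<i> * r) * w = c + complex_of_real (2 * r) * (g * V c)"
        unfolding gV unfolding c_def by (simp add: field_simps)
      then have 1: "(d + (2 - sqrt 3 * r - \<i> * r) * w, r) \<in> P"
        using c g(1) unfolding small_in_P block_def by blast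
      have "d + (2 - sqrt 3 * r + \<i> * r) * w = c + complex_of_real (2 * r) * ((1 - omega) * g * V c)"
        unfolding gV' unfolding c_def by (simp add: field_simps)
      then have 2: "(d + (2 - sqrt 3 * r + \<i> * r) * w, r) \<in> P"
        using c hexagon_mult[OF one_minus_omega_in_hexagon g(1)] unfolding small_in_P block_def by blast
      have n: "cmod (2 - sqrt 3 * r + \<i> * r) = 1 + r"
        unfolding unit_block_angle(3)[symmetric]
        by (simp only: norm_mult norm_of_real norm_cis abs_one_plus_r mult_1_right)
      have "2 - sqrt 3 * r - \<i> * r = cnj (2 - sqrt 3 * r + \<i> * r)" by simp
      then have n': "cmod (2 - sqrt 3 * r - \<i> * r) = 1 + r" by (simp only: complex_mod_cnj n)
      have "E \<in> {(d + (2 - sqrt 3 * r - \<i> * r) * w, r), (d + (2 - sqrt 3 * r + \<i> * r) * w, r)}"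
        using h(2) True by (simp add: w_def)
      then show ?thesis
        using 1 2 n n' w unfolding neighbours_def
        by (elim insertE emptyE) (simp_all only: mem_Collect_eq tangent_Pair add_diff_cancel_left' norm_mult mult_1_right simp_thms)
    qed
  }
qed

section \<open>Angle sums around each kind of disc\<close>

lemma concat_upt_corona:
  assumes "cmod u = 1" "0 < radius D" "\<And>k p. p \<in> set (L k) \<Longrightarrow> 0 < fst p"
    and ne: "\<And>k :: nat. L k \<noteq> []"
    and nbs: "(\<Union>k\<in>{..<6}. polar_disc D u ` set (L k)) = neighbours Q D"
    and "\<And>k. k < 6 \<Longrightarrow> successively (\<lambda>p q. snd q = snd p + corona_angle (radius D) (fst p) (fst q)) (L k)"
    and "\<And>k. k < 6 \<Longrightarrow> snd (hd (L (Suc k))) = snd (last (L k)) + corona_angle (radius D) (fst (last (L k))) (fst (hd (L (Suc k))))"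
    and closed: "hd (L 6) = (fst (hd (L 0)), snd (hd (L 0)) + 2 * pi)"
  shows "\<exists>Ds. corona Q D Ds \<and>
        (\<forall>i<length Ds. tangent (Ds ! i) (Ds ! (Suc i mod length Ds))) \<and>
        (\<Sum>i<length Ds.
           angle_at (centre D) (centre (Ds ! i)) (centre (Ds ! (Suc i mod length Ds)))) = 2 * pi"
proof (rule corona_criterion_angles)
  let ?ps = "concat (map L [0..<6])"
  have "[0..<6] = 0 # [1..<6]" by (simp add: upt_conv_Cons)
  then have hd: "hd ?ps = hd (L 0)" and "?ps \<noteq> []" using ne[of 0] by simp_all
  then show "?ps \<noteq> []" by simp
  show "polar_disc D u ` set ?ps = neighbours Q D"
    unfolding nbs[symmetric] by (auto simp: image_UN)
  show "successively (\<lambda>p q. snd q = snd p + corona_angle (radius D) (fst p) (fst q))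
      (?ps @ [(fst (hd ?ps), snd (hd ?ps) + 2 * pi)])"
    unfolding hd closed[symmetric] by (rule successively_concat_upt) (use assms in auto)
qed (use assms in auto)

lemma hexagon_angle: "cis (real k * (pi / 3)) = omega ^ k" "cis (real k * (pi / 3) + a) = omega ^ k * cis a"
  "cis (real k * (pi / 3) - a) = omega ^ k * cnj (cis a)"
  by (simp_all add: omega_power cis_mult cis_cnj)

lemma corona_centre:
  assumes c: "c \<in> S"
  shows "\<exists>Ds. corona P (c, r) Ds \<and>
        (\<forall>i<length Ds. tangent (Ds ! i) (Ds ! (Suc i mod length Ds))) \<and>
        (\<Sum>i<length Ds.
           angle_at (centre (c, r)) (centre (Ds ! i)) (centre (Ds ! (Suc i mod length Ds)))) = 2 * pi"
proof (rule concat_upt_corona[where u = "V c" and L = "\<lambda>k. [(r, k * (pi / 3))]"])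
  have "polar_disc (c, r) (V c) (r, real k * (pi / 3)) = (c + complex_of_real (2 * r) * (omega ^ k * V c), r)" for k
    unfolding polar_disc_def snd_conv fst_conv hexagon_angle by simp
  then show "(\<Union>k\<in>{..<6}. polar_disc (c, r) (V c) ` set [(r, real k * (pi / 3))]) = neighbours P (c, r)"
    unfolding neighbours_centre[OF c] small_corona_def hexagon_power by auto
qed (use V[OF c] in \<open>auto simp: corona_angle_small algebra_simps\<close>)

lemma corona_unit:
  assumes d: "d \<in> C - S"
  shows "\<exists>Ds. corona P (d, 1) Ds \<and>
        (\<forall>i<length Ds. tangent (Ds ! i) (Ds ! (Suc i mod length Ds))) \<and>
        (\<Sum>i<length Ds.
           angle_at (centre (d, 1)) (centre (Ds ! i)) (centre (Ds ! (Suc i mod length Ds)))) = 2 * pi"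
proof -
  obtain U where U: "cmod U = 1" "\<And>h. h \<in> hexagon \<Longrightarrow> d + 2 * (h * U) \<in> C"
    using lattice d unfolding hexagonal_def by blast
  define b where "b = corona_angle 1 1 r"
  define K where "K k \<longleftrightarrow> d + 2 * (omega ^ k * U) \<in> S" for k :: nat
  \<comment> \<open>A block contributes two discs on either side of the old direction, so the list
    may begin at a negative angle.\<close>
  define L where "L k = (if K k then [(r, k * (pi / 3) - (pi / 3 - b)), (r, k * (pi / 3) + (pi / 3 - b))]
    else [(1, k * (pi / 3))])" for k :: nat
  \<comment> \<open>Consecutive neighbours are at distance 2 and cannot both carry blocks, so discs
    of two different blocks never follow each other.\<close>
  have K: "\<not> K (Suc k)" if "K k" for k
  proof -
    have "d + 2 * (omega ^ Suc k * U) - (d + 2 * (omega ^ k * U)) = 2 * (omega - 1) * (omega ^ k * U)"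
      by (simp add: algebra_simps)
    moreover have "cmod (omega - 1) = 1" by (rule norm_hexagon) (simp add: hexagon_def)
    ultimately have "cmod (d + 2 * (omega ^ Suc k * U) - (d + 2 * (omega ^ k * U))) = 2"
      using U(1) by (simp only: norm_mult norm_power norm_omega) simp
    then show ?thesis using independent that unfolding K_def by blast
  qed
  have angles: "corona_angle 1 1 1 = pi / 3" "corona_angle 1 1 r = b" "corona_angle 1 r 1 = b"
    "corona_angle 1 r r = 2 * pi / 3 - 2 * b"
    using corona_angle_units unit_block_angle by (simp_all add: b_def)
  show ?thesis
  proof (rule concat_upt_corona[where u = U and L = L])
    have polar: "polar_disc (d, 1) U (1, real k * (pi / 3)) = (d + 2 * (omega ^ k * U), 1)"
      "polar_disc (d, 1) U (r, real k * (pi / 3) - (pi / 3 - b)) = (d + (2 - sqrt 3 * r - \<i> * r) * (omega ^ k * U), r)"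
      "polar_disc (d, 1) U (r, real k * (pi / 3) + (pi / 3 - b)) = (d + (2 - sqrt 3 * r + \<i> * r) * (omega ^ k * U), r)" for k
    proof -
      have 1: "(1 + r) * cis (pi / 3 - b) = 2 - sqrt 3 * r + \<i> * r"
        using unit_block_angle(3) by (simp add: b_def)
      have "(1 + r) * cnj (cis (pi / 3 - b)) = cnj ((1 + r) * cis (pi / 3 - b))"
        by simp
      also have "\<dots> = 2 - sqrt 3 * r - \<i> * r" unfolding 1 by simp
      finally have 2: "(1 + r) * cnj (cis (pi / 3 - b)) = 2 - sqrt 3 * r - \<i> * r" .
      show "polar_disc (d, 1) U (1, real k * (pi / 3)) = (d + 2 * (omega ^ k * U), 1)"
        unfolding polar_disc_def snd_conv fst_conv hexagon_angle by simp
      show "polar_disc (d, 1) U (r, real k * (pi / 3) - (pi / 3 - b)) = (d + (2 - sqrt 3 * r - \<i> * r) * (omega ^ k * U), r)"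
        unfolding polar_disc_def snd_conv fst_conv hexagon_angle 2[symmetric] by simp
      show "polar_disc (d, 1) U (r, real k * (pi / 3) + (pi / 3 - b)) = (d + (2 - sqrt 3 * r + \<i> * r) * (omega ^ k * U), r)"
        unfolding polar_disc_def snd_conv fst_conv hexagon_angle 1[symmetric] by simp
    qed
    have "polar_disc (d, 1) U ` set (L k) = (if d + 2 * (omega ^ k * U) \<in> S
      then {(d + (2 - sqrt 3 * r - \<i> * r) * (omega ^ k * U), r), (d + (2 - sqrt 3 * r + \<i> * r) * (omega ^ k * U), r)}
      else {(d + 2 * (omega ^ k * U), 1)})" for k
      by (cases "d + 2 * (omega ^ k * U) \<in> S")
        (simp_all only: L_def K_def if_True if_False list.set image_insert image_empty polar)
    then show "(\<Union>k\<in>{..<6}. polar_disc (d, 1) U ` set (L k)) = neighbours P (d, 1)"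
      by (subst neighbours_unit[OF d U(1)]) (use U(2) in \<open>simp_all only: hexagon_power image_image\<close>)
    have "K 6 \<longleftrightarrow> K 0" by (simp add: K_def omega_power_6)
    then show "hd (L 6) = (fst (hd (L 0)), snd (hd (L 0)) + 2 * pi)"
      by (simp add: L_def)
    show "snd (hd (L (Suc k))) = snd (last (L k)) + corona_angle (radius (d, 1)) (fst (last (L k))) (fst (hd (L (Suc k))))" for k
      using K[of k] by (auto simp: L_def angles algebra_simps)
  qed (use U in \<open>auto simp: L_def angles algebra_simps split: if_splits\<close>)
qed

lemma corona_outer:
  assumes c: "c \<in> S" and h: "h \<in> hexagon"
  defines "x \<equiv> c + complex_of_real (2 * r) * (h * V c)"
  shows "\<exists>Ds. corona P (x, r) Ds \<and>
        (\<forall>i<length Ds. tangent (Ds ! i) (Ds ! (Suc i mod length Ds))) \<and>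
        (\<Sum>i<length Ds.
           angle_at (centre (x, r)) (centre (Ds ! i)) (centre (Ds ! (Suc i mod length Ds)))) = 2 * pi"
proof (rule corona_criterion_angles)
  let ?u = "- (h * V c)"
  \<comment> \<open>The gaps \<open>pi / 3\<close>, \<open>pi / 3\<close>, \<open>alpha\<close>,
    \<open>4 * pi / 3 - 2 * alpha\<close> and \<open>alpha\<close> make a full turn.\<close>
  let ?ps = "[(r, - (pi / 3)), (r, 0), (r, pi / 3), (1, pi / 3 + alpha), (1, 5 * pi / 3 - alpha)]"
  show "cmod ?u = 1" using V[OF c] h by (simp add: norm_mult norm_hexagon)
  have 1: "(r + 1) * cis (5 * pi / 3 - alpha) = - (s + \<i>)"
  proof -
    have "5 * pi / 3 - alpha = pi + (2 * pi / 3 - alpha)" by simp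
    then have "cis (5 * pi / 3 - alpha) = - cis (2 * pi / 3 - alpha)"
      by (simp only: cis_mult[symmetric] cis_pi) simp
    then show ?thesis using cis_half_angle by (simp add: add.commute)
  qed
  have 2: "(r + 1) * cis (pi / 3 + alpha) = - (s - \<i>)"
  proof -
    have "cis (pi - y) = - cnj (cis y)" for y
      by (simp add: complex_eq_iff)
    from this[of "2 * pi / 3 - alpha"] have "cis (pi / 3 + alpha) = - cnj (cis (2 * pi / 3 - alpha))"
      by (simp add: algebra_simps)
    then have "(r + 1) * cis (pi / 3 + alpha) = - cnj ((1 + r) * cis (2 * pi / 3 - alpha))"
      by (simp add: add.commute)
    then show ?thesis unfolding cis_half_angle by simp
  qed
  have 3: "cis (- (pi / 3)) = 1 - omega"
    by (simp add: complex_eq_iff cos_60 sin_60)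
  have "polar_disc (x, r) ?u (r, - (pi / 3)) = (x + complex_of_real (2 * r) * ((1 - omega) * ?u), r)"
    "polar_disc (x, r) ?u (r, 0) = (x + complex_of_real (2 * r) * ?u, r)"
    "polar_disc (x, r) ?u (r, pi / 3) = (x + complex_of_real (2 * r) * (omega * ?u), r)"
    "polar_disc (x, r) ?u (1, pi / 3 + alpha) = (x - (s - \<i>) * ?u, 1)"
    "polar_disc (x, r) ?u (1, 5 * pi / 3 - alpha) = (x - (s + \<i>) * ?u, 1)"
    unfolding polar_disc_def fst_conv snd_conv 1 2 3 cis_pi_div_3 cis_zero
    by (simp_all add: algebra_simps)
  then have "polar_disc (x, r) ?u ` set ?ps = mixed_corona x ?u"
    unfolding mixed_corona_def by (simp only: list.set image_insert image_empty) blast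
  then show "polar_disc (x, r) ?u ` set ?ps = neighbours P (x, r)"
    using neighbours_outer[OF c h] by (simp add: x_def)
  show "successively (\<lambda>p q. snd q = snd p + corona_angle (radius (x, r)) (fst p) (fst q))
      (?ps @ [(fst (hd ?ps), snd (hd ?ps) + 2 * pi)])"
    by (simp add: corona_angle_small)
qed auto

theorem compact_packing_using_P:
  assumes "S \<noteq> {}"
  shows "compact_packing_using r P"
proof -
  have "\<exists>Ds. corona P D Ds \<and>
        (\<forall>i<length Ds. tangent (Ds ! i) (Ds ! (Suc i mod length Ds))) \<and>
        (\<Sum>i<length Ds.
           angle_at (centre D) (centre (Ds ! i)) (centre (Ds ! (Suc i mod length Ds)))) = 2 * pi"
    if "D \<in> P" for D
    using that
  proof (cases rule: P_cases)
    case (1 d)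
    then show ?thesis using corona_unit[OF 1(1)] by simp
  next
    case (2 c z)
    from 2(2) consider "z = c" | h where "h \<in> hexagon" "z = c + complex_of_real (2 * r) * (h * V c)"
      by (auto simp: block_def)
    then show ?thesis
    proof cases
      case 1
      then show ?thesis using corona_centre[OF 2(1)] 2 by simp
    next
      case (2 h)
      then show ?thesis using corona_outer[OF \<open>c \<in> S\<close> 2(1)] \<open>D = (z, r)\<close> by simp
    qed
  qed
  then have "compact_packing P"
    using packing_P by (simp add: compact_packing_def)
  moreover have "\<forall>D\<in>P. radius D = 1 \<or> radius D = r" by (auto simp: P_def)
  moreover obtain c where c: "c \<in> S" using assms by blast
  then have "(c, r) \<in> P" by (auto simp: small_in_P block_def)
  moreover have "c + (sqrt 3 - \<i>) * (1 * V c) \<in> C - S"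
  proof -
    have "cmod (c + (sqrt 3 - \<i>) * (1 * V c) - c) = 2"
      using V[OF c] norm_sqrt_3_i by (simp add: norm_mult)
    then show ?thesis using independent[OF c] V_C[OF c one_in_hexagon] by blast
  qed
  then have "(c + (sqrt 3 - \<i>) * (1 * V c), 1) \<in> P" by (simp add: unit_in_P)
  ultimately show ?thesis unfolding compact_packing_using_def by force
qed

end

section \<open>The value of the radius and the equivalence\<close>

lemma block_radiusI:
  assumes "r = (2 * sqrt 3 + 1 - 2 * sqrt (1 + sqrt 3)) / 3"
  shows "block_radius r"
proof
  define q where "q = sqrt (1 + sqrt 3)"
  have q: "q\<^sup>2 = 1 + sqrt 3" by (simp add: q_def)
  have r: "3 * r = 2 * sqrt 3 + 1 - 2 * q" using assms by (simp add: q_def)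
  \<comment> \<open>Isolating and squaring the nested root leaves three times the quadratic.\<close>
  then have "(3 * r - (2 * sqrt 3 + 1))\<^sup>2 = 4 * q\<^sup>2"
    by (simp add: power2_eq_square)
  then show "3 * r\<^sup>2 + 3 = (2 + 4 * sqrt 3) * r"
    unfolding q by (simp add: power2_eq_square algebra_simps)
  \<comment> \<open>\<open>3 * r\<close> is a difference of larger numbers and must fall between
    1.14 and 1.17, hence the three decimals.\<close>
  have s3: "1732 / 1000 < sqrt 3" "sqrt 3 < 1733 / 1000"
    by (rule real_less_rsqrt real_less_lsqrt; simp add: power2_eq_square)+
  have "1648 / 1000 < q" "q < 1654 / 1000"
    unfolding q_def by (rule real_less_rsqrt real_less_lsqrt; use s3 in \<open>simp add: power2_eq_square\<close>)+
  then show "38 / 100 < r" "r < 39 / 100" using r s3 by linarith+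
qed

text \<open>Choosing a direction \<open>V c\<close> for each block turns the relational definition
  of replacement into an instance of \<open>block_lattice\<close>.\<close>

lemma (in block_radius) block_replacement_compact:
  assumes T: "triangular_lattice_packing T" and S: "S \<subseteq> T" "S \<noteq> {}"
    and independent: "\<forall>D\<in>S. \<forall>E\<in>S. \<not> tangent D E" and P: "block_replacement r T S P"
  shows "compact_packing_using r P"
proof -
  define C S' where "C = centre ` T" and "S' = centre ` S"
  have TC: "T = (\<lambda>c. (c, 1)) ` C"
    using triangular_lattice_packing_centres(2)[OF T] by (simp add: C_def)
  have SS: "S = (\<lambda>c. (c, 1)) ` S'"
  proof -
    have "D = (centre D, 1)" if "D \<in> S" for D
      using that S(1) T by (auto simp: triangular_lattice_packing_def prod_eq_iff)
    then show ?thesis by (force simp: S'_def image_image)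
  qed
  obtain B where B: "\<forall>D\<in>S. hexagonal_block r T D (B D)" "P = (T - S) \<union> (\<Union>D\<in>S. B D)"
    using P unfolding block_replacement_def by blast
  have "\<forall>c\<in>S'. \<exists>v. cmod v = 1 \<and> B (c, 1) = insert (c, r) (small_corona c v) \<and>
    (\<forall>h\<in>hexagon. c + (sqrt 3 - \<i>) * (h * v) \<in> C)"
  proof
    fix c assume "c \<in> S'"
    then have "(c, 1) \<in> S" by (simp add: SS)
    then show "\<exists>v. cmod v = 1 \<and> B (c, 1) = insert (c, r) (small_corona c v) \<and>
      (\<forall>h\<in>hexagon. c + (sqrt 3 - \<i>) * (h * v) \<in> C)"
      unfolding C_def using S(1) B(1) by (intro hexagonal_block_small_corona[OF T]) auto
  qed
  then obtain V where V: "\<And>c. c \<in> S' \<Longrightarrow> cmod (V c) = 1"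
    "\<And>c. c \<in> S' \<Longrightarrow> B (c, 1) = insert (c, r) (small_corona c (V c))"
    "\<And>c h. c \<in> S' \<Longrightarrow> h \<in> hexagon \<Longrightarrow> c + (sqrt 3 - \<i>) * (h * V c) \<in> C"
    by metis
  interpret L: block_lattice r C S' V
  proof
    show "hexagonal C" using triangular_lattice_packing_centres(1)[OF T] by (simp add: C_def)
    show "S' \<subseteq> C" using S(1) by (auto simp: C_def S'_def)
    show "cmod (d - c) \<noteq> 2" if "c \<in> S'" "d \<in> S'" for c d
      using independent that by (auto simp: SS tangent_Pair)
  qed (fact V)+
  have "P = L.P"
    unfolding B(2) L.P_def TC SS by (auto simp: V(2) block_discs)
  moreover have "S' \<noteq> {}" using S(2) by (simp add: S'_def)
  ultimately show ?thesis using L.compact_packing_using_P by simp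
qed

theorem mainTheorem3:
  fixes r :: real
  assumes "r = (2 * sqrt 3 + 1 - 2 * sqrt (1 + sqrt 3)) / 3"
  shows "{P. compact_packing_using r P} =
         {P. \<exists>T S. triangular_lattice_packing T \<and> S \<subseteq> T \<and> S \<noteq> {} \<and>
                (\<forall>D\<in>S. \<forall>E\<in>S. \<not> tangent D E) \<and> block_replacement r T S P}"
proof -
  interpret block_radius r using assms by (rule block_radiusI)
  have "\<exists>T S. triangular_lattice_packing T \<and> S \<subseteq> T \<and> S \<noteq> {} \<and>
    (\<forall>D\<in>S. \<forall>E\<in>S. \<not> tangent D E) \<and> block_replacement r T S P"
    if "compact_packing_using r P" for P
  proof -
    interpret block_packing r P
      by standard (use that in \<open>auto simp: compact_packing_using_def\<close>)
    show ?thesis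
      using that by (intro is_block_replacement) (simp add: compact_packing_using_def)
  qed
  moreover have "compact_packing_using r P" if "\<exists>T S. triangular_lattice_packing T \<and> S \<subseteq> T \<and> S \<noteq> {} \<and>
    (\<forall>D\<in>S. \<forall>E\<in>S. \<not> tangent D E) \<and> block_replacement r T S P" for P
    using that by (elim exE conjE) (rule block_replacement_compact)
  ultimately show ?thesis by (intro Collect_cong iffI)
qed

end
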